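(* Let $B$ be a Poisson Hopf algebra over $k$ with comultiplication $\Delta$, counit $\epsilon$ and antipode $S$. Suppose that $\alpha$ is a Poisson derivation on $B$, that $\delta$ is a derivation on the algebra $B$ with $$\delta(\{a,b\})=\{\delta(a),b\}+\{a,\delta(b)\}+\alpha(a)\delta(b)-\delta(a)\alpha(b)\quad\text{for all } a,b\in B,$$ that $g\in B$ is a group-like element and that $w=\sum w_1\otimes w_2\in B^+\otimes B^+$. Suppose there is a linear map $\eta:B\to k$ such that all of the following hold for all $a,b\in B$: (i) $\alpha(b)=\eta(b_1)b_2=b_1\eta(b_2)+\{g,b\}g^{-1}$; (ii) $\eta(ab)=\epsilon(a)\eta(b)+\epsilon(b)\eta(a)$ and $\eta(\{a,b\})=0$; (iii) $\Delta\delta(b)-\delta(b_1)\otimes b_2-gb_1\otimes\delta(b_2)=\{w,\Delta(b)\}-\Delta(\alpha(b))\,w$; (iv) $\sum S(w_1)w_2=\sum g^{-1}w_1S(w_2)$; (v) $w\otimes 1+(\Delta\otimes\mathrm{Id})(w)=g\otimes w+(\mathrm{Id}\otimes\Delta)(w)$. Then the Poisson polynomial algebra $B[x;\alpha,\delta]_p$ has a unique Poisson Hopf algebra structure with $B$ as a Poisson Hopf subalgebra such that $\epsilon(x)=0$ and $\Delta(x)=g\otimes x+x\otimes 1+w$.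
   Context: $k$ is a field; algebras, coalgebras and tensor products are over $k$. Sweedler notation $\Delta(b)=b_1\otimes b_2$ is used with the summation sign omitted. A Poisson algebra is a commutative $k$-algebra $A$ with a Lie bracket $\{\cdot,\cdot\}$ such that $\{a,bc\}=\{a,b\}c+b\{a,c\}$. For a Poisson algebra $A$, $A\otimes A$ is a Poisson algebra with $\{a\otimes b,c\otimes d\}=ac\otimes\{b,d\}+\{a,c\}\otimes bd$. A Poisson Hopf algebra is a commutative Hopf algebra $B$ with a Poisson bracket such that $\Delta(\{a,b\})=\{\Delta(a),\Delta(b)\}$ for all $a,b\in B$. $B^+=\ker\epsilon$. A Poisson derivation of a Poisson algebra is a $k$-linear map which is a derivation for both the multiplication and the bracket. Under the stated conditions on $\alpha,\delta$, the bracket of $B$ extends uniquely to a Poisson bracket on the polynomial ring $B[x]$ with $\{x,b\}=\alpha(b)x+\delta(b)$ for $b\in B$; this Poisson algebra is the Poisson polynomial algebra $B[x;\alpha,\delta]_p$. *)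

theory Defs
  imports
    "HOL-Library.Poly_Mapping"
    "HOL-Computational_Algebra.Polynomial"
begin

section \<open>Formal linear combinations\<close>

text \<open>
  \<^typ>\<open>'x \<Rightarrow>\<^sub>0 'k\<close> is the free vector space on \<^typ>\<open>'x\<close>.  Tensor products are quotients of such
  spaces.  They depend on the scalar multiplication \<open>scale\<close>, hence are sets of cosets, not types.
\<close>

definition fs_scale :: "'k::field \<Rightarrow> ('x \<Rightarrow>\<^sub>0 'k) \<Rightarrow> ('x \<Rightarrow>\<^sub>0 'k)" where
  "fs_scale c u = Poly_Mapping.map ((*) c) u"

abbreviation gen :: "'x \<Rightarrow> ('x \<Rightarrow>\<^sub>0 'k::field)" where
  "gen x \<equiv> Poly_Mapping.single x 1"

text \<open>The linear extension of a map from the basis \<^typ>\<open>'x\<close> to a vector space with scalar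
  multiplication \<open>s\<close>.\<close>

definition lin_ext ::
    "('k::field \<Rightarrow> 'v::comm_monoid_add \<Rightarrow> 'v) \<Rightarrow> ('x \<Rightarrow> 'v) \<Rightarrow> ('x \<Rightarrow>\<^sub>0 'k) \<Rightarrow> 'v" where
  "lin_ext s f u = (\<Sum>x\<in>Poly_Mapping.keys u. s (Poly_Mapping.lookup u x) (f x))"

text \<open>
  A quotient of a formal space is given by the map \<open>cls\<close> sending a formal combination to its
  coset.  A map induced on quotients is obtained, as in \<^theory>\<open>HOL.Equiv_Relations\<close>, by a union
  over all representatives; when the map is well defined, this is the union of a single coset.
\<close>

definition q_add :: "(('x \<Rightarrow>\<^sub>0 'k::field) \<Rightarrow> ('x \<Rightarrow>\<^sub>0 'k) set) \<Rightarrow>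
    ('x \<Rightarrow>\<^sub>0 'k) set \<Rightarrow> ('x \<Rightarrow>\<^sub>0 'k) set \<Rightarrow> ('x \<Rightarrow>\<^sub>0 'k) set" where
  "q_add cls s t = (\<Union>u\<in>s. \<Union>v\<in>t. cls (u + v))"

definition q_minus :: "(('x \<Rightarrow>\<^sub>0 'k::field) \<Rightarrow> ('x \<Rightarrow>\<^sub>0 'k) set) \<Rightarrow>
    ('x \<Rightarrow>\<^sub>0 'k) set \<Rightarrow> ('x \<Rightarrow>\<^sub>0 'k) set \<Rightarrow> ('x \<Rightarrow>\<^sub>0 'k) set" where
  "q_minus cls s t = (\<Union>u\<in>s. \<Union>v\<in>t. cls (u - v))"

definition q_scale :: "(('x \<Rightarrow>\<^sub>0 'k::field) \<Rightarrow> ('x \<Rightarrow>\<^sub>0 'k) set) \<Rightarrow>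
    'k \<Rightarrow> ('x \<Rightarrow>\<^sub>0 'k) set \<Rightarrow> ('x \<Rightarrow>\<^sub>0 'k) set" where
  "q_scale cls c t = (\<Union>u\<in>t. cls (fs_scale c u))"

definition q_linear :: "(('y \<Rightarrow>\<^sub>0 'k::field) \<Rightarrow> ('y \<Rightarrow>\<^sub>0 'k) set) \<Rightarrow>
    ('x \<Rightarrow> ('y \<Rightarrow>\<^sub>0 'k)) \<Rightarrow> ('x \<Rightarrow>\<^sub>0 'k) set \<Rightarrow> ('y \<Rightarrow>\<^sub>0 'k) set" where
  "q_linear cls F t = (\<Union>u\<in>t. cls (lin_ext fs_scale F u))"

definition q_bilinear :: "(('z \<Rightarrow>\<^sub>0 'k::field) \<Rightarrow> ('z \<Rightarrow>\<^sub>0 'k) set) \<Rightarrow>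
    ('x \<Rightarrow> 'y \<Rightarrow> ('z \<Rightarrow>\<^sub>0 'k)) \<Rightarrow> ('x \<Rightarrow>\<^sub>0 'k) set \<Rightarrow> ('y \<Rightarrow>\<^sub>0 'k) set \<Rightarrow> ('z \<Rightarrow>\<^sub>0 'k) set" where
  "q_bilinear cls F s t =
     (\<Union>u\<in>s. \<Union>v\<in>t. cls (lin_ext fs_scale (\<lambda>x. lin_ext fs_scale (F x) v) u))"


section \<open>The tensor powers $A \otimes A$ and $A \otimes A \otimes A$\<close>

definition null2 :: "('k::field \<Rightarrow> 'a::ab_group_add \<Rightarrow> 'a) \<Rightarrow> ('a \<times> 'a \<Rightarrow>\<^sub>0 'k) set" where
  "null2 scale = module.span fs_scale
     ({gen (a + a', b) - gen (a, b) - gen (a', b) | a a' b. True} \<union>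
      {gen (a, b + b') - gen (a, b) - gen (a, b') | a b b'. True} \<union>
      {gen (scale c a, b) - fs_scale c (gen (a, b)) | c a b. True} \<union>
      {gen (a, scale c b) - fs_scale c (gen (a, b)) | c a b. True})"

definition rel2 ::
    "('k::field \<Rightarrow> 'a::ab_group_add \<Rightarrow> 'a) \<Rightarrow> (('a \<times> 'a \<Rightarrow>\<^sub>0 'k) \<times> ('a \<times> 'a \<Rightarrow>\<^sub>0 'k)) set" where
  "rel2 scale = {(u, v). v - u \<in> null2 scale}"

definition tensor2 :: "('k::field \<Rightarrow> 'a::ab_group_add \<Rightarrow> 'a) \<Rightarrow> ('a \<times> 'a \<Rightarrow>\<^sub>0 'k) set set" where
  "tensor2 scale = UNIV // rel2 scale"

definition cls2 :: "('k::field \<Rightarrow> 'a::ab_group_add \<Rightarrow> 'a) \<Rightarrow>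
    ('a \<times> 'a \<Rightarrow>\<^sub>0 'k) \<Rightarrow> ('a \<times> 'a \<Rightarrow>\<^sub>0 'k) set" where
  "cls2 scale u = rel2 scale `` {u}"

definition tens :: "('k::field \<Rightarrow> 'a::ab_group_add \<Rightarrow> 'a) \<Rightarrow> 'a \<Rightarrow> 'a \<Rightarrow> ('a \<times> 'a \<Rightarrow>\<^sub>0 'k) set" where
  "tens scale a b = cls2 scale (gen (a, b))"

definition null3 :: "('k::field \<Rightarrow> 'a::ab_group_add \<Rightarrow> 'a) \<Rightarrow> ('a \<times> 'a \<times> 'a \<Rightarrow>\<^sub>0 'k) set" where
  "null3 scale = module.span fs_scale
     ({gen (a + a', b, c) - gen (a, b, c) - gen (a', b, c) | a a' b c. True} \<union>
      {gen (a, b + b', c) - gen (a, b, c) - gen (a, b', c) | a b b' c. True} \<union>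
      {gen (a, b, c + c') - gen (a, b, c) - gen (a, b, c') | a b c c'. True} \<union>
      {gen (scale r a, b, c) - fs_scale r (gen (a, b, c)) | r a b c. True} \<union>
      {gen (a, scale r b, c) - fs_scale r (gen (a, b, c)) | r a b c. True} \<union>
      {gen (a, b, scale r c) - fs_scale r (gen (a, b, c)) | r a b c. True})"

definition cls3 :: "('k::field \<Rightarrow> 'a::ab_group_add \<Rightarrow> 'a) \<Rightarrow>
    ('a \<times> 'a \<times> 'a \<Rightarrow>\<^sub>0 'k) \<Rightarrow> ('a \<times> 'a \<times> 'a \<Rightarrow>\<^sub>0 'k) set" where
  "cls3 scale u = {(u, v). v - u \<in> null3 scale} `` {u}"

abbreviation "add2 scale \<equiv> q_add (cls2 scale)"
abbreviation "minus2 scale \<equiv> q_minus (cls2 scale)"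
abbreviation "scale2 scale \<equiv> q_scale (cls2 scale)"
abbreviation "add3 scale \<equiv> q_add (cls3 scale)"

definition mult2 :: "('k::field \<Rightarrow> 'a::comm_ring_1 \<Rightarrow> 'a) \<Rightarrow>
    ('a \<times> 'a \<Rightarrow>\<^sub>0 'k) set \<Rightarrow> ('a \<times> 'a \<Rightarrow>\<^sub>0 'k) set \<Rightarrow> ('a \<times> 'a \<Rightarrow>\<^sub>0 'k) set" where
  "mult2 scale = q_bilinear (cls2 scale) (\<lambda>(a, b) (c, d). gen (a * c, b * d))"

definition bracket2 :: "('k::field \<Rightarrow> 'a::comm_ring_1 \<Rightarrow> 'a) \<Rightarrow> ('a \<Rightarrow> 'a \<Rightarrow> 'a) \<Rightarrow>
    ('a \<times> 'a \<Rightarrow>\<^sub>0 'k) set \<Rightarrow> ('a \<times> 'a \<Rightarrow>\<^sub>0 'k) set \<Rightarrow> ('a \<times> 'a \<Rightarrow>\<^sub>0 'k) set" where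
  "bracket2 scale br =
     q_bilinear (cls2 scale) (\<lambda>(a, b) (c, d). gen (a * c, br b d) + gen (br a c, b * d))"

text \<open>The map $f \otimes h : A \otimes A \to C \otimes C$ for linear maps $f, h : A \to C$, where
  \<open>scale\<close> is the scalar multiplication of the codomain.\<close>

definition tens_map :: "('k::field \<Rightarrow> 'c::ab_group_add \<Rightarrow> 'c) \<Rightarrow> ('a \<Rightarrow> 'c) \<Rightarrow> ('a \<Rightarrow> 'c) \<Rightarrow>
    ('a \<times> 'a \<Rightarrow>\<^sub>0 'k) set \<Rightarrow> ('c \<times> 'c \<Rightarrow>\<^sub>0 'k) set" where
  "tens_map scale f h = q_linear (cls2 scale) (\<lambda>(a, b). gen (f a, h b))"

text \<open>The linear map $A \otimes A \to V$, $a \otimes b \mapsto \varphi(a, b)$, for a bilinear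
  $\varphi$; thus \<open>eval2 scale \<phi> t\<close> is $\sum \varphi(t_1, t_2)$.\<close>

definition eval2 :: "('k::field \<Rightarrow> 'v::ab_group_add \<Rightarrow> 'v) \<Rightarrow> ('a \<Rightarrow> 'a \<Rightarrow> 'v) \<Rightarrow>
    ('a \<times> 'a \<Rightarrow>\<^sub>0 'k) set \<Rightarrow> 'v" where
  "eval2 scale \<phi> t = the_elem (lin_ext scale (\<lambda>(a, b). \<phi> a b) ` t)"

definition tens_left :: "('k::field \<Rightarrow> 'a::ab_group_add \<Rightarrow> 'a) \<Rightarrow>
    'a \<Rightarrow> ('a \<times> 'a \<Rightarrow>\<^sub>0 'k) set \<Rightarrow> ('a \<times> 'a \<times> 'a \<Rightarrow>\<^sub>0 'k) set" where
  "tens_left scale g = q_linear (cls3 scale) (\<lambda>(a, b). gen (g, a, b))"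

definition tens_right :: "('k::field \<Rightarrow> 'a::ab_group_add \<Rightarrow> 'a) \<Rightarrow>
    ('a \<times> 'a \<Rightarrow>\<^sub>0 'k) set \<Rightarrow> 'a \<Rightarrow> ('a \<times> 'a \<times> 'a \<Rightarrow>\<^sub>0 'k) set" where
  "tens_right scale t g = q_linear (cls3 scale) (\<lambda>(a, b). gen (a, b, g)) t"

text \<open>The maps $D \otimes \mathrm{Id}$ and $\mathrm{Id} \otimes D$ from $A \otimes A$ to
  $A \otimes A \otimes A$, for linear $D : A \to A \otimes A$.  The coset does not depend on the
  representative of $D(a)$ that is chosen.\<close>

definition left3 :: "('k::field \<Rightarrow> 'a::ab_group_add \<Rightarrow> 'a) \<Rightarrow> ('a \<Rightarrow> ('a \<times> 'a \<Rightarrow>\<^sub>0 'k) set) \<Rightarrow>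
    ('a \<times> 'a \<Rightarrow>\<^sub>0 'k) set \<Rightarrow> ('a \<times> 'a \<times> 'a \<Rightarrow>\<^sub>0 'k) set" where
  "left3 scale D = q_linear (cls3 scale)
     (\<lambda>(a, b). lin_ext fs_scale (\<lambda>(a1, a2). gen (a1, a2, b)) (SOME u. u \<in> D a))"

definition right3 :: "('k::field \<Rightarrow> 'a::ab_group_add \<Rightarrow> 'a) \<Rightarrow> ('a \<Rightarrow> ('a \<times> 'a \<Rightarrow>\<^sub>0 'k) set) \<Rightarrow>
    ('a \<times> 'a \<Rightarrow>\<^sub>0 'k) set \<Rightarrow> ('a \<times> 'a \<times> 'a \<Rightarrow>\<^sub>0 'k) set" where
  "right3 scale D = q_linear (cls3 scale)
     (\<lambda>(a, b). lin_ext fs_scale (\<lambda>(b1, b2). gen (a, b1, b2)) (SOME u. u \<in> D b))"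


section \<open>Poisson algebras and Poisson Hopf algebras\<close>

locale comm_algebra = vector_space scale
  for scale :: "'k::field \<Rightarrow> 'a::comm_ring_1 \<Rightarrow> 'a" +
  assumes scale_mult_left: "scale c (a * b) = scale c a * b"

locale poisson_algebra = comm_algebra scale
  for scale :: "'k::field \<Rightarrow> 'a::comm_ring_1 \<Rightarrow> 'a" +
  fixes br :: "'a \<Rightarrow> 'a \<Rightarrow> 'a"
  assumes br_linear_left: "Vector_Spaces.linear scale scale (\<lambda>a. br a b)"
    and br_linear_right: "Vector_Spaces.linear scale scale (br a)"
    and br_alternating: "br a a = 0"
    and br_jacobi: "br a (br b c) + br b (br c a) + br c (br a b) = 0"
    and br_leibniz: "br a (b * c) = br a b * c + b * br a c"

locale comm_hopf_algebra = comm_algebra scale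
  for scale :: "'k::field \<Rightarrow> 'a::comm_ring_1 \<Rightarrow> 'a" +
  fixes \<Delta> :: "'a \<Rightarrow> ('a \<times> 'a \<Rightarrow>\<^sub>0 'k) set"
    and \<epsilon> :: "'a \<Rightarrow> 'k"
    and S :: "'a \<Rightarrow> 'a"
  assumes comult_closed: "\<Delta> a \<in> tensor2 scale"
    and comult_add: "\<Delta> (a + b) = add2 scale (\<Delta> a) (\<Delta> b)"
    and comult_scale: "\<Delta> (scale c a) = scale2 scale c (\<Delta> a)"
    and comult_mult: "\<Delta> (a * b) = mult2 scale (\<Delta> a) (\<Delta> b)"
    and comult_one: "\<Delta> 1 = tens scale 1 1"
    and counit_linear: "Vector_Spaces.linear scale (*) \<epsilon>"
    and counit_mult: "\<epsilon> (a * b) = \<epsilon> a * \<epsilon> b"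
    and counit_one: "\<epsilon> 1 = 1"
    and coassoc: "left3 scale \<Delta> (\<Delta> a) = right3 scale \<Delta> (\<Delta> a)"
    and counit_left: "eval2 scale (\<lambda>a1 a2. scale (\<epsilon> a1) a2) (\<Delta> a) = a"
    and counit_right: "eval2 scale (\<lambda>a1 a2. scale (\<epsilon> a2) a1) (\<Delta> a) = a"
    and antipode_linear: "Vector_Spaces.linear scale scale S"
    and antipode_left: "eval2 scale (\<lambda>a1 a2. S a1 * a2) (\<Delta> a) = scale (\<epsilon> a) 1"
    and antipode_right: "eval2 scale (\<lambda>a1 a2. a1 * S a2) (\<Delta> a) = scale (\<epsilon> a) 1"

locale poisson_hopf_algebra =
  poisson_algebra scale br + comm_hopf_algebra scale \<Delta> \<epsilon> S
  for scale :: "'k::field \<Rightarrow> 'a::comm_ring_1 \<Rightarrow> 'a"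
    and br :: "'a \<Rightarrow> 'a \<Rightarrow> 'a"
    and \<Delta> :: "'a \<Rightarrow> ('a \<times> 'a \<Rightarrow>\<^sub>0 'k) set"
    and \<epsilon> :: "'a \<Rightarrow> 'k"
    and S :: "'a \<Rightarrow> 'a" +
  assumes comult_br: "\<Delta> (br a b) = bracket2 scale br (\<Delta> a) (\<Delta> b)"

definition algebra_derivation ::
    "('k::field \<Rightarrow> 'a::comm_ring_1 \<Rightarrow> 'a) \<Rightarrow> ('a \<Rightarrow> 'a) \<Rightarrow> bool" where
  "algebra_derivation scale d \<longleftrightarrow>
     Vector_Spaces.linear scale scale d \<and> (\<forall>a b. d (a * b) = d a * b + a * d b)"

definition poisson_derivation ::
    "('k::field \<Rightarrow> 'a::comm_ring_1 \<Rightarrow> 'a) \<Rightarrow> ('a \<Rightarrow> 'a \<Rightarrow> 'a) \<Rightarrow> ('a \<Rightarrow> 'a) \<Rightarrow> bool" where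
  "poisson_derivation scale br d \<longleftrightarrow>
     algebra_derivation scale d \<and> (\<forall>a b. d (br a b) = br (d a) b + br a (d b))"

definition group_like :: "('k::field \<Rightarrow> 'a::comm_ring_1 \<Rightarrow> 'a) \<Rightarrow>
    ('a \<Rightarrow> ('a \<times> 'a \<Rightarrow>\<^sub>0 'k) set) \<Rightarrow> ('a \<Rightarrow> 'k) \<Rightarrow> 'a \<Rightarrow> bool" where
  "group_like scale \<Delta> \<epsilon> g \<longleftrightarrow> \<Delta> g = tens scale g g \<and> \<epsilon> g = 1"

definition ring_inv :: "'a::comm_ring_1 \<Rightarrow> 'a" where
  "ring_inv g = (THE h. g * h = 1)"

text \<open>$B^+ \otimes B^+$, as a subspace of $B \otimes B$.\<close>

definition aug_tensor2 :: "('k::field \<Rightarrow> 'a::comm_ring_1 \<Rightarrow> 'a) \<Rightarrow> ('a \<Rightarrow> 'k) \<Rightarrow>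
    ('a \<times> 'a \<Rightarrow>\<^sub>0 'k) set set" where
  "aug_tensor2 scale \<epsilon> =
     {cls2 scale u | u. Poly_Mapping.keys u \<subseteq> {a. \<epsilon> a = 0} \<times> {b. \<epsilon> b = 0}}"


section \<open>Poisson polynomial algebras\<close>

definition poly_scale :: "('k::field \<Rightarrow> 'a::comm_ring_1 \<Rightarrow> 'a) \<Rightarrow> 'k \<Rightarrow> 'a poly \<Rightarrow> 'a poly" where
  "poly_scale scale c p = map_poly (scale c) p"

abbreviation const_poly :: "'a::zero \<Rightarrow> 'a poly" where
  "const_poly b \<equiv> [:b:]"

abbreviation var_poly :: "'a::comm_ring_1 poly" where
  "var_poly \<equiv> [:0, 1:]"

text \<open>The bracket of $B[x; \alpha, \delta]_p$.\<close>

definition poisson_poly_bracket :: "('k::field \<Rightarrow> 'a::comm_ring_1 \<Rightarrow> 'a) \<Rightarrow> ('a \<Rightarrow> 'a \<Rightarrow> 'a) \<Rightarrow>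
    ('a \<Rightarrow> 'a) \<Rightarrow> ('a \<Rightarrow> 'a) \<Rightarrow> 'a poly \<Rightarrow> 'a poly \<Rightarrow> 'a poly" where
  "poisson_poly_bracket scale br \<alpha> \<delta> = (THE Br.
     poisson_algebra (poly_scale scale) Br \<and>
     (\<forall>a b. Br (const_poly a) (const_poly b) = const_poly (br a b)) \<and>
     (\<forall>b. Br var_poly (const_poly b) = const_poly (\<alpha> b) * var_poly + const_poly (\<delta> b)))"

end

theory Submission
  imports Defs
begin

text \<open>
  Cosets are replaced by formal representatives, on which congruence modulo the defining relations
  of the tensor powers is a ring congruence.  The Poisson bracket, \<open>\<Delta>'\<close>, \<open>\<epsilon>'\<close> and \<open>S'\<close> on \<open>B[x]\<close> are
  the unique extensions by (bi)derivations and algebra homomorphisms from \<open>B\<close> and \<open>x\<close>, where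
  \<open>S'(x) = - g\<^sup>-\<^sup>1 x - \<Sum> S(w\<^sub>1) w\<^sub>2\<close>.  Each axiom then says that a set of polynomials closed under sums
  and products is everything, so it is enough to check it on \<open>B\<close> and on \<open>x\<close>: there coassociativity
  is (v), the antipode identities are (iv), and \<open>\<Delta>'{x, b} = {\<Delta>' x, \<Delta>' b}\<close> follows from (iii) and
  \<open>\<Delta>(\<alpha>(b)) = \<alpha>(b\<^sub>1) \<otimes> b\<^sub>2 = b\<^sub>1 \<otimes> \<alpha>(b\<^sub>2) + {g, b\<^sub>1} g\<^sup>-\<^sup>1 \<otimes> b\<^sub>2\<close>, a consequence of (i) and coassociativity.
\<close>

section \<open>Linear maps modulo a subspace\<close>

text \<open>The tensor powers have no type of their own, so no type class supplies their ring laws.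
  A coset-valued \<open>\<Delta>\<close> is therefore traded for a choice \<open>d\<close> of
  representatives, which is linear and multiplicative only modulo \<open>null2\<close>. The value of
  \<open>S' x\<close> is forced: the left antipode identity on
  \<open>g \<otimes> x + x \<otimes> 1 + w\<close> reads
  \<open>S g * x + S' x + \<Sum> S(w\<^sub>1) w\<^sub>2 = 0\<close>, the right one gives \<open>-
  g\<^sup>-\<^sup>1 x - g\<^sup>-\<^sup>1 \<Sum> w\<^sub>1 S(w\<^sub>2)\<close>, and (iv) says that
  the two agree. Checking the antipode identities on generators requires both sides to be
  multiplicative, but the axioms only make the antipode linear; its multiplicativity on
  \<open>B\<close> and its uniqueness on \<open>B[x]\<close> both come from one cancellation
  argument for convolution. In \<open>\<Delta>'{x, b}\<close> the terms containing \<open>x\<close>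
  are governed by \<open>\<Delta>(\<alpha>(b))\<close>, those over \<open>B\<close> by (iii); the
  correction \<open>{g, b} g\<^sup>-\<^sup>1\<close> in (i) matches what the factor \<open>g\<close>
  of \<open>g \<otimes> x\<close> contributes to the bracket.\<close>

definition eqm :: "'v::ab_group_add set \<Rightarrow> 'v \<Rightarrow> 'v \<Rightarrow> bool" where
  "eqm W u v \<longleftrightarrow> u - v \<in> W"

text \<open>A linear map into a quotient, seen through arbitrarily chosen representatives of its
  values, is linear only modulo the subspace. \<open>W = {0}\<close> recovers ordinary linearity, so
  one set of lemmas serves formal sums, algebras and the ground field.\<close>

definition lin_mod :: "('k \<Rightarrow> 'u::ab_group_add \<Rightarrow> 'u) \<Rightarrow> ('k \<Rightarrow> 'v::ab_group_add \<Rightarrow> 'v) \<Rightarrow>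
    'v set \<Rightarrow> ('u \<Rightarrow> 'v) \<Rightarrow> bool" where
  "lin_mod s t W f \<longleftrightarrow>
     (\<forall>x y. eqm W (f (x + y)) (f x + f y)) \<and> (\<forall>c x. eqm W (f (s c x)) (t c (f x)))"

lemma eqm_0 [simp]: "eqm {0} u v \<longleftrightarrow> u = v"
  by (simp add: eqm_def)

lemma lin_modI:
  assumes "\<And>x y. eqm W (f (x + y)) (f x + f y)" "\<And>c x. eqm W (f (s c x)) (t c (f x))"
  shows "lin_mod s t W f"
  using assms by (simp add: lin_mod_def)

lemma lin_mod_add: "lin_mod s t W f \<Longrightarrow> eqm W (f (x + y)) (f x + f y)"
  and lin_mod_scale: "lin_mod s t W f \<Longrightarrow> eqm W (f (s c x)) (t c (f x))"
  by (auto simp: lin_mod_def)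

lemma linear_imp_lin_mod: "Vector_Spaces.linear s t f \<Longrightarrow> lin_mod s t {0} f"
  by (simp add: Vector_Spaces.linear_iff lin_mod_def)

lemma linear_iff_lin_mod:
  "vector_space s \<Longrightarrow> vector_space t \<Longrightarrow> Vector_Spaces.linear s t f \<longleftrightarrow> lin_mod s t {0} f"
  by (simp add: Vector_Spaces.linear_iff lin_mod_def)

locale mod_space = vector_space t
  for t :: "'k::field \<Rightarrow> 'v::ab_group_add \<Rightarrow> 'v" +
  fixes W :: "'v set"
  assumes subspace: "subspace W"
begin

lemma eqm_refl [simp, intro]: "eqm W u u"
  using subspace by (simp add: eqm_def subspace_0)

lemma eqm_sym: "eqm W u v \<Longrightarrow> eqm W v u"
  using subspace_neg[OF subspace, of "u - v"] by (simp add: eqm_def)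

lemma eqm_trans: "eqm W u v \<Longrightarrow> eqm W v x \<Longrightarrow> eqm W u x"
  using subspace_add[OF subspace, of "u - v" "v - x"] by (simp add: eqm_def)

lemma eqm_add: "eqm W u v \<Longrightarrow> eqm W u' v' \<Longrightarrow> eqm W (u + u') (v + v')"
  using subspace_add[OF subspace, of "u - v" "u' - v'"] by (simp add: eqm_def algebra_simps)

lemma eqm_diff: "eqm W u v \<Longrightarrow> eqm W u' v' \<Longrightarrow> eqm W (u - u') (v - v')"
  using subspace_diff[OF subspace, of "u - v" "u' - v'"] by (simp add: eqm_def algebra_simps)

lemma eqm_minus: "eqm W u v \<Longrightarrow> eqm W (- u) (- v)"
  using eqm_diff[of 0 0 u v] by simp

lemma eqm_scale: "eqm W u v \<Longrightarrow> eqm W (t c u) (t c v)"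
  using subspace_scale[OF subspace, of "u - v" c] by (simp add: eqm_def scale_right_diff_distrib)

lemma eqm_mem: "u \<in> W \<longleftrightarrow> eqm W u 0"
  by (simp add: eqm_def)

lemma lin_mod_weaken: "lin_mod s t {0} f \<Longrightarrow> lin_mod s t W f"
  by (auto simp: lin_mod_def)

lemma lin_mod_plus:
  assumes f: "lin_mod s t W f" and h: "lin_mod s t W h"
  shows "lin_mod s t W (\<lambda>x. f x + h x)"
proof (rule lin_modI)
  fix x y c
  show "eqm W (f (x + y) + h (x + y)) (f x + h x + (f y + h y))"
    using eqm_add[OF lin_mod_add[OF f, of x y] lin_mod_add[OF h, of x y]] by (simp add: algebra_simps)
  show "eqm W (f (s c x) + h (s c x)) (t c (f x + h x))"
    using eqm_add[OF lin_mod_scale[OF f, of c x] lin_mod_scale[OF h, of c x]]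
    by (simp add: scale_right_distrib)
qed

lemma lin_mod_scaled:
  assumes f: "lin_mod s t W f"
  shows "lin_mod s t W (\<lambda>x. t c (f x))"
proof (rule lin_modI)
  fix x y d
  show "eqm W (t c (f (x + y))) (t c (f x) + t c (f y))"
    using eqm_scale[OF lin_mod_add[OF f, of x y], of c] by (simp add: scale_right_distrib)
  show "eqm W (t c (f (s d x))) (t d (t c (f x)))"
    using eqm_scale[OF lin_mod_scale[OF f, of d x], of c] by (simp add: scale_scale mult.commute)
qed

lemma lin_mod_cong:
  assumes f: "lin_mod s t W f" and eq: "\<And>x. eqm W (h x) (f x)"
  shows "lin_mod s t W h"
  by (intro lin_modI)
    (meson eq eqm_add eqm_scale eqm_sym eqm_trans f lin_mod_add lin_mod_scale)+

lemma lin_mod_0: "lin_mod s t W f \<Longrightarrow> eqm W (f 0) 0"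
  using eqm_diff[OF lin_mod_add[of s t W f 0 0] eqm_refl[of "f 0"]] by (simp add: eqm_sym)

lemma lin_mod_diff:
  assumes f: "lin_mod s t W f"
  shows "eqm W (f (x - y)) (f x - f y)"
  using eqm_diff[OF eqm_sym[OF lin_mod_add[OF f, of "x - y" y]] eqm_refl[of "f y"]] by simp

lemma lin_mod_uminus:
  assumes f: "lin_mod s t W f"
  shows "eqm W (f (- x)) (- f x)"
  using lin_mod_diff[OF f, of 0 x] eqm_diff[OF lin_mod_0[OF f] eqm_refl[of "f x"]] eqm_trans
  by fastforce

lemma lin_mod_sum:
  assumes f: "lin_mod s t W f"
  shows "eqm W (f (\<Sum>i\<in>I. c i)) (\<Sum>i\<in>I. f (c i))"
proof (induction I rule: infinite_finite_induct)
  case (insert i I)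
  then show ?case
    using eqm_trans[OF lin_mod_add[OF f] eqm_add[OF eqm_refl]] by simp
qed (auto simp: lin_mod_0[OF f])

end

lemma lin_mod_comp:
  assumes V: "mod_space t W" and U: "mod_space r W'"
    and f: "lin_mod s t W f" and h: "lin_mod t r W' h" and res: "\<And>v. v \<in> W \<Longrightarrow> h v \<in> W'"
  shows "lin_mod s r W' (\<lambda>x. h (f x))"
proof -
  interpret V: mod_space t W by fact
  interpret U: mod_space r W' by fact
  have *: "eqm W' (h u) (h v)" if "eqm W u v" for u v
    using U.lin_mod_diff[OF h, of u v] res[of "u - v"] that U.eqm_mem U.eqm_sym U.eqm_trans
    by (metis eqm_def diff_zero)
  show ?thesis
    by (intro lin_modI)
      (meson * U.eqm_trans f h lin_mod_add lin_mod_scale)+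
qed

lemma mod_space_0: "vector_space t \<Longrightarrow> mod_space t {0}"
  by (simp add: mod_space_def mod_space_axioms_def module.subspace_single_0 vector_space_def module_def)

lemma (in mod_space) lin_mod_comp0:
  assumes "vector_space r" "lin_mod s r {0} f" "lin_mod r t W h"
  shows "lin_mod s t W (\<lambda>x. h (f x))"
proof (rule lin_mod_comp[OF mod_space_0[OF assms(1)] mod_space_axioms assms(2,3)])
  show "h v \<in> W" if "v \<in> {0}" for v
    using that lin_mod_0[OF assms(3)] by (simp add: eqm_def)
qed

text \<open>The form in which well-definedness is used below: linearity reduces the congruence of
  values to the single difference \<open>u - v\<close>, which lies in \<open>W\<close>.\<close>

lemma eqm_image:
  assumes "mod_space r W'" "lin_mod t r W' h" "\<And>v. v \<in> W \<Longrightarrow> h v \<in> W'" "eqm W u v"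
  shows "eqm W' (h u) (h v)"
proof -
  interpret U: mod_space r W' by fact
  show ?thesis
    using U.lin_mod_diff[OF assms(2), of u v] assms(3)[of "u - v"] assms(4)
    by (metis eqm_def diff_zero U.eqm_mem U.eqm_sym U.eqm_trans)
qed

section \<open>Formal linear combinations\<close>

lemma lookup_fs_scale [simp]: "Poly_Mapping.lookup (fs_scale c u) x = c * Poly_Mapping.lookup u x"
  by (simp add: fs_scale_def Poly_Mapping.map.rep_eq when_def)

global_interpretation fs: vector_space fs_scale
  by unfold_locales (auto intro!: poly_mapping_eqI simp: lookup_add algebra_simps)

lemma fs_scale_single [simp]:
  "fs_scale c (Poly_Mapping.single x d) = Poly_Mapping.single x (c * d)"
  by (rule poly_mapping_eqI) (simp add: lookup_single when_def)

lemma fs_sum_gens: "u = (\<Sum>x\<in>Poly_Mapping.keys u. fs_scale (Poly_Mapping.lookup u x) (gen x))"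
  by (rule poly_mapping_eqI)
    (simp add: lookup_sum lookup_single when_def sum.delta in_keys_iff if_distrib cong: if_cong)

context vector_space
begin

lemma lin_ext_superset:
  assumes "finite A" "Poly_Mapping.keys u \<subseteq> A"
  shows "lin_ext scale f u = (\<Sum>x\<in>A. scale (Poly_Mapping.lookup u x) (f x))"
  unfolding lin_ext_def using assms
  by (intro sum.mono_neutral_left) (auto simp: in_keys_iff)

lemma lin_ext_add: "lin_ext scale f (u + v) = lin_ext scale f u + lin_ext scale f v"
proof -
  let ?A = "Poly_Mapping.keys u \<union> Poly_Mapping.keys v"
  have "lin_ext scale f (u + v) = (\<Sum>x\<in>?A. scale (Poly_Mapping.lookup (u + v) x) (f x))"
    by (intro lin_ext_superset) (use Poly_Mapping.keys_add[of u v] in auto)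
  moreover have "lin_ext scale f u = (\<Sum>x\<in>?A. scale (Poly_Mapping.lookup u x) (f x))"
    "lin_ext scale f v = (\<Sum>x\<in>?A. scale (Poly_Mapping.lookup v x) (f x))"
    by (intro lin_ext_superset; auto)+
  ultimately show ?thesis
    by (simp add: lookup_add scale_left_distrib sum.distrib)
qed

lemma lin_ext_fs_scale: "lin_ext scale f (fs_scale c u) = scale c (lin_ext scale f u)"
proof -
  have "lin_ext scale f (fs_scale c u) =
      (\<Sum>x\<in>Poly_Mapping.keys u. scale (Poly_Mapping.lookup (fs_scale c u) x) (f x))"
    by (intro lin_ext_superset) (auto simp: in_keys_iff)
  then show ?thesis
    by (simp add: lin_ext_def scale_sum_right)
qed

lemma lin_ext_single [simp]: "lin_ext scale f (Poly_Mapping.single x c) = scale c (f x)"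
  by (cases "c = 0") (auto simp: lin_ext_def)

lemma lin_ext_zero [simp]: "lin_ext scale f 0 = 0"
  by (simp add: lin_ext_def)

lemma lin_ext_diff: "lin_ext scale f (u - v) = lin_ext scale f u - lin_ext scale f v"
  using lin_ext_add[of f "u - v" v] by (simp add: algebra_simps)

lemma lin_ext_lin0: "lin_mod fs_scale scale {0} (lin_ext scale f)"
  by (simp add: lin_mod_def lin_ext_add lin_ext_fs_scale)

lemma lin_ext_fun_add: "lin_ext scale (\<lambda>x. f x + h x) u = lin_ext scale f u + lin_ext scale h u"
  by (simp add: lin_ext_def scale_right_distrib sum.distrib)

lemma lin_ext_fun_scale: "lin_ext scale (\<lambda>x. scale c (f x)) u = scale c (lin_ext scale f u)"
  by (simp add: lin_ext_def scale_sum_right mult.commute)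

end

context mod_space
begin

lemma lin_ext_lin: "lin_mod fs_scale t W (lin_ext t f)"
  by (rule lin_mod_weaken[OF lin_ext_lin0])

text \<open>Freeness modulo \<open>W\<close>: expanding \<open>u\<close> over its support turns each
  side, up to \<open>W\<close>, into the same combination of values on generators.\<close>

lemma free_ext:
  assumes h: "lin_mod fs_scale t W h" and h': "lin_mod fs_scale t W h'"
    and eq: "\<And>x. x \<in> Poly_Mapping.keys u \<Longrightarrow> eqm W (h (gen x)) (h' (gen x))"
  shows "eqm W (h u) (h' u)"
proof -
  have *: "eqm W (k u) (\<Sum>x\<in>Poly_Mapping.keys u. t (Poly_Mapping.lookup u x) (k (gen x)))"
    if k: "lin_mod fs_scale t W k" for k
  proof -
    have "eqm W (k u) (\<Sum>x\<in>Poly_Mapping.keys u. k (fs_scale (Poly_Mapping.lookup u x) (gen x)))"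
      by (subst (1) fs_sum_gens) (rule lin_mod_sum[OF k])
    moreover have "eqm W (\<Sum>x\<in>A. k (fs_scale (Poly_Mapping.lookup u x) (gen x)))
      (\<Sum>x\<in>A. t (Poly_Mapping.lookup u x) (k (gen x)))" for A
      by (induction A rule: infinite_finite_induct)
        (auto intro!: eqm_add lin_mod_scale[OF k] simp del: fs_scale_single)
    ultimately show ?thesis by (rule eqm_trans)
  qed
  have "eqm W (\<Sum>x\<in>A. t (Poly_Mapping.lookup u x) (h (gen x)))
    (\<Sum>x\<in>A. t (Poly_Mapping.lookup u x) (h' (gen x)))" if "A \<subseteq> Poly_Mapping.keys u" for A
    using that by (induction A rule: infinite_finite_induct) (auto intro!: eqm_add eqm_scale eq)
  with *[OF h] *[OF h'] show ?thesis
    by (meson eqm_sym eqm_trans order_refl)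
qed

lemma lin_ext_eqm:
  assumes "\<And>x. x \<in> Poly_Mapping.keys u \<Longrightarrow> eqm W (f x) (f' x)"
  shows "eqm W (lin_ext t f u) (lin_ext t f' u)"
  by (rule free_ext[OF lin_ext_lin lin_ext_lin]) (simp add: assms)

lemma lin_ext_lin_param:
  assumes "\<And>x. lin_mod s t W (\<lambda>y. F y x)"
  shows "lin_mod s t W (\<lambda>y. lin_ext t (F y) u)"
proof (rule lin_modI)
  fix y z c
  show "eqm W (lin_ext t (F (y + z)) u) (lin_ext t (F y) u + lin_ext t (F z) u)"
    by (subst lin_ext_fun_add[symmetric]) (intro lin_ext_eqm lin_mod_add[OF assms])
  show "eqm W (lin_ext t (F (s c y)) u) (t c (lin_ext t (F y) u))"
    by (subst lin_ext_fun_scale[symmetric]) (intro lin_ext_eqm lin_mod_scale[OF assms])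
qed

section \<open>Universal property of the tensor powers, modulo a subspace\<close>

lemma span_mem:
  assumes h: "lin_mod fs_scale t W h" and G: "\<And>v. v \<in> G \<Longrightarrow> h v \<in> W" and u: "u \<in> fs.span G"
  shows "h u \<in> W"
  using u
proof (induction rule: fs.span_induct_alt)
  case base
  then show ?case using lin_mod_0[OF h] by (simp add: eqm_mem)
next
  case (step c x y)
  have "eqm W (h (fs_scale c x + y)) (t c (h x) + h y)"
    using eqm_trans[OF lin_mod_add[OF h] eqm_add[OF lin_mod_scale[OF h] eqm_refl]] .
  moreover have "t c (h x) + h y \<in> W"
    using step G subspace by (simp add: subspace_add subspace_scale)
  ultimately show ?case by (metis eqm_mem eqm_trans)
qed

text \<open>Brings a defect such as \<open>h (u - v - w) \<in> W\<close> into the shape of an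
  additivity or homogeneity congruence for \<open>h\<close>.\<close>

lemma lin_mod_gen:
  assumes h: "lin_mod fs_scale t W h"
  shows "eqm W (h (u - v)) (h w) \<longleftrightarrow> eqm W (h u) (h v + h w)"
    and "eqm W (h (u - v)) 0 \<longleftrightarrow> eqm W (h u) (h v)"
proof -
  have d: "eqm W (h (u - v)) x \<longleftrightarrow> eqm W (h u - h v) x" for x
    using lin_mod_diff[OF h, of u v] eqm_sym eqm_trans by blast
  show "eqm W (h (u - v)) (h w) \<longleftrightarrow> eqm W (h u) (h v + h w)"
    "eqm W (h (u - v)) 0 \<longleftrightarrow> eqm W (h u) (h v)"
    unfolding d by (auto simp: eqm_def algebra_simps)
qed

text \<open>The families spanning \<open>null2\<close> are exactly the defects of additivity and
  homogeneity in each slot, so bilinearity on generators suffices. This is how every map out of the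
  tensor square is shown to be well defined.\<close>

lemma null2_mem:
  assumes h: "lin_mod fs_scale t W h"
    and l: "\<And>b. lin_mod scale t W (\<lambda>a. h (gen (a, b)))"
    and r: "\<And>a. lin_mod scale t W (\<lambda>b. h (gen (a, b)))"
    and u: "u \<in> null2 scale"
  shows "h u \<in> W"
  using u unfolding null2_def
proof (rule span_mem[OF h, rotated])
  have s: "eqm W (h (fs_scale c (gen x))) v \<longleftrightarrow> eqm W (t c (h (gen x))) v" for c x v
    using lin_mod_scale[OF h, of c "gen x"] eqm_sym eqm_trans by blast
  have s': "eqm W v (h (fs_scale c (gen x))) \<longleftrightarrow> eqm W v (t c (h (gen x)))" for c x v
    using s eqm_sym by blast
  show "h v \<in> W" if "v \<in> {gen (a + a', b) - gen (a, b) - gen (a', b) |a a' b. True} \<union>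
      {gen (a, b + b') - gen (a, b) - gen (a, b') |a b b'. True} \<union>
      {gen (scale c a, b) - fs_scale c (gen (a, b)) |c a b. True} \<union>
      {gen (a, scale c b) - fs_scale c (gen (a, b)) |c a b. True}" for v
    using that
    by (auto simp: eqm_mem lin_mod_gen[OF h] s' simp del: fs_scale_single
        intro: lin_mod_add[OF l] lin_mod_add[OF r] lin_mod_scale[OF l] lin_mod_scale[OF r])
qed

lemma null3_mem:
  assumes h: "lin_mod fs_scale t W h"
    and 1: "\<And>b c. lin_mod scale t W (\<lambda>a. h (gen (a, b, c)))"
    and 2: "\<And>a c. lin_mod scale t W (\<lambda>b. h (gen (a, b, c)))"
    and 3: "\<And>a b. lin_mod scale t W (\<lambda>c. h (gen (a, b, c)))"
    and u: "u \<in> null3 scale"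
  shows "h u \<in> W"
  using u unfolding null3_def
proof (rule span_mem[OF h, rotated])
  have s: "eqm W (h (fs_scale c (gen x))) v \<longleftrightarrow> eqm W (t c (h (gen x))) v" for c x v
    using lin_mod_scale[OF h, of c "gen x"] eqm_sym eqm_trans by blast
  have s': "eqm W v (h (fs_scale c (gen x))) \<longleftrightarrow> eqm W v (t c (h (gen x)))" for c x v
    using s eqm_sym by blast
  show "h v \<in> W" if "v \<in> {gen (a + a', b, c) - gen (a, b, c) - gen (a', b, c) | a a' b c. True} \<union>
      {gen (a, b + b', c) - gen (a, b, c) - gen (a, b', c) | a b b' c. True} \<union>
      {gen (a, b, c + c') - gen (a, b, c) - gen (a, b, c') | a b c c'. True} \<union>
      {gen (scale r a, b, c) - fs_scale r (gen (a, b, c)) | r a b c. True} \<union>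
      {gen (a, scale r b, c) - fs_scale r (gen (a, b, c)) | r a b c. True} \<union>
      {gen (a, b, scale r c) - fs_scale r (gen (a, b, c)) | r a b c. True}" for v
    using that
    by (auto simp: eqm_mem lin_mod_gen[OF h] s' simp del: fs_scale_single
        intro: lin_mod_add[OF 1] lin_mod_add[OF 2] lin_mod_add[OF 3]
          lin_mod_scale[OF 1] lin_mod_scale[OF 2] lin_mod_scale[OF 3])
qed

end

lemma mod_space_null2: "mod_space fs_scale (null2 scale)"
  by unfold_locales (simp add: null2_def)

lemma mod_space_null3: "mod_space fs_scale (null3 scale)"
  by unfold_locales (simp add: null3_def)

lemma gen2_lin:
  "lin_mod scale fs_scale (null2 scale) (\<lambda>a. gen (a, b))"
  "lin_mod scale fs_scale (null2 scale) (\<lambda>b. gen (a, b))"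
  \<comment> \<open>Reversing \<open>diff_diff_eq\<close> gives differences the form
    \<open>u - v - w\<close> of the spanning elements, so that each claim is literally membership in
    the spanning set.\<close>
  unfolding lin_mod_def eqm_def null2_def diff_diff_eq[symmetric]
  by (intro conjI allI fs.span_base; (rule UnI1 UnI2)+, rule CollectI, intro exI, rule conjI[OF refl TrueI])+

lemma gen3_lin:
  "lin_mod scale fs_scale (null3 scale) (\<lambda>a. gen (a, b, c))"
  "lin_mod scale fs_scale (null3 scale) (\<lambda>b. gen (a, b, c))"
  "lin_mod scale fs_scale (null3 scale) (\<lambda>c. gen (a, b, c))"
  unfolding lin_mod_def eqm_def null3_def diff_diff_eq[symmetric]
  by (intro conjI allI fs.span_base; (rule UnI1 UnI2)+, rule CollectI, intro exI, rule conjI[OF refl TrueI])+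

section \<open>Computing the operations on cosets through representatives\<close>

lemma (in mod_space) coset_eq_iff:
  assumes "\<And>u v. u \<in> C v \<longleftrightarrow> eqm W u v"
  shows "C u = C v \<longleftrightarrow> eqm W u v"
  unfolding set_eq_iff assms by (meson eqm_refl eqm_sym eqm_trans)

lemma mem_cls2: "u \<in> cls2 scale v \<longleftrightarrow> eqm (null2 scale) u v"
  by (simp add: cls2_def rel2_def eqm_def)

lemma mem_cls3: "u \<in> cls3 scale v \<longleftrightarrow> eqm (null3 scale) u v"
  by (simp add: cls3_def eqm_def)

lemmas cls2_eq_iff = mod_space.coset_eq_iff[OF mod_space_null2 mem_cls2]
  and cls3_eq_iff = mod_space.coset_eq_iff[OF mod_space_null3 mem_cls3]

lemma tensor2_eq: "tensor2 scale = range (cls2 scale)"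
  by (auto simp: tensor2_def cls2_def quotient_def)

text \<open>A coset is nonempty and \<open>F\<close> is constant on it, so the union has only one
  distinct member. This is what makes the \<open>q_\<close> operations computable.\<close>

lemma UN_cosets:
  assumes "mod_space t W" "\<And>u v. u \<in> C v \<longleftrightarrow> eqm W u v" "\<And>v. eqm W v u \<Longrightarrow> F v = F u"
  shows "(\<Union>v\<in>C u. F v) = F u"
proof -
  interpret mod_space t W by fact
  have "u \<in> C u" using assms(2) by simp
  moreover have "F v = F u" if "v \<in> C u" for v
    using that assms(2,3) by blast
  ultimately show ?thesis by blast
qed

lemma add2_cls: "add2 scale (cls2 scale u) (cls2 scale v) = cls2 scale (u + v)"
proof -
  interpret mod_space fs_scale "null2 scale" by (rule mod_space_null2)
  note U = UN_cosets[OF mod_space_null2 mem_cls2]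
  show ?thesis unfolding q_add_def
    by (subst U; (subst U)?) (auto simp: cls2_eq_iff intro!: eqm_add SUP_cong)
qed

lemma minus2_cls: "minus2 scale (cls2 scale u) (cls2 scale v) = cls2 scale (u - v)"
proof -
  interpret mod_space fs_scale "null2 scale" by (rule mod_space_null2)
  note U = UN_cosets[OF mod_space_null2 mem_cls2]
  show ?thesis unfolding q_minus_def
    by (subst U; (subst U)?) (auto simp: cls2_eq_iff intro!: eqm_diff SUP_cong)
qed

lemma scale2_cls: "scale2 scale c (cls2 scale u) = cls2 scale (fs_scale c u)"
proof -
  interpret mod_space fs_scale "null2 scale" by (rule mod_space_null2)
  note U = UN_cosets[OF mod_space_null2 mem_cls2]
  show ?thesis unfolding q_scale_def
    by (subst U) (auto simp: cls2_eq_iff intro!: eqm_scale)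
qed

lemma add3_cls: "add3 scale (cls3 scale u) (cls3 scale v) = cls3 scale (u + v)"
proof -
  interpret mod_space fs_scale "null3 scale" by (rule mod_space_null3)
  note U = UN_cosets[OF mod_space_null3 mem_cls3]
  show ?thesis unfolding q_add_def
    by (subst U; (subst U)?) (auto simp: cls3_eq_iff intro!: eqm_add SUP_cong)
qed

lemma q_linear_cls:
  assumes W: "mod_space fs_scale W" and W': "mod_space fs_scale W'"
    and C: "\<And>u v. u \<in> C v \<longleftrightarrow> eqm W u v" and C': "\<And>u v. C' u = C' v \<longleftrightarrow> eqm W' u v"
    and res: "\<And>v. v \<in> W \<Longrightarrow> lin_ext fs_scale F v \<in> W'"
  shows "q_linear C' F (C u) = C' (lin_ext fs_scale F u)"
proof -
  interpret W': mod_space fs_scale W' by fact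
  show ?thesis unfolding q_linear_def
    by (subst UN_cosets[OF W C]) (auto simp: C' intro: eqm_image[OF W' W'.lin_ext_lin res])
qed

definition bilin_ext :: "('x \<Rightarrow> 'y \<Rightarrow> 'z \<Rightarrow>\<^sub>0 'k::field) \<Rightarrow> ('x \<Rightarrow>\<^sub>0 'k) \<Rightarrow> ('y \<Rightarrow>\<^sub>0 'k) \<Rightarrow> ('z \<Rightarrow>\<^sub>0 'k)" where
  "bilin_ext F u v = lin_ext fs_scale (\<lambda>x. lin_ext fs_scale (F x) v) u"

lemma bilin_ext_lin:
  "lin_mod fs_scale fs_scale {0} (\<lambda>u. bilin_ext F u v)"
  "lin_mod fs_scale fs_scale {0} (\<lambda>v. bilin_ext F u v)"
proof -
  interpret mod_space fs_scale "{0}" by (rule mod_space_0) unfold_locales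
  show "lin_mod fs_scale fs_scale {0} (\<lambda>u. bilin_ext F u v)"
    unfolding bilin_ext_def by (rule lin_ext_lin)
  show "lin_mod fs_scale fs_scale {0} (\<lambda>v. bilin_ext F u v)"
    unfolding bilin_ext_def by (intro lin_ext_lin_param lin_ext_lin)
qed

lemma bilin_ext_simps:
  "bilin_ext F (u + u') v = bilin_ext F u v + bilin_ext F u' v"
  "bilin_ext F u (v + v') = bilin_ext F u v + bilin_ext F u v'"
  "bilin_ext F (fs_scale c u) v = fs_scale c (bilin_ext F u v)"
  "bilin_ext F u (fs_scale c v) = fs_scale c (bilin_ext F u v)"
  "bilin_ext F (gen x) v = lin_ext fs_scale (F x) v"
  "bilin_ext F (gen x) (gen y) = F x y"
  using lin_mod_add[OF bilin_ext_lin(1)[of F]] lin_mod_add[OF bilin_ext_lin(2)[of F]]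
    lin_mod_scale[OF bilin_ext_lin(1)[of F]] lin_mod_scale[OF bilin_ext_lin(2)[of F]]
  by (auto simp: bilin_ext_def)

lemma q_bilinear_cls:
  assumes W: "mod_space fs_scale W"
    and C: "\<And>u v. u \<in> C v \<longleftrightarrow> eqm W u v" and C': "\<And>u v. C u = C v \<longleftrightarrow> eqm W u v"
    and res: "\<And>u v. v \<in> W \<Longrightarrow> bilin_ext F v u \<in> W" "\<And>u v. v \<in> W \<Longrightarrow> bilin_ext F u v \<in> W"
  shows "q_bilinear C F (C u) (C v) = C (bilin_ext F u v)"
proof -
  interpret mod_space fs_scale W by fact
  note U = UN_cosets[OF W C]
  have 1: "eqm W (bilin_ext F u v) (bilin_ext F u' v')" if "eqm W u u'" "eqm W v v'" for u u' v v'
    using eqm_trans[OF eqm_image[OF W lin_mod_weaken[OF bilin_ext_lin(1)] res(1) that(1)]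
        eqm_image[OF W lin_mod_weaken[OF bilin_ext_lin(2)] res(2) that(2)]] by auto
  show ?thesis unfolding q_bilinear_def bilin_ext_def[symmetric]
    by (subst U; (subst U)?) (auto simp: C' intro!: 1 SUP_cong)
qed

text \<open>Bilinearity makes the image of a coset a singleton, as \<open>the_elem\<close> in
  \<open>eval2\<close> requires.\<close>

lemma (in vector_space) eval2_cls:
  assumes "\<And>b. lin_mod s scale {0} (\<lambda>a. \<phi> a b)" "\<And>a. lin_mod s scale {0} (\<phi> a)"
  shows "eval2 scale \<phi> (cls2 s u) = lin_ext scale (\<lambda>(a, b). \<phi> a b) u"
proof -
  interpret W: mod_space scale "{0}" by (rule mod_space_0) unfold_locales
  interpret N: mod_space fs_scale "null2 s" by (rule mod_space_null2)
  let ?h = "lin_ext scale (\<lambda>(a, b). \<phi> a b)"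
  have "?h v \<in> {0}" if "v \<in> null2 s" for v
    using assms that by (intro W.null2_mem[OF W.lin_ext_lin]) auto
  then have *: "?h v = ?h u" if "v \<in> cls2 s u" for v
    using eqm_image[OF W.mod_space_axioms W.lin_ext_lin _ that[unfolded mem_cls2]] by auto
  have "u \<in> cls2 s u" by (simp add: mem_cls2)
  with * have "?h ` cls2 s u = {?h u}" by (metis image_cong image_constant)
  then show ?thesis by (simp add: eval2_def)
qed

lemma fs_induct [case_names add scale gen]:
  assumes "\<And>u v. P u \<Longrightarrow> P v \<Longrightarrow> P (u + v)" "\<And>c u. P u \<Longrightarrow> P (fs_scale c u)" "\<And>x. P (gen x)"
  shows "P u"
proof -
  \<comment> \<open>Zero is reached as the zero multiple of an arbitrary generator.\<close>
  have z: "P 0" using assms(2)[of "gen undefined" 0] assms(3) by simp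
  have "P (\<Sum>x\<in>A. fs_scale (Poly_Mapping.lookup u x) (gen x))" for A
    by (induction A rule: infinite_finite_induct) (auto intro!: assms z simp del: fs_scale_single)
  then show ?thesis by (subst fs_sum_gens)
qed

lemma (in vector_space) lin_ext_lin_ext:
  "lin_ext scale f (lin_ext fs_scale G u) = lin_ext scale (\<lambda>x. lin_ext scale f (G x)) u"
  by (induction u rule: fs_induct)
    (simp_all add: lin_ext_add lin_ext_fs_scale fs.lin_ext_add fs.lin_ext_fs_scale del: fs_scale_single)

section \<open>Multiplication of formal linear combinations\<close>

text \<open>With the componentwise product, pairs and (as nested pairs) triples are commutative
  monoids, so a single product on formal sums covers both tensor powers.\<close>

instantiation prod :: (times, times) times
begin

definition times_prod :: "'a \<times> 'b \<Rightarrow> 'a \<times> 'b \<Rightarrow> 'a \<times> 'b" where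
  "x * y = (fst x * fst y, snd x * snd y)"

instance ..

end

instantiation prod :: (one, one) one
begin

definition one_prod :: "'a \<times> 'b" where
  "1 = (1, 1)"

instance ..

end

instance prod :: (comm_monoid_mult, comm_monoid_mult) comm_monoid_mult
  by intro_classes (simp_all add: times_prod_def one_prod_def mult_ac)

lemma times_Pair [simp]: "(a, b) * (c, d) = (a * c, b * d)"
  by (simp add: times_prod_def)

text \<open>The product of the monoid algebra over the multiplicative monoid of pairs or triples. It
  is commutative and associative as an equation between formal sums, not merely modulo the tensor
  relations.\<close>

definition fmul :: "('x::comm_monoid_mult \<Rightarrow>\<^sub>0 'k::field) \<Rightarrow> ('x \<Rightarrow>\<^sub>0 'k) \<Rightarrow> ('x \<Rightarrow>\<^sub>0 'k)"
    (infixl "\<odot>" 70) where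
  "u \<odot> v = bilin_ext (\<lambda>x y. gen (x * y)) u v"

lemma fmul_add_left: "(u + u') \<odot> v = u \<odot> v + u' \<odot> v"
  and fmul_add_right: "u \<odot> (v + v') = u \<odot> v + u \<odot> v'"
  and fmul_scale_left: "fs_scale c u \<odot> v = fs_scale c (u \<odot> v)"
  and fmul_scale_right: "u \<odot> fs_scale c v = fs_scale c (u \<odot> v)"
  and fmul_gen: "gen x \<odot> gen y = gen (x * y)"
  by (simp_all add: fmul_def bilin_ext_simps)

lemmas fmul_simps = fmul_add_left fmul_add_right fmul_scale_left fmul_scale_right fmul_gen

lemma fmul_commute: "u \<odot> v = v \<odot> u"
proof (induction u rule: fs_induct)
  case (gen x)
  show ?case
    by (induction v rule: fs_induct) (simp_all add: fmul_simps mult.commute del: fs_scale_single)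
qed (simp_all add: fmul_simps)

lemma fmul_assoc: "(u \<odot> v) \<odot> w = u \<odot> (v \<odot> w)"
proof (induction u rule: fs_induct)
  case (gen x)
  show ?case
  proof (induction v rule: fs_induct)
    case (gen y)
    show ?case
      by (induction w rule: fs_induct) (simp_all add: fmul_simps mult.assoc del: fs_scale_single)
  qed (simp_all add: fmul_simps)
qed (simp_all add: fmul_simps)

lemma fmul_one [simp]: "gen 1 \<odot> u = u" "u \<odot> gen 1 = u"
proof -
  show "gen 1 \<odot> u = u"
    by (induction u rule: fs_induct) (simp_all add: fmul_simps del: fs_scale_single)
  then show "u \<odot> gen 1 = u" by (simp add: fmul_commute)
qed

lemma fmul_left_commute: "u \<odot> (v \<odot> w) = v \<odot> (u \<odot> w)"
  by (metis fmul_assoc fmul_commute)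

lemma fmul_zero [simp]: "0 \<odot> u = 0" "u \<odot> 0 = 0"
  using fmul_scale_left[of 0 0 u] fmul_scale_right[of u 0 0] by simp_all

section \<open>The tensor relations as ideals\<close>

context comm_algebra
begin

sublocale N2: mod_space fs_scale "null2 scale"
  by (rule mod_space_null2)

sublocale N3: mod_space fs_scale "null3 scale"
  by (rule mod_space_null3)

sublocale Z: mod_space scale "{0}"
  by (rule mod_space_0) (rule vector_space_axioms)

lemma scale_mult_right: "scale c (a * b) = a * scale c b"
  by (metis mult.commute scale_mult_left)

lemma mult_lin0: "lin_mod scale scale {0} (\<lambda>x. a * x)" "lin_mod scale scale {0} (\<lambda>x. x * a)"
  by (simp_all add: lin_mod_def algebra_simps scale_mult_left scale_mult_right)

lemma lin0_I:
  "(\<And>x y. f (x + y) = f x + f y) \<Longrightarrow> (\<And>c x. f (scale c x) = scale c (f x)) \<Longrightarrow>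
    lin_mod scale scale {0} f"
  by (simp add: lin_mod_def)

lemma gen2_comp:
  assumes "lin_mod scale scale {0} f"
  shows "lin_mod scale fs_scale (null2 scale) (\<lambda>x. gen (f x, b))"
    and "lin_mod scale fs_scale (null2 scale) (\<lambda>x. gen (a, f x))"
  using N2.lin_mod_comp0[OF vector_space_axioms assms gen2_lin(1)[of scale b]]
    N2.lin_mod_comp0[OF vector_space_axioms assms gen2_lin(2)[of scale a]] by auto

lemma gen3_comp:
  assumes "lin_mod scale scale {0} f"
  shows "lin_mod scale fs_scale (null3 scale) (\<lambda>x. gen (f x, b, c))"
    and "lin_mod scale fs_scale (null3 scale) (\<lambda>x. gen (a, f x, c))"
    and "lin_mod scale fs_scale (null3 scale) (\<lambda>x. gen (a, b, f x))"
  using N3.lin_mod_comp0[OF vector_space_axioms assms gen3_lin(1)[of scale b c]]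
    N3.lin_mod_comp0[OF vector_space_axioms assms gen3_lin(2)[of scale a c]]
    N3.lin_mod_comp0[OF vector_space_axioms assms gen3_lin(3)[of scale a b]] by auto

text \<open>\<open>null2\<close> is an ideal: multiplication by a generator \<open>(a, b)\<close>
  acts slotwise by multiplication with \<open>a\<close> and \<open>b\<close>, which is bilinear, so
  it preserves the relations.\<close>

lemma null2_fmul: "x \<in> null2 scale \<Longrightarrow> u \<odot> x \<in> null2 scale"
proof (induction u rule: fs_induct)
  case (gen y)
  obtain a b where y: "y = (a, b)" by fastforce
  show ?case
    unfolding y
  proof (rule N2.null2_mem[OF _ _ _ gen])
    show "lin_mod fs_scale fs_scale (null2 scale) ((\<odot>) (gen (a, b)))"
      by (simp add: lin_mod_def fmul_simps)
  qed (auto simp: fmul_gen intro!: gen2_comp mult_lin0)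
qed (auto simp: fmul_simps intro!: fs.subspace_add fs.subspace_scale N2.subspace)

lemma null3_fmul: "x \<in> null3 scale \<Longrightarrow> u \<odot> x \<in> null3 scale"
proof (induction u rule: fs_induct)
  case (gen y)
  obtain a b c where y: "y = (a, b, c)" using prod_cases3 by blast
  show ?case
    unfolding y
  proof (rule N3.null3_mem[OF _ _ _ _ gen])
    show "lin_mod fs_scale fs_scale (null3 scale) ((\<odot>) (gen (a, b, c)))"
      by (simp add: lin_mod_def fmul_simps)
  qed (auto simp: fmul_gen intro!: gen3_comp mult_lin0)
qed (auto simp: fmul_simps intro!: fs.subspace_add fs.subspace_scale N3.subspace)

lemma fmul_diff: "u \<odot> (v - v') = u \<odot> v - u \<odot> v'" for u :: "'x::comm_monoid_mult \<Rightarrow>\<^sub>0 'k"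
  using fmul_add_right[of u "v - v'" v'] by (simp add: algebra_simps)

lemma eqm_fmul2:
  assumes "eqm (null2 scale) u u'" "eqm (null2 scale) v v'"
  shows "eqm (null2 scale) (u \<odot> v) (u' \<odot> v')"
proof -
  have "eqm (null2 scale) (w \<odot> x) (w \<odot> y)" if "eqm (null2 scale) x y" for w x y
    using null2_fmul[of "x - y" w] that by (simp add: eqm_def fmul_diff)
  with assms show ?thesis by (metis fmul_commute N2.eqm_trans)
qed

lemma eqm_fmul3:
  assumes "eqm (null3 scale) u u'" "eqm (null3 scale) v v'"
  shows "eqm (null3 scale) (u \<odot> v) (u' \<odot> v')"
proof -
  have "eqm (null3 scale) (w \<odot> x) (w \<odot> y)" if "eqm (null3 scale) x y" for w x y
    using null3_fmul[of "x - y" w] that by (simp add: eqm_def fmul_diff)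
  with assms show ?thesis by (metis fmul_commute N3.eqm_trans)
qed

lemma mult2_cls: "mult2 scale (cls2 scale u) (cls2 scale v) = cls2 scale (u \<odot> v)"
proof -
  have F: "(\<lambda>(a, b) (c, d). gen (a * c, b * d)) = (\<lambda>x y :: 'a \<times> 'a. gen (x * y) :: _ \<Rightarrow>\<^sub>0 'k)"
    by (auto simp: fun_eq_iff)
  show ?thesis
    unfolding mult2_def F fmul_def
    by (rule q_bilinear_cls[OF N2.mod_space_axioms mem_cls2 cls2_eq_iff])
      (metis fmul_def null2_fmul fmul_commute)+
qed

end

section \<open>Extensions to the triple tensor product\<close>

definition ext_right :: "'a \<Rightarrow> ('a \<times> 'a \<Rightarrow>\<^sub>0 'k::field) \<Rightarrow> ('a \<times> 'a \<times> 'a \<Rightarrow>\<^sub>0 'k)" where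
  "ext_right c = lin_ext fs_scale (\<lambda>(a, b). gen (a, b, c))"

definition ext_left :: "'a \<Rightarrow> ('a \<times> 'a \<Rightarrow>\<^sub>0 'k::field) \<Rightarrow> ('a \<times> 'a \<times> 'a \<Rightarrow>\<^sub>0 'k)" where
  "ext_left c = lin_ext fs_scale (\<lambda>(a, b). gen (c, a, b))"

definition comult_left :: "('a \<Rightarrow> ('a \<times> 'a \<Rightarrow>\<^sub>0 'k::field)) \<Rightarrow>
    ('a \<times> 'a \<Rightarrow>\<^sub>0 'k) \<Rightarrow> ('a \<times> 'a \<times> 'a \<Rightarrow>\<^sub>0 'k)" where
  "comult_left d = lin_ext fs_scale (\<lambda>(a, b). ext_right b (d a))"

definition comult_right :: "('a \<Rightarrow> ('a \<times> 'a \<Rightarrow>\<^sub>0 'k::field)) \<Rightarrow>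
    ('a \<times> 'a \<Rightarrow>\<^sub>0 'k) \<Rightarrow> ('a \<times> 'a \<times> 'a \<Rightarrow>\<^sub>0 'k)" where
  "comult_right d = lin_ext fs_scale (\<lambda>(a, b). ext_left a (d b))"

lemmas ext_defs = ext_right_def ext_left_def comult_left_def comult_right_def

lemma ext_simps:
  "ext_right c (u + v) = ext_right c u + ext_right c v"
  "ext_right c (fs_scale r u) = fs_scale r (ext_right c u)"
  "ext_right c (gen (a, b)) = gen (a, b, c)"
  "ext_left c (u + v) = ext_left c u + ext_left c v"
  "ext_left c (fs_scale r u) = fs_scale r (ext_left c u)"
  "ext_left c (gen (a, b)) = gen (c, a, b)"
  by (simp_all add: ext_defs fs.lin_ext_add fs.lin_ext_fs_scale)

lemma comult_ext_simps:
  "comult_left d (u + v) = comult_left d u + comult_left d v"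
  "comult_left d (fs_scale r u) = fs_scale r (comult_left d u)"
  "comult_left d (gen (a, b)) = ext_right b (d a)"
  "comult_right d (u + v) = comult_right d u + comult_right d v"
  "comult_right d (fs_scale r u) = fs_scale r (comult_right d u)"
  "comult_right d (gen (a, b)) = ext_left a (d b)"
  by (simp_all add: ext_defs fs.lin_ext_add fs.lin_ext_fs_scale)

lemma ext_right_fmul: "ext_right (c * c') (u \<odot> v) = ext_right c u \<odot> ext_right c' v"
proof (induction u rule: fs_induct)
  case (gen x)
  show ?case
    by (induction v rule: fs_induct; cases x)
      (auto simp: fmul_simps ext_simps simp del: fs_scale_single)
qed (simp_all add: fmul_simps ext_simps)

lemma ext_left_fmul: "ext_left (c * c') (u \<odot> v) = ext_left c u \<odot> ext_left c' v"
proof (induction u rule: fs_induct)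
  case (gen x)
  show ?case
    by (induction v rule: fs_induct; cases x)
      (auto simp: fmul_simps ext_simps simp del: fs_scale_single)
qed (simp_all add: fmul_simps ext_simps)

context comm_algebra
begin

lemma ext_lin:
  "lin_mod fs_scale fs_scale (null3 scale) (ext_right c)"
  "lin_mod fs_scale fs_scale (null3 scale) (ext_left c)"
  "lin_mod fs_scale fs_scale (null3 scale) (comult_left d)"
  "lin_mod fs_scale fs_scale (null3 scale) (comult_right d)"
  by (simp_all add: lin_mod_def ext_simps comult_ext_simps)

lemma ext_lin_param:
  "lin_mod scale fs_scale (null3 scale) (\<lambda>c. ext_right c u)"
  "lin_mod scale fs_scale (null3 scale) (\<lambda>c. ext_left c u)"
  unfolding ext_defs by (intro N3.lin_ext_lin_param; auto simp: gen3_lin)+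

lemma ext_null:
  assumes "u \<in> null2 scale"
  shows "ext_right c u \<in> null3 scale" "ext_left c u \<in> null3 scale"
  by (rule N3.null2_mem[OF _ _ _ assms]; simp add: ext_lin ext_simps gen3_lin)+

lemma ext_cong:
  assumes "eqm (null2 scale) u v"
  shows "eqm (null3 scale) (ext_right c u) (ext_right c v)"
    and "eqm (null3 scale) (ext_left c u) (ext_left c v)"
  using eqm_image[OF N3.mod_space_axioms ext_lin(1) ext_null(1) assms]
    eqm_image[OF N3.mod_space_axioms ext_lin(2) ext_null(2) assms] by auto

lemma comult_ext_null:
  assumes d: "lin_mod scale fs_scale (null2 scale) d" and u: "u \<in> null2 scale"
  shows "comult_left d u \<in> null3 scale" "comult_right d u \<in> null3 scale"
proof -
  show "comult_left d u \<in> null3 scale"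
    by (rule N3.null2_mem[OF _ _ _ u])
      (auto simp: comult_ext_simps ext_lin ext_lin_param
        intro!: lin_mod_comp[OF N2.mod_space_axioms N3.mod_space_axioms d ext_lin(1) ext_null(1)])
  show "comult_right d u \<in> null3 scale"
    by (rule N3.null2_mem[OF _ _ _ u])
      (auto simp: comult_ext_simps ext_lin ext_lin_param
        intro!: lin_mod_comp[OF N2.mod_space_axioms N3.mod_space_axioms d ext_lin(2) ext_null(2)])
qed

lemma comult_ext_cong:
  assumes d: "lin_mod scale fs_scale (null2 scale) d" and "eqm (null2 scale) u v"
  shows "eqm (null3 scale) (comult_left d u) (comult_left d v)"
    and "eqm (null3 scale) (comult_right d u) (comult_right d v)"
  using eqm_image[OF N3.mod_space_axioms ext_lin(3) comult_ext_null(1)[OF d] assms(2)]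
    eqm_image[OF N3.mod_space_axioms ext_lin(4) comult_ext_null(2)[OF d] assms(2)] by auto

text \<open>Allows the representatives picked by \<open>SOME\<close> in \<open>left3\<close> and
  \<open>right3\<close> to be exchanged for those of a given \<open>d\<close>.\<close>

lemma comult_ext_cong_fun:
  assumes "\<And>a. eqm (null2 scale) (d a) (d' a)"
  shows "eqm (null3 scale) (comult_left d u) (comult_left d' u)"
    and "eqm (null3 scale) (comult_right d u) (comult_right d' u)"
  unfolding comult_left_def comult_right_def
  by (intro N3.lin_ext_eqm; auto intro: ext_cong assms)+

text \<open>On generators this is multiplicativity of \<open>d\<close> in one slot and of the monoid
  product in the other. It is what carries coassociativity from two elements to their
  product.\<close>

lemma comult_ext_fmul:
  assumes d: "lin_mod scale fs_scale (null2 scale) d"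
    and m: "\<And>a b. eqm (null2 scale) (d (a * b)) (d a \<odot> d b)"
  shows "eqm (null3 scale) (comult_left d (u \<odot> v)) (comult_left d u \<odot> comult_left d v)"
    and "eqm (null3 scale) (comult_right d (u \<odot> v)) (comult_right d u \<odot> comult_right d v)"
proof -
  show "eqm (null3 scale) (comult_left d (u \<odot> v)) (comult_left d u \<odot> comult_left d v)"
  proof (induction u rule: fs_induct)
    case (gen x)
    show ?case
    proof (induction v rule: fs_induct)
      case (gen y)
      show ?case
        using ext_cong(1)[OF m]
        by (cases x; cases y) (simp add: fmul_gen comult_ext_simps flip: ext_right_fmul)
    qed (simp_all add: fmul_simps comult_ext_simps N3.eqm_add N3.eqm_scale del: fs_scale_single)
  qed (simp_all add: fmul_simps comult_ext_simps N3.eqm_add N3.eqm_scale del: fs_scale_single)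
  show "eqm (null3 scale) (comult_right d (u \<odot> v)) (comult_right d u \<odot> comult_right d v)"
  proof (induction u rule: fs_induct)
    case (gen x)
    show ?case
    proof (induction v rule: fs_induct)
      case (gen y)
      show ?case
        using ext_cong(2)[OF m]
        by (cases x; cases y) (simp add: fmul_gen comult_ext_simps flip: ext_left_fmul)
    qed (simp_all add: fmul_simps comult_ext_simps N3.eqm_add N3.eqm_scale del: fs_scale_single)
  qed (simp_all add: fmul_simps comult_ext_simps N3.eqm_add N3.eqm_scale del: fs_scale_single)
qed

lemma tens_right_cls: "tens_right scale (cls2 scale u) c = cls3 scale (ext_right c u)"
  unfolding tens_right_def ext_right_def
  by (rule q_linear_cls[OF N2.mod_space_axioms N3.mod_space_axioms mem_cls2 cls3_eq_iff])
    (metis ext_null(1) ext_right_def)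

lemma tens_left_cls: "tens_left scale c (cls2 scale u) = cls3 scale (ext_left c u)"
  unfolding tens_left_def ext_left_def
  by (rule q_linear_cls[OF N2.mod_space_axioms N3.mod_space_axioms mem_cls2 cls3_eq_iff])
    (metis ext_null(2) ext_left_def)

lemma left3_right3_cls:
  assumes d: "lin_mod scale fs_scale (null2 scale) d"
  shows "left3 scale (\<lambda>a. cls2 scale (d a)) (cls2 scale u) = cls3 scale (comult_left d u)"
    and "right3 scale (\<lambda>a. cls2 scale (d a)) (cls2 scale u) = cls3 scale (comult_right d u)"
proof -
  define d' where "d' a = (SOME u. u \<in> cls2 scale (d a))" for a
  have d': "eqm (null2 scale) (d' a) (d a)" for a
    unfolding d'_def mem_cls2 by (rule someI_ex) (blast intro: N2.eqm_refl)
  have lin: "lin_mod scale fs_scale (null2 scale) d'"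
    by (rule N2.lin_mod_cong[OF d d'])
  have "left3 scale (\<lambda>a. cls2 scale (d a)) (cls2 scale u) = cls3 scale (comult_left d' u)"
    unfolding left3_def d'_def[symmetric] ext_right_def[symmetric] comult_left_def
    by (rule q_linear_cls[OF N2.mod_space_axioms N3.mod_space_axioms mem_cls2 cls3_eq_iff])
      (metis comult_ext_null(1)[OF lin] comult_left_def)
  then show "left3 scale (\<lambda>a. cls2 scale (d a)) (cls2 scale u) = cls3 scale (comult_left d u)"
    by (simp add: cls3_eq_iff comult_ext_cong_fun d')
  have "right3 scale (\<lambda>a. cls2 scale (d a)) (cls2 scale u) = cls3 scale (comult_right d' u)"
    unfolding right3_def d'_def[symmetric] ext_left_def[symmetric] comult_right_def
    by (rule q_linear_cls[OF N2.mod_space_axioms N3.mod_space_axioms mem_cls2 cls3_eq_iff])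
      (metis comult_ext_null(2)[OF lin] comult_right_def)
  then show "right3 scale (\<lambda>a. cls2 scale (d a)) (cls2 scale u) = cls3 scale (comult_right d u)"
    by (simp add: cls3_eq_iff comult_ext_cong_fun d')
qed

end

section \<open>Hopf algebras in terms of representatives\<close>

text \<open>Here \<open>d a\<close> is a formal linear combination representing \<open>\<Delta> a\<close>.\<close>

locale comm_hopf_rep = comm_algebra scale
  for scale :: "'k::field \<Rightarrow> 'a::comm_ring_1 \<Rightarrow> 'a" +
  fixes d :: "'a \<Rightarrow> ('a \<times> 'a \<Rightarrow>\<^sub>0 'k)"
    and \<epsilon> :: "'a \<Rightarrow> 'k"
    and S :: "'a \<Rightarrow> 'a"
  assumes d_lin: "lin_mod scale fs_scale (null2 scale) d"
    and d_mult: "eqm (null2 scale) (d (a * b)) (d a \<odot> d b)"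
    and d_one: "eqm (null2 scale) (d 1) (gen 1)"
    and \<epsilon>_lin: "lin_mod scale (*) {0} \<epsilon>"
    and \<epsilon>_mult: "\<epsilon> (a * b) = \<epsilon> a * \<epsilon> b"
    and \<epsilon>_one: "\<epsilon> 1 = 1"
    and d_coassoc: "eqm (null3 scale) (comult_left d (d a)) (comult_right d (d a))"
    and d_counit_left: "lin_ext scale (\<lambda>(a1, a2). scale (\<epsilon> a1) a2) (d a) = a"
    and d_counit_right: "lin_ext scale (\<lambda>(a1, a2). scale (\<epsilon> a2) a1) (d a) = a"
    and S_lin: "lin_mod scale scale {0} S"
    and d_antipode_left: "lin_ext scale (\<lambda>(a1, a2). S a1 * a2) (d a) = scale (\<epsilon> a) 1"
    and d_antipode_right: "lin_ext scale (\<lambda>(a1, a2). a1 * S a2) (d a) = scale (\<epsilon> a) 1"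

lemma vector_space_mult: "vector_space ((*) :: 'k::field \<Rightarrow> 'k \<Rightarrow> 'k)"
  by unfold_locales (simp_all add: algebra_simps)

lemma (in comm_algebra) eval2_counit:
  assumes "lin_mod scale (*) {0} \<epsilon>"
  shows "eval2 scale (\<lambda>a1 a2. scale (\<epsilon> a1) a2) (cls2 scale u) = lin_ext scale (\<lambda>(a1, a2). scale (\<epsilon> a1) a2) u"
    and "eval2 scale (\<lambda>a1 a2. scale (\<epsilon> a2) a1) (cls2 scale u) = lin_ext scale (\<lambda>(a1, a2). scale (\<epsilon> a2) a1) u"
  using lin_mod_add[OF assms] lin_mod_scale[OF assms]
  by (intro eval2_cls; simp add: lin_mod_def scale_left_distrib scale_right_distrib mult.commute)+

lemma (in comm_algebra) scale_out:
  "scale c a * b = scale c (a * b)" "a * scale c b = scale c (a * b)"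
  using scale_mult_left[of c a b] scale_mult_right[of c a b] by simp_all

lemma (in comm_algebra) eval2_antipode:
  assumes "lin_mod scale scale {0} S"
  shows "eval2 scale (\<lambda>a1 a2. S a1 * a2) (cls2 scale u) = lin_ext scale (\<lambda>(a1, a2). S a1 * a2) u"
    and "eval2 scale (\<lambda>a1 a2. a1 * S a2) (cls2 scale u) = lin_ext scale (\<lambda>(a1, a2). a1 * S a2) u"
  using lin_mod_add[OF assms] lin_mod_scale[OF assms]
  by (intro eval2_cls; simp add: lin_mod_def algebra_simps scale_out)+

text \<open>Each operation on cosets has been computed on representatives, so the axioms translate
  one by one. The translation runs forwards for a given structure and backwards for a constructed
  one.\<close>

lemma comm_hopf_algebra_iff:
  "comm_hopf_algebra scale (\<lambda>a. cls2 scale (d a)) \<epsilon> S \<longleftrightarrow> comm_hopf_rep scale d \<epsilon> S"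
proof
  assume H: "comm_hopf_algebra scale (\<lambda>a. cls2 scale (d a)) \<epsilon> S"
  interpret comm_hopf_algebra scale "\<lambda>a. cls2 scale (d a)" \<epsilon> S by fact
  have lin: "lin_mod scale fs_scale (null2 scale) d"
    using comult_add comult_scale by (simp add: lin_mod_def add2_cls scale2_cls cls2_eq_iff)
  have \<epsilon>: "lin_mod scale (*) {0} \<epsilon>" and S: "lin_mod scale scale {0} S"
    by (simp_all add: linear_imp_lin_mod counit_linear antipode_linear)
  show "comm_hopf_rep scale d \<epsilon> S"
    using lin \<epsilon> S comult_mult comult_one counit_mult counit_one coassoc counit_left counit_right
      antipode_left antipode_right
    by unfold_locales
      (simp_all add: mult2_cls cls2_eq_iff cls3_eq_iff tens_def one_prod_def left3_right3_cls
        eval2_counit eval2_antipode)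
next
  assume "comm_hopf_rep scale d \<epsilon> S"
  then interpret comm_hopf_rep scale d \<epsilon> S .
  show "comm_hopf_algebra scale (\<lambda>a. cls2 scale (d a)) \<epsilon> S"
  proof (intro comm_hopf_algebra.intro comm_hopf_algebra_axioms.intro)
    show "comm_algebra scale" by (rule comm_algebra_axioms)
    show "Vector_Spaces.linear scale (*) \<epsilon>" "Vector_Spaces.linear scale scale S"
      by (simp_all add: linear_iff_lin_mod vector_space_mult vector_space_axioms \<epsilon>_lin S_lin)
  qed (simp_all only: add2_cls scale2_cls mult2_cls cls2_eq_iff cls3_eq_iff tens_def
      left3_right3_cls[OF d_lin] eval2_counit[OF \<epsilon>_lin] eval2_antipode[OF S_lin] tensor2_eq rangeI
      lin_mod_add[OF d_lin] lin_mod_scale[OF d_lin] d_mult d_one[unfolded one_prod_def] \<epsilon>_mult \<epsilon>_one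
      d_coassoc d_counit_left d_counit_right d_antipode_left d_antipode_right)
qed

lemma (in comm_hopf_algebra) obtain_rep:
  obtains d where "\<Delta> = (\<lambda>a. cls2 scale (d a))"
proof -
  have "\<forall>a. \<exists>u. \<Delta> a = cls2 scale u"
    using comult_closed by (auto simp: tensor2_eq)
  then show ?thesis using that by (metis (no_types, lifting) ext)
qed

context comm_algebra
begin

text \<open>Contractions of triple tensors become iterated Sweedler sums, so that the counit and
  antipode axioms can be applied to the inner sum.\<close>

lemma lin_ext_ext:
  "lin_ext scale f (ext_right c u) = lin_ext scale (\<lambda>(a, b). f (a, b, c)) u"
  "lin_ext scale f (ext_left c u) = lin_ext scale (\<lambda>(a, b). f (c, a, b)) u"
  "lin_ext scale f (comult_left d u) =
     lin_ext scale (\<lambda>(a, b). lin_ext scale (\<lambda>(a1, a2). f (a1, a2, b)) (d a)) u"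
  "lin_ext scale f (comult_right d u) =
     lin_ext scale (\<lambda>(a, b). lin_ext scale (\<lambda>(b1, b2). f (a, b1, b2)) (d b)) u"
  by (induction u rule: fs_induct;
      auto simp: ext_simps comult_ext_simps lin_ext_add lin_ext_fs_scale ext_defs lin_ext_lin_ext
        case_prod_unfold simp del: fs_scale_single)+

lemma lin_ext_mult_left: "lin_ext scale (\<lambda>x. a * f x) u = a * lin_ext scale f u"
  by (simp add: lin_ext_def sum_distrib_left scale_mult_right)

lemma lin_ext_mult_right: "lin_ext scale (\<lambda>x. f x * a) u = lin_ext scale f u * a"
  by (simp add: lin_ext_def sum_distrib_right scale_mult_left)

lemma lin_ext_linear_comp:
  assumes "lin_mod scale scale {0} f"
  shows "f (lin_ext scale h u) = lin_ext scale (\<lambda>x. f (h x)) u"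
  using lin_mod_add[OF assms] lin_mod_scale[OF assms]
  by (induction u rule: fs_induct) (simp_all add: lin_ext_add lin_ext_fs_scale del: fs_scale_single)

text \<open>A multiplicative map on the basis monoid extends to an algebra map on its monoid
  algebra.\<close>

lemma lin_ext_fmul:
  assumes "\<And>x y. f (x * y) = f x * f y"
  shows "lin_ext scale f (u \<odot> v) = lin_ext scale f u * lin_ext scale f v"
proof (induction u rule: fs_induct)
  case (gen x)
  show ?case
    by (induction v rule: fs_induct)
      (simp_all add: fmul_simps assms lin_ext_add lin_ext_fs_scale algebra_simps scale_mult_right
        del: fs_scale_single)
qed (simp_all add: fmul_simps lin_ext_add lin_ext_fs_scale algebra_simps scale_mult_left)

lemma lin_ext_null2:
  assumes "\<And>b. lin_mod scale scale {0} (\<lambda>a. f (a, b))" "\<And>a. lin_mod scale scale {0} (\<lambda>b. f (a, b))"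
    and "eqm (null2 scale) u v"
  shows "lin_ext scale f u = lin_ext scale f v"
  using Z.null2_mem[OF lin_ext_lin0[of f] _ _ assms(3)[unfolded eqm_def]] assms(1,2)
  by (simp add: lin_ext_diff)

lemma lin_ext_null3:
  assumes "\<And>b c. lin_mod scale scale {0} (\<lambda>a. f (a, b, c))"
    and "\<And>a c. lin_mod scale scale {0} (\<lambda>b. f (a, b, c))"
    and "\<And>a b. lin_mod scale scale {0} (\<lambda>c. f (a, b, c))"
    and "eqm (null3 scale) u v"
  shows "lin_ext scale f u = lin_ext scale f v"
  using Z.null3_mem[OF lin_ext_lin0[of f] _ _ _ assms(4)[unfolded eqm_def]] assms(1-3)
  by (simp add: lin_ext_diff)

end

section \<open>Convolution and properties of the antipode\<close>

context comm_hopf_rep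
begin

lemma \<epsilon>_simps: "\<epsilon> (a + b) = \<epsilon> a + \<epsilon> b" "\<epsilon> (scale c a) = c * \<epsilon> a"
  using lin_mod_add[OF \<epsilon>_lin] lin_mod_scale[OF \<epsilon>_lin] by auto

lemma S_simps: "S (a + b) = S a + S b" "S (scale c a) = scale c (S a)"
  using lin_mod_add[OF S_lin] lin_mod_scale[OF S_lin] by auto

text \<open>\<open>T(a) = \<Sum> T(a\<^sub>1) a\<^sub>2 S(a\<^sub>3) = \<Sum> \<epsilon>(a\<^sub>1) c S(a\<^sub>2)\<close>.\<close>

lemma convolution_cancel:
  assumes T: "lin_mod scale scale {0} T"
    and eq: "\<And>a. lin_ext scale (\<lambda>(a1, a2). T a1 * a2) (d a) = scale (\<epsilon> a) c"
  shows "T a = c * S a"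
proof -
  have T': "T (a + b) = T a + T b" "T (scale r a) = scale r (T a)" for a b r
    using lin_mod_add[OF T] lin_mod_scale[OF T] by auto
  let ?f = "\<lambda>(a1, a2, a3). T a1 * a2 * S a3"
  have "lin_ext scale ?f (comult_left d (d a)) =
      lin_ext scale (\<lambda>(x, y). lin_ext scale (\<lambda>(a1, a2). (T a1 * a2) * S y) (d x)) (d a)"
    by (simp add: lin_ext_ext)
  also have "\<dots> = lin_ext scale (\<lambda>(x, y). c * S (scale (\<epsilon> x) y)) (d a)"
    by (intro arg_cong[where f = "\<lambda>f. lin_ext scale f (d a)"])
      (auto simp: fun_eq_iff case_prod_unfold lin_ext_mult_right eq[unfolded case_prod_unfold] S_simps
        scale_mult_left[symmetric] scale_mult_right[symmetric])
  also have "\<dots> = c * S (lin_ext scale (\<lambda>(x, y). scale (\<epsilon> x) y) (d a))"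
    by (simp add: case_prod_unfold lin_ext_mult_left lin_ext_linear_comp[OF S_lin])
  finally have 1: "lin_ext scale ?f (comult_left d (d a)) = c * S a"
    by (simp add: d_counit_left)
  have "lin_ext scale ?f (comult_right d (d a)) =
      lin_ext scale (\<lambda>(x, y). lin_ext scale (\<lambda>(a1, a2). T x * (a1 * S a2)) (d y)) (d a)"
    by (simp add: lin_ext_ext mult.assoc)
  also have "\<dots> = lin_ext scale (\<lambda>(x, y). T (scale (\<epsilon> y) x)) (d a)"
    by (intro arg_cong[where f = "\<lambda>f. lin_ext scale f (d a)"])
      (auto simp: fun_eq_iff case_prod_unfold lin_ext_mult_left
        d_antipode_right[unfolded case_prod_unfold] T' scale_mult_right[symmetric])
  also have "\<dots> = T (lin_ext scale (\<lambda>(x, y). scale (\<epsilon> y) x) (d a))"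
    by (simp add: case_prod_unfold lin_ext_linear_comp[OF T])
  finally have 2: "lin_ext scale ?f (comult_right d (d a)) = T a"
    by (simp add: d_counit_right)
  have "lin_ext scale ?f (comult_left d (d a)) = lin_ext scale ?f (comult_right d (d a))"
    by (rule lin_ext_null3[OF _ _ _ d_coassoc])
      (auto intro!: lin0_I simp: T' S_simps algebra_simps scale_out)
  with 1 2 show ?thesis by simp
qed

text \<open>The map \<open>(a, b) \<mapsto> S (a * b)\<close> is a left convolution inverse of
  multiplication, and two cancellations evaluate it. The first, in the variable \<open>a\<close>,
  yields \<open>\<Sum> S (a * b\<^sub>1) * b\<^sub>2 = \<epsilon>(b) S(a)\<close>; the second, in
  \<open>b\<close> with constant \<open>c = S a\<close>, yields the product.\<close>

lemma S_mult: "S (a * b) = S a * S b"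
proof -
  \<comment> \<open>The antipode axiom at \<open>a * b\<close>, with the representative of the
    comultiplication of the product replaced by the product of representatives.\<close>
  have G: "lin_ext scale (\<lambda>(a1, a2). S a1 * a2) (d a \<odot> d b) = scale (\<epsilon> a * \<epsilon> b) 1" for a b
    by (subst d_antipode_left[of "a * b", unfolded \<epsilon>_mult, symmetric],
        rule lin_ext_null2[OF _ _ N2.eqm_sym[OF d_mult]])
      (auto intro!: lin0_I simp: S_simps algebra_simps scale_out)
  have GG: "lin_ext scale f (u \<odot> v) = lin_ext scale (\<lambda>x. lin_ext scale (\<lambda>y. f (x * y)) v) u" for f u v
    by (simp add: fmul_def bilin_ext_def lin_ext_lin_ext)
  have T1: "lin_ext scale (\<lambda>(b1, b2). S (a * b1) * b2) (d b) = scale (\<epsilon> b) 1 * S a" for a b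
  proof (rule convolution_cancel)
    show "lin_mod scale scale {0} (\<lambda>a. lin_ext scale (\<lambda>(b1, b2). S (a * b1) * b2) (d b))"
      by (intro Z.lin_ext_lin_param)
        (auto intro!: lin0_I simp: S_simps algebra_simps scale_out)
    show "lin_ext scale (\<lambda>(a1, a2). lin_ext scale (\<lambda>(b1, b2). S (a1 * b1) * b2) (d b) * a2) (d x) =
        scale (\<epsilon> x) (scale (\<epsilon> b) 1)" for x
      using G[of x b] unfolding GG
      by (simp add: case_prod_unfold times_prod_def mult.commute mult.assoc
          flip: lin_ext_mult_right lin_ext_mult_left)
  qed
  show ?thesis
  proof (rule convolution_cancel)
    show "lin_mod scale scale {0} (\<lambda>b. S (a * b))"
      by (auto intro!: lin0_I simp: S_simps algebra_simps scale_out)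
    show "lin_ext scale (\<lambda>(b1, b2). S (a * b1) * b2) (d x) = scale (\<epsilon> x) (S a)" for x
      by (simp add: T1 scale_out)
  qed
qed

text \<open>Cancellation with \<open>c = 1\<close>: a left convolution inverse of the identity
  equals the antipode.\<close>

lemma S_unique:
  assumes "comm_hopf_rep scale d \<epsilon> S'"
  shows "S' = S"
proof -
  interpret S': comm_hopf_rep scale d \<epsilon> S' by fact
  show ?thesis
    using convolution_cancel[of S' 1, OF S'.S_lin S'.d_antipode_left] by auto
qed

lemma S_one: "S 1 = 1"
proof -
  have "lin_ext scale (\<lambda>(a1, a2). S a1 * a2) (d 1) = lin_ext scale (\<lambda>(a1, a2). S a1 * a2) (gen 1)"
    by (rule lin_ext_null2[OF _ _ d_one])
      (auto intro!: lin0_I simp: S_simps algebra_simps scale_out)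
  then show ?thesis by (simp add: d_antipode_left \<epsilon>_one one_prod_def)
qed

text \<open>At a group-like element the Sweedler sum in the antipode axiom has a single term. Hence
  \<open>S g\<close> serves as \<open>g\<^sup>-\<^sup>1\<close>.\<close>

lemma S_group_like:
  assumes "eqm (null2 scale) (d g) (gen (g, g))" "\<epsilon> g = 1"
  shows "S g * g = 1"
proof -
  have "lin_ext scale (\<lambda>(a1, a2). S a1 * a2) (d g) = lin_ext scale (\<lambda>(a1, a2). S a1 * a2) (gen (g, g))"
    by (rule lin_ext_null2[OF _ _ assms(1)])
      (auto intro!: lin0_I simp: S_simps algebra_simps scale_out)
  then show ?thesis by (simp add: d_antipode_left assms(2))
qed

end

text \<open>Congruent representatives define the same coset-valued map, so passing through cosets
  transfers all axioms at once.\<close>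

lemma comm_hopf_rep_cong:
  assumes "comm_hopf_rep scale d \<epsilon> S" "\<And>a. eqm (null2 scale) (d' a) (d a)"
  shows "comm_hopf_rep scale d' \<epsilon> S"
proof -
  have "(\<lambda>a. cls2 scale (d' a)) = (\<lambda>a. cls2 scale (d a))"
    by (rule ext) (simp add: cls2_eq_iff assms(2))
  with assms(1) show ?thesis by (metis comm_hopf_algebra_iff)
qed

section \<open>The bracket on the tensor square\<close>

context poisson_algebra
begin

lemma br_lin: "lin_mod scale scale {0} (\<lambda>a. br a b)" "lin_mod scale scale {0} (br a)"
  using br_linear_left br_linear_right by (auto intro: linear_imp_lin_mod)

lemma br_simps:
  "br (a + a') b = br a b + br a' b" "br (scale c a) b = scale c (br a b)"
  "br a (b + b') = br a b + br a b'" "br a (scale c b) = scale c (br a b)"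
  using lin_mod_add[OF br_lin(1)] lin_mod_scale[OF br_lin(1)]
    lin_mod_add[OF br_lin(2)] lin_mod_scale[OF br_lin(2)] by auto

lemma br_anti: "br a b = - br b a"
proof -
  have "br a b + br b a = 0"
    using br_alternating[of "a + b", unfolded br_simps] by (simp add: br_alternating add.commute)
  then show ?thesis by (simp add: eq_neg_iff_add_eq_0)
qed

lemma br_leibniz_left: "br (a * b) c = br a c * b + a * br b c"
  using br_leibniz[of c a b] by (simp add: br_anti[of _ c])

definition bracket_rep :: "('a \<times> 'a \<Rightarrow>\<^sub>0 'k) \<Rightarrow> ('a \<times> 'a \<Rightarrow>\<^sub>0 'k) \<Rightarrow> ('a \<times> 'a \<Rightarrow>\<^sub>0 'k)" where
  "bracket_rep = bilin_ext (\<lambda>(a, b) (c, d). gen (a * c, br b d) + gen (br a c, b * d))"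

lemma bracket_rep_simps:
  "bracket_rep (u + u') v = bracket_rep u v + bracket_rep u' v"
  "bracket_rep u (v + v') = bracket_rep u v + bracket_rep u v'"
  "bracket_rep (fs_scale r u) v = fs_scale r (bracket_rep u v)"
  "bracket_rep u (fs_scale r v) = fs_scale r (bracket_rep u v)"
  "bracket_rep (gen (a, b)) (gen (c, d)) = gen (a * c, br b d) + gen (br a c, b * d)"
  by (simp_all add: bracket_rep_def bilin_ext_simps)

lemma gen2_uminus:
  "eqm (null2 scale) (gen (- a, b)) (- gen (a, b))" "eqm (null2 scale) (gen (a, - b)) (- gen (a, b))"
  using N2.lin_mod_uminus[OF gen2_lin(1)] N2.lin_mod_uminus[OF gen2_lin(2)] by auto

text \<open>Antisymmetry can hold only as a congruence: \<open>gen (- a, b)\<close> and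
  \<open>- gen (a, b)\<close> are different formal sums.\<close>

lemma bracket_rep_anti: "eqm (null2 scale) (bracket_rep u v) (- bracket_rep v u)"
proof (induction u rule: fs_induct)
  case (gen x)
  obtain a b where x: "x = (a, b)" by fastforce
  show ?case
  proof (induction v rule: fs_induct)
    case (gen y)
    obtain c d where y: "y = (c, d)" by fastforce
    show ?case
      using N2.eqm_add[OF gen2_uminus(2)[of "a * c" "br d b"] gen2_uminus(1)[of "br c a" "b * d"]]
      by (simp add: x y bracket_rep_simps br_anti[of b] br_anti[of a] mult.commute)
  qed (use N2.eqm_add N2.eqm_scale in \<open>fastforce simp: bracket_rep_simps simp del: fs_scale_single\<close>)+
qed (use N2.eqm_add N2.eqm_scale in \<open>fastforce simp: bracket_rep_simps simp del: fs_scale_single\<close>)+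

lemma bracket_rep_null_right: "v \<in> null2 scale \<Longrightarrow> bracket_rep u v \<in> null2 scale"
proof (induction u rule: fs_induct)
  case (gen x)
  obtain a b where x: "x = (a, b)" by fastforce
  show ?case
    unfolding x
  proof (rule N2.null2_mem[OF _ _ _ gen])
    show "lin_mod fs_scale fs_scale (null2 scale) (bracket_rep (gen (a, b)))"
      by (simp add: lin_mod_def bracket_rep_simps)
  qed (auto simp: bracket_rep_simps intro!: N2.lin_mod_plus gen2_comp mult_lin0 br_lin)
qed (auto simp: bracket_rep_simps intro!: fs.subspace_add fs.subspace_scale N2.subspace)

lemma bracket_rep_null_left: "u \<in> null2 scale \<Longrightarrow> bracket_rep u v \<in> null2 scale"
  using bracket_rep_null_right[of u v] bracket_rep_anti[of u v] fs.subspace_neg[OF N2.subspace]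
  by (metis N2.eqm_mem N2.eqm_trans)

lemma bracket_rep_cong:
  assumes "eqm (null2 scale) u u'" "eqm (null2 scale) v v'"
  shows "eqm (null2 scale) (bracket_rep u v) (bracket_rep u' v')"
proof -
  have l: "lin_mod fs_scale fs_scale (null2 scale) (\<lambda>u. bracket_rep u v)"
    "lin_mod fs_scale fs_scale (null2 scale) (bracket_rep u)" for u v
    by (simp_all add: lin_mod_def bracket_rep_simps)
  show ?thesis
    using N2.eqm_trans[OF eqm_image[OF N2.mod_space_axioms l(1) bracket_rep_null_left assms(1)]
        eqm_image[OF N2.mod_space_axioms l(2) bracket_rep_null_right assms(2)]] .
qed

lemma bracket2_cls: "bracket2 scale br (cls2 scale u) (cls2 scale v) = cls2 scale (bracket_rep u v)"
  unfolding bracket2_def bracket_rep_def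
  by (rule q_bilinear_cls[OF N2.mod_space_axioms mem_cls2 cls2_eq_iff])
    (use bracket_rep_null_left bracket_rep_null_right in \<open>simp_all add: bracket_rep_def\<close>)

text \<open>Antisymmetry alone yields \<open>2 {u, u} = 0\<close>, which is empty in characteristic
  two. In the induction it cancels the cross terms of a sum, and on a generator both summands vanish
  because \<open>br\<close> is alternating.\<close>

lemma bracket_rep_alternating: "eqm (null2 scale) (bracket_rep u u) 0"
proof (induction u rule: fs_induct)
  case (add u v)
  have "eqm (null2 scale) (bracket_rep u u + bracket_rep v v + (bracket_rep u v + bracket_rep v u))
      (0 + 0 + (- bracket_rep v u + bracket_rep v u))"
    using add by (intro N2.eqm_add bracket_rep_anti N2.eqm_refl)
  then show ?case by (simp add: bracket_rep_simps algebra_simps)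
next
  case (scale c u)
  then show ?case
    using N2.eqm_scale[OF N2.eqm_scale[OF scale], of c c] by (simp add: bracket_rep_simps)
next
  case (gen x)
  then show ?case
    using N2.eqm_add[OF N2.lin_mod_0[OF gen2_lin(2)] N2.lin_mod_0[OF gen2_lin(1)]]
    by (cases x) (simp add: bracket_rep_simps br_alternating)
qed

text \<open>Both sides are trilinear, so generators suffice; there the rule is the Leibniz rule of
  \<open>br\<close> in either slot, followed by additivity of the tensor in that slot.\<close>

lemma bracket_rep_leibniz:
  "eqm (null2 scale) (bracket_rep u (v \<odot> w)) (bracket_rep u v \<odot> w + v \<odot> bracket_rep u w)"
proof (induction u rule: fs_induct)
  case (gen x)
  obtain a b where x: "x = (a, b)" by fastforce
  show ?case
  proof (induction v rule: fs_induct)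
    case (gen y)
    obtain c d where y: "y = (c, d)" by fastforce
    show ?case
    proof (induction w rule: fs_induct)
      case (gen z)
      obtain e f where z: "z = (e, f)" by fastforce
      show ?case
        using N2.eqm_add[OF
            lin_mod_add[OF gen2_lin(2)[of scale "a * (c * e)"], of "br b d * f" "d * br b f"]
            lin_mod_add[OF gen2_lin(1)[of scale "b * (d * f)"], of "br a c * e" "c * br a e"]]
        by (simp add: x y z bracket_rep_simps fmul_simps br_leibniz mult_ac add_ac)
    next
      case (add u v)
      then show ?case
        using N2.eqm_add[OF add] by (simp add: bracket_rep_simps fmul_simps add_ac)
    next
      case (scale r u)
      then show ?case
        using N2.eqm_scale[OF scale, of r]
        by (simp add: bracket_rep_simps fmul_simps fs.scale_right_distrib)
    qed
  next
    case (add u v)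
    then show ?case
      using N2.eqm_add[OF add] by (simp add: bracket_rep_simps fmul_simps add_ac)
  next
    case (scale r u)
    then show ?case
      using N2.eqm_scale[OF scale, of r]
      by (simp add: bracket_rep_simps fmul_simps fs.scale_right_distrib)
  qed
next
  case (add u v)
  then show ?case
    using N2.eqm_add[OF add] by (simp add: bracket_rep_simps fmul_simps add_ac)
next
  case (scale r u)
  then show ?case
    using N2.eqm_scale[OF scale, of r]
    by (simp add: bracket_rep_simps fmul_simps fs.scale_right_distrib)
qed

end

locale poisson_hopf_rep =
  poisson_algebra scale br + comm_hopf_rep scale d \<epsilon> S
  for scale :: "'k::field \<Rightarrow> 'a::comm_ring_1 \<Rightarrow> 'a" and br d \<epsilon> S +
  assumes d_br: "eqm (null2 scale) (d (br a b)) (bracket_rep (d a) (d b))"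

lemma poisson_hopf_algebra_iff:
  "poisson_hopf_algebra scale br (\<lambda>a. cls2 scale (d a)) \<epsilon> S \<longleftrightarrow> poisson_hopf_rep scale br d \<epsilon> S"
proof -
  have "bracket2 scale br (cls2 scale (d a)) (cls2 scale (d b)) =
      cls2 scale (poisson_algebra.bracket_rep br (d a) (d b))" if "poisson_algebra scale br" for a b
    using that by (rule poisson_algebra.bracket2_cls)
  then show ?thesis
    unfolding poisson_hopf_algebra_def poisson_hopf_rep_def comm_hopf_algebra_iff
      poisson_hopf_algebra_axioms_def poisson_hopf_rep_axioms_def
    by (simp add: cls2_eq_iff cong: conj_cong)
qed

section \<open>Poisson polynomial algebras\<close>

lemma poly_gen_induct [case_names const var add mult]:
  assumes const: "\<And>a. P (const_poly a)" and var: "P var_poly"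
    and add: "\<And>p q. P p \<Longrightarrow> P q \<Longrightarrow> P (p + q)" and mult: "\<And>p q. P p \<Longrightarrow> P q \<Longrightarrow> P (p * q)"
  shows "P p"
proof (induction p)
  case 0
  show ?case using const[of 0] by simp
next
  case (pCons a p)
  have "pCons a p = const_poly a + var_poly * p" by simp
  then show ?case by (metis const var add mult pCons.IH)
qed

text \<open>Scaling by \<open>c\<close> is multiplication by the constant \<open>scale c 1\<close>
  of \<open>B\<close>. Homogeneity of the extended maps thus follows from their behaviour on
  products and constants.\<close>

lemma (in comm_algebra) poly_scale_eq: "poly_scale scale c p = smult (scale c 1) p"
  by (rule poly_eqI) (simp add: poly_scale_def coeff_map_poly scale_out)

lemma (in comm_algebra) poly_scale_const: "poly_scale scale c (const_poly a) = const_poly (scale c a)"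
  by (simp add: poly_scale_eq scale_out)

lemma (in comm_algebra) comm_algebra_poly: "comm_algebra (poly_scale scale)"
proof unfold_locales
  fix c d p q
  show "poly_scale scale c (p + q) = poly_scale scale c p + poly_scale scale c q"
    "poly_scale scale (c + d) p = poly_scale scale c p + poly_scale scale d p"
    "poly_scale scale c (poly_scale scale d p) = poly_scale scale (c * d) p"
    "poly_scale scale 1 p = p"
    "poly_scale scale c (p * q) = poly_scale scale c p * q"
    by (simp_all add: poly_scale_eq smult_add_right smult_add_left scale_left_distrib scale_out
        mult.commute)
qed

text \<open>For a derivation \<open>D : B \<rightarrow> B[x]\<close>, this is the derivation of \<open>B[x]\<close> extending \<open>D\<close> with
  \<open>x \<mapsto> y\<close>.\<close>

definition deriv_ext :: "('a::comm_ring_1 \<Rightarrow> 'a poly) \<Rightarrow> 'a poly \<Rightarrow> 'a poly \<Rightarrow> 'a poly" where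
  "deriv_ext D y p =
     snd (fold_coeffs (\<lambda>a b. (pCons a (fst b), D a + pCons 0 (snd b) + fst b * y)) p (0, 0))"

lemma deriv_ext_0 [simp]: "deriv_ext D y 0 = 0"
  by (simp add: deriv_ext_def)

lemma deriv_ext_pCons:
  assumes "D 0 = 0"
  shows "deriv_ext D y (pCons a p) = D a + pCons 0 (deriv_ext D y p) + p * y"
proof -
  let ?F = "\<lambda>a b. (pCons a (fst b), D a + pCons 0 (snd b) + fst b * y)"
  \<comment> \<open>\<open>fold_coeffs\<close> performs no step on the zero polynomial;
    \<open>D 0 = 0\<close> makes the recursion true there as well.\<close>
  have step: "fold_coeffs ?F (pCons a p) (0, 0) = ?F a (fold_coeffs ?F p (0, 0))" for a p
    using assms by (cases "a = 0 \<and> p = 0") auto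
  \<comment> \<open>The first component rebuilds the polynomial folded so far; the product rule for
    \<open>x * p\<close> needs it in the term \<open>p * y\<close>.\<close>
  have "fst (fold_coeffs ?F p (0, 0)) = p" for p
    by (induction p) (simp_all add: step)
  then show ?thesis
    by (simp add: deriv_ext_def step)
qed

lemma deriv_ext_const: "D 0 = 0 \<Longrightarrow> deriv_ext D y (const_poly a) = D a"
  and deriv_ext_var: "D 0 = 0 \<Longrightarrow> D 1 = 0 \<Longrightarrow> deriv_ext D y var_poly = y"
  by (simp_all add: deriv_ext_pCons)

text \<open>An extended derivation depends linearly on its values on generators. This gives
  additivity and the Leibniz rule of \<open>poly_br\<close> in the left argument, which enters the
  outer extension only through those values.\<close>

lemma deriv_ext_fun_add:
  assumes "D 0 = 0" "E 0 = 0"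
  shows "deriv_ext (\<lambda>a. D a + E a) (y + z) p = deriv_ext D y p + deriv_ext E z p"
  using assms by (induction p) (simp_all add: deriv_ext_pCons algebra_simps)

lemma deriv_ext_fun_mult:
  assumes "D 0 = 0"
  shows "deriv_ext (\<lambda>a. r * D a) (r * y) p = r * deriv_ext D y p"
  using assms by (induction p) (simp_all add: deriv_ext_pCons algebra_simps)

lemma deriv_ext_add:
  assumes D: "\<And>a b. D (a + b) = D a + D b"
  shows "deriv_ext D y (p + q) = deriv_ext D y p + deriv_ext D y q"
proof (induction p q rule: poly_induct2)
  case (pCons a p b q)
  have "D 0 = 0" using D[of 0 0] by simp
  with pCons show ?case by (simp add: deriv_ext_pCons D algebra_simps)
qed simp

lemma deriv_ext_mult:
  assumes D: "\<And>a b. D (a + b) = D a + D b"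
    and L: "\<And>a b. D (a * b) = D a * const_poly b + const_poly a * D b"
  shows "deriv_ext D y (p * q) = deriv_ext D y p * q + p * deriv_ext D y q"
proof (induction p)
  case (pCons a p)
  have D0: "D 0 = 0" using D[of 0 0] by simp
  have s: "deriv_ext D y (smult a q) = D a * q + smult a (deriv_ext D y q)"
  proof (induction q)
    case (pCons b q)
    then show ?case by (simp add: deriv_ext_pCons D0 L algebra_simps smult_add_right)
  qed simp
  show ?case
    using pCons by (simp add: deriv_ext_pCons D0 s deriv_ext_add[OF D] algebra_simps)
qed simp

section \<open>The Poisson bracket on B[x]\<close>

locale poisson_poly_data = poisson_algebra scale br
  for scale :: "'k::field \<Rightarrow> 'b::comm_ring_1 \<Rightarrow> 'b" and br +
  fixes \<alpha> \<delta> :: "'b \<Rightarrow> 'b"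
  assumes \<alpha>_deriv: "poisson_derivation scale br \<alpha>"
    and \<delta>_deriv: "algebra_derivation scale \<delta>"
    and \<delta>_br: "\<delta> (br a b) = br (\<delta> a) b + br a (\<delta> b) + \<alpha> a * \<delta> b - \<delta> a * \<alpha> b"
begin

abbreviation "ps \<equiv> poly_scale scale"

sublocale poly: comm_algebra ps
  by (rule comm_algebra_poly)

lemma \<alpha>_lin: "lin_mod scale scale {0} \<alpha>" and \<delta>_lin: "lin_mod scale scale {0} \<delta>"
  using \<alpha>_deriv \<delta>_deriv
  by (auto simp: poisson_derivation_def algebra_derivation_def intro: linear_imp_lin_mod)

lemma \<alpha>_\<delta>_simps:
  "\<alpha> (a + b) = \<alpha> a + \<alpha> b" "\<alpha> (scale c a) = scale c (\<alpha> a)"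
  "\<delta> (a + b) = \<delta> a + \<delta> b" "\<delta> (scale c a) = scale c (\<delta> a)"
  using lin_mod_add[OF \<alpha>_lin] lin_mod_scale[OF \<alpha>_lin]
    lin_mod_add[OF \<delta>_lin] lin_mod_scale[OF \<delta>_lin] by auto

lemma \<alpha>_mult: "\<alpha> (a * b) = \<alpha> a * b + a * \<alpha> b" and \<alpha>_br: "\<alpha> (br a b) = br (\<alpha> a) b + br a (\<alpha> b)"
  and \<delta>_mult: "\<delta> (a * b) = \<delta> a * b + a * \<delta> b"
  using \<alpha>_deriv \<delta>_deriv by (auto simp: poisson_derivation_def algebra_derivation_def)

lemma zeros: "\<alpha> 0 = 0" "\<delta> 0 = 0" "br 0 a = 0" "br a 0 = 0" "\<alpha> 1 = 0" "\<delta> 1 = 0" "br 1 a = 0" "br a 1 = 0"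
  using \<alpha>_\<delta>_simps(1,3)[of 0 0] br_simps(1)[of 0 0 a] br_simps(3)[of a 0 0]
    \<alpha>_mult[of 1 1] \<delta>_mult[of 1 1] br_leibniz[of a 1 1] br_leibniz_left[of 1 1 a] by auto

definition var_br :: "'b \<Rightarrow> 'b poly" where
  "var_br b = [:\<delta> b, \<alpha> b:]"

lemma var_br_simps: "var_br (a + b) = var_br a + var_br b" "var_br (a * b) = var_br a * const_poly b + const_poly a * var_br b" "var_br 0 = 0" "var_br 1 = 0"
  by (simp_all add: var_br_def \<alpha>_\<delta>_simps \<alpha>_mult \<delta>_mult zeros mult.commute)

text \<open>Two nested extensions. The inner ones are the derivations \<open>{-, b}\<close>, sending
  \<open>a\<close> to \<open>{a, b}\<close> and \<open>x\<close> to \<open>var_br b\<close>, and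
  \<open>{-, x}\<close>, sending \<open>a\<close> to \<open>- var_br a\<close> and \<open>x\<close>
  to \<open>0\<close>. Their values at \<open>p\<close> are the values on generators of the outer
  derivation \<open>{p, -}\<close>.\<close>

definition poly_br :: "'b poly \<Rightarrow> 'b poly \<Rightarrow> 'b poly" where
  "poly_br p q = deriv_ext (\<lambda>b. deriv_ext (\<lambda>a. const_poly (br a b)) (var_br b) p)
     (deriv_ext (\<lambda>a. - var_br a) 0 p) q"

lemma inner_add:
  "deriv_ext (\<lambda>a. const_poly (br a (b + c))) (var_br (b + c)) p =
    deriv_ext (\<lambda>a. const_poly (br a b)) (var_br b) p + deriv_ext (\<lambda>a. const_poly (br a c)) (var_br c) p"
  using deriv_ext_fun_add[of "\<lambda>a. const_poly (br a b)" "\<lambda>a. const_poly (br a c)" "var_br b" "var_br c" p]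
  by (simp add: zeros br_simps var_br_simps)

lemma inner_zero: "deriv_ext (\<lambda>a. const_poly (br a 0)) (var_br 0) p = 0"
  using inner_add[of 0 0 p] by simp

text \<open>For fixed \<open>p\<close>, \<open>b \<mapsto> {p, b}\<close> has to be a derivation
  from \<open>B\<close> to \<open>B[x]\<close> before the outer extension can be one.\<close>

lemma inner_mult:
  "deriv_ext (\<lambda>a. const_poly (br a (b * c))) (var_br (b * c)) p =
    deriv_ext (\<lambda>a. const_poly (br a b)) (var_br b) p * const_poly c +
    const_poly b * deriv_ext (\<lambda>a. const_poly (br a c)) (var_br c) p"
proof -
  have "deriv_ext (\<lambda>a. const_poly (br a (b * c))) (var_br (b * c)) p =
      deriv_ext (\<lambda>a. const_poly c * const_poly (br a b) + const_poly b * const_poly (br a c))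
        (const_poly c * var_br b + const_poly b * var_br c) p"
    by (simp add: br_leibniz var_br_simps mult_ac)
  also have "\<dots> = deriv_ext (\<lambda>a. const_poly c * const_poly (br a b)) (const_poly c * var_br b) p +
      deriv_ext (\<lambda>a. const_poly b * const_poly (br a c)) (const_poly b * var_br c) p"
    by (rule deriv_ext_fun_add) (simp_all add: zeros)
  also have "\<dots> = const_poly c * deriv_ext (\<lambda>a. const_poly (br a b)) (var_br b) p +
      const_poly b * deriv_ext (\<lambda>a. const_poly (br a c)) (var_br c) p"
    by (intro arg_cong2[where f = "(+)"] deriv_ext_fun_mult) (simp_all add: zeros)
  finally show ?thesis by (simp only: mult_ac)
qed

lemma poly_br_add_right: "poly_br p (q + r) = poly_br p q + poly_br p r"
  unfolding poly_br_def by (rule deriv_ext_add) (rule inner_add)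

lemma poly_br_mult_right: "poly_br p (q * r) = poly_br p q * r + q * poly_br p r"
  unfolding poly_br_def by (rule deriv_ext_mult) (rule inner_add inner_mult)+

lemma poly_br_add_left: "poly_br (p + q) r = poly_br p r + poly_br q r"
proof -
  have "deriv_ext (\<lambda>a. const_poly (br a b)) (var_br b) (p + q) =
      deriv_ext (\<lambda>a. const_poly (br a b)) (var_br b) p + deriv_ext (\<lambda>a. const_poly (br a b)) (var_br b) q" for b
    by (rule deriv_ext_add) (simp add: br_simps)
  moreover have "deriv_ext (\<lambda>a. - var_br a) 0 (p + q) = deriv_ext (\<lambda>a. - var_br a) 0 p + deriv_ext (\<lambda>a. - var_br a) 0 q"
    by (rule deriv_ext_add) (simp add: var_br_simps)
  ultimately show ?thesis
    unfolding poly_br_def by (simp add: deriv_ext_fun_add inner_zero)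
qed

lemma poly_br_mult_left: "poly_br (p * q) r = poly_br p r * q + p * poly_br q r"
proof -
  have "deriv_ext (\<lambda>a. const_poly (br a b)) (var_br b) (p * q) =
      q * deriv_ext (\<lambda>a. const_poly (br a b)) (var_br b) p + p * deriv_ext (\<lambda>a. const_poly (br a b)) (var_br b) q" for b
    by (subst deriv_ext_mult) (simp_all add: br_simps br_leibniz_left mult.commute)
  moreover have "deriv_ext (\<lambda>a. - var_br a) 0 (p * q) =
      q * deriv_ext (\<lambda>a. - var_br a) 0 p + p * deriv_ext (\<lambda>a. - var_br a) 0 q"
    by (subst deriv_ext_mult) (simp_all add: var_br_simps mult.commute)
  ultimately show ?thesis
    unfolding poly_br_def by (simp add: deriv_ext_fun_add deriv_ext_fun_mult inner_zero mult.commute)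
qed

lemma poly_br_const_const: "poly_br (const_poly a) (const_poly b) = const_poly (br a b)"
  unfolding poly_br_def by (subst deriv_ext_const, rule inner_zero) (simp add: deriv_ext_const zeros)

lemma poly_br_const_var: "poly_br (const_poly a) var_poly = - var_br a"
  unfolding poly_br_def
  by (subst deriv_ext_var, rule inner_zero) (simp_all add: deriv_ext_const zeros var_br_simps)

lemma poly_br_var_const: "poly_br var_poly (const_poly b) = var_br b"
  unfolding poly_br_def by (subst deriv_ext_const, rule inner_zero) (simp add: deriv_ext_var zeros)

lemma poly_br_var_var: "poly_br var_poly var_poly = 0"
  unfolding poly_br_def
  by (subst deriv_ext_var, rule inner_zero) (simp_all add: deriv_ext_var deriv_ext_const zeros var_br_simps)

lemma poly_br_anti: "poly_br p q = - poly_br q p"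
proof (induction p rule: poly_gen_induct)
  case (const a)
  show ?case
    by (induction q rule: poly_gen_induct)
      (simp_all add: poly_br_const_const poly_br_const_var poly_br_var_const poly_br_add_left poly_br_add_right poly_br_mult_left
        poly_br_mult_right br_anti[of a])
next
  case var
  show ?case
    by (induction q rule: poly_gen_induct)
      (simp_all add: poly_br_var_const poly_br_var_var poly_br_const_var poly_br_add_left poly_br_add_right poly_br_mult_left
        poly_br_mult_right)
qed (simp_all add: poly_br_add_left poly_br_add_right poly_br_mult_left poly_br_mult_right)

text \<open>Antisymmetry would leave a factor 2, so sums and products are treated directly: their
  squares vanish because the mixed terms cancel in pairs.\<close>

lemma poly_br_self: "poly_br p p = 0"
proof (induction p rule: poly_gen_induct)
  case (add p q)
  then show ?case using poly_br_anti[of p q] by (simp add: poly_br_add_left poly_br_add_right)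
next
  case (mult p q)
  then show ?case using poly_br_anti[of p q] by (simp add: poly_br_mult_left poly_br_mult_right)
qed (simp_all add: poly_br_const_const poly_br_var_var br_alternating)

lemma poly_br_minus_right: "poly_br p (- q) = - poly_br p q"
proof -
  have "poly_br p 0 = 0" using poly_br_add_right[of p 0 0] by simp
  then show ?thesis
    using poly_br_add_right[of p q "- q"] by (simp add: eq_neg_iff_add_eq_0 add.commute)
qed

lemma poly_br_scale_right: "poly_br p (ps c q) = ps c (poly_br p q)"
proof -
  \<comment> \<open>Scalars of the ground field are Poisson central, so the Leibniz rule for
    multiplication by \<open>scale c 1\<close> reduces to homogeneity.\<close>
  have "poly_br p (const_poly (scale c 1)) = 0"
  proof (induction p rule: poly_gen_induct)
    case (const a)
    show ?case by (simp add: poly_br_const_const br_simps zeros)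
  next
    case var
    show ?case by (simp add: poly_br_var_const var_br_def \<alpha>_\<delta>_simps zeros)
  qed (simp_all add: poly_br_add_left poly_br_mult_left)
  then show ?thesis
    using poly_br_mult_right[of p "const_poly (scale c 1)" q] by (simp add: poly_scale_eq)
qed

section \<open>The Jacobi identity on B[x]\<close>

definition jacobiator :: "'b poly \<Rightarrow> 'b poly \<Rightarrow> 'b poly \<Rightarrow> 'b poly" where
  "jacobiator p q r = poly_br p (poly_br q r) + poly_br q (poly_br r p) + poly_br r (poly_br p q)"

lemma jacobiator_rotate: "jacobiator p q r = jacobiator q r p"
  by (simp add: jacobiator_def)

lemma jacobiator_add: "jacobiator (p + p') q r = jacobiator p q r + jacobiator p' q r"
  by (simp add: jacobiator_def poly_br_add_left poly_br_add_right)

text \<open>The mixed products of two single brackets cancel by antisymmetry, leaving a derivation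
  in the first argument, and by rotation in each argument. The Jacobi identity may therefore be
  tested on generators.\<close>

lemma jacobiator_mult: "jacobiator (p * p') q r = jacobiator p q r * p' + p * jacobiator p' q r"
  using poly_br_anti[of q p] poly_br_anti[of q p']
  by (simp add: jacobiator_def poly_br_add_left poly_br_add_right poly_br_mult_left poly_br_mult_right algebra_simps)

lemma jacobiator_gen:
  assumes "\<And>a. jacobiator (const_poly a) q r = 0" "jacobiator var_poly q r = 0"
  shows "jacobiator p q r = 0"
  by (induction p rule: poly_gen_induct) (simp_all add: assms jacobiator_add jacobiator_mult)

lemma jacobiator_const: "jacobiator (const_poly a) (const_poly b) (const_poly c) = 0"
  by (simp add: jacobiator_def poly_br_const_const br_jacobi)

lemma var_br_eq: "var_br b = const_poly (\<alpha> b) * var_poly + const_poly (\<delta> b)"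
  by (simp add: var_br_def)

text \<open>The place where the conditions on \<open>\<alpha>\<close> and \<open>\<delta>\<close>
  enter: the coefficient of \<open>x\<close> vanishes because \<open>\<alpha>\<close> is a Poisson
  derivation, the constant term because of the twisted rule for
  \<open>\<delta> (br b c)\<close>.\<close>

lemma jacobiator_var1: "jacobiator var_poly (const_poly b) (const_poly c) = 0"
proof -
  have var_br: "poly_br (const_poly a) (var_br b) = const_poly (br a (\<alpha> b)) * var_poly - const_poly (\<alpha> b) * var_br a
      + const_poly (br a (\<delta> b))" for a b
    unfolding var_br_eq[of b] poly_br_add_right poly_br_mult_right poly_br_const_const poly_br_const_var by simp
  have "jacobiator var_poly (const_poly b) (const_poly c) =
      var_br (br b c) - poly_br (const_poly b) (var_br c) + poly_br (const_poly c) (var_br b)"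
    by (simp add: jacobiator_def poly_br_const_const poly_br_const_var poly_br_var_const poly_br_minus_right)
  also have "\<dots> = 0"
    unfolding var_br
    by (simp add: var_br_def \<alpha>_br \<delta>_br br_anti[of c] algebra_simps)
  finally show ?thesis .
qed

lemma jacobiator_var2: "jacobiator var_poly var_poly r = 0"
proof -
  have "poly_br 0 r = 0" "poly_br r 0 = 0" using poly_br_add_left[of 0 0 r] poly_br_add_right[of r 0 0] by auto
  then show ?thesis
    using poly_br_anti[of r var_poly] by (simp add: jacobiator_def poly_br_self poly_br_minus_right)
qed

lemma jacobiator_zero: "jacobiator p q r = 0"
proof (rule jacobiator_gen)
  have v: "jacobiator var_poly q r = 0" for q r
  proof (subst jacobiator_rotate, rule jacobiator_gen)
    show "jacobiator var_poly r var_poly = 0" for r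
      by (metis jacobiator_rotate jacobiator_var2)
    show "jacobiator (const_poly a) r var_poly = 0" for a
      by (subst jacobiator_rotate, rule jacobiator_gen)
        (metis jacobiator_rotate jacobiator_var1 jacobiator_var2)+
  qed
  then show "jacobiator var_poly q r = 0" .
  show "jacobiator (const_poly a) q r = 0" for a
  proof (subst jacobiator_rotate, rule jacobiator_gen)
    show "jacobiator var_poly r (const_poly a) = 0" by (rule v)
    show "jacobiator (const_poly b) r (const_poly a) = 0" for b
      by (subst jacobiator_rotate, rule jacobiator_gen) (simp_all add: jacobiator_const v)
  qed
qed

lemma poisson_algebra_poly_br: "poisson_algebra ps poly_br"
proof (intro poisson_algebra.intro poly.comm_algebra_axioms poisson_algebra_axioms.intro)
  fix p q r
  have "poly_br (ps c p) q = ps c (poly_br p q)" for c p q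
  proof -
    have "poly_br (ps c p) q = - ps c (poly_br q p)"
      using poly_br_anti[of "ps c p" q] by (simp add: poly_br_scale_right)
    then show ?thesis
      using poly_br_anti[of p q] by (simp add: poly_scale_eq)
  qed
  then show "Vector_Spaces.linear ps ps (\<lambda>p. poly_br p q)" "Vector_Spaces.linear ps ps (poly_br p)"
    by (simp_all add: linear_iff_lin_mod poly.vector_space_axioms lin_mod_def poly_br_add_left poly_br_add_right
      poly_br_scale_right)
  show "poly_br p p = 0" by (rule poly_br_self)
  show "poly_br p (poly_br q r) + poly_br q (poly_br r p) + poly_br r (poly_br p q) = 0"
    using jacobiator_zero[of p q r] by (simp add: jacobiator_def)
  show "poly_br p (q * r) = poly_br p q * r + q * poly_br p r" by (rule poly_br_mult_right)
qed

sublocale P: poisson_algebra ps poly_br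
  by (rule poisson_algebra_poly_br)

text \<open>A Poisson bracket is determined by its values on generators. Brackets of a constant with
  \<open>x\<close> follow from the prescribed ones by antisymmetry, and \<open>{x, x} = 0\<close>
  because the bracket is alternating.\<close>

lemma poisson_poly_bracket_eq: "poisson_poly_bracket scale br \<alpha> \<delta> = poly_br"
  unfolding poisson_poly_bracket_def
proof (rule the_equality, goal_cases)
  case 1
  show ?case
    using poisson_algebra_poly_br poly_br_const_const poly_br_var_const var_br_eq by simp
next
  case (2 Br)
  then interpret U: poisson_algebra ps Br by blast
  have 1: "Br (const_poly a) (const_poly b) = poly_br (const_poly a) (const_poly b)"
    "Br var_poly (const_poly b) = poly_br var_poly (const_poly b)" for a b
    using 2 by (simp_all add: poly_br_const_const poly_br_var_const var_br_eq)
  have 2: "Br p (const_poly b) = poly_br p (const_poly b)" for p b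
    by (induction p rule: poly_gen_induct)
      (simp_all add: 1 U.br_simps U.br_leibniz_left poly_br_add_left poly_br_mult_left)
  have 3: "Br p var_poly = poly_br p var_poly" for p
  proof (induction p rule: poly_gen_induct)
    case (const a)
    show ?case by (subst U.br_anti, subst poly_br_anti) (simp add: 1)
  qed (simp_all add: U.br_alternating poly_br_self U.br_simps U.br_leibniz_left poly_br_add_left poly_br_mult_left)
  have "Br p q = poly_br p q" for p q
    by (induction q rule: poly_gen_induct)
      (simp_all add: 2 3 U.br_simps U.br_leibniz poly_br_add_right poly_br_mult_right)
  then show ?case by (intro ext)
qed

end

section \<open>The Hopf structure on the Poisson polynomial algebra\<close>

definition tens_rep :: "('a \<Rightarrow> 'c) \<Rightarrow> ('a \<Rightarrow> 'c) \<Rightarrow> ('a \<times> 'a \<Rightarrow>\<^sub>0 'k::field) \<Rightarrow> ('c \<times> 'c \<Rightarrow>\<^sub>0 'k)" where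
  "tens_rep f h = lin_ext fs_scale (\<lambda>(a, b). gen (f a, h b))"

lemma tens_rep_simps:
  "tens_rep f h (u + v) = tens_rep f h u + tens_rep f h v"
  "tens_rep f h (fs_scale c u) = fs_scale c (tens_rep f h u)"
  "tens_rep f h (gen (a, b)) = gen (f a, h b)"
  by (simp_all add: tens_rep_def fs.lin_ext_add fs.lin_ext_fs_scale)

lemma (in comm_algebra) tens_rep_null:
  assumes f: "lin_mod s scale {0} f" and h: "lin_mod s scale {0} h" and u: "u \<in> null2 s"
  shows "tens_rep f h u \<in> null2 scale"
  by (rule N2.null2_mem[OF _ _ _ u])
    (auto simp: tens_rep_simps lin_mod_def[of fs_scale] intro!: N2.lin_mod_comp0[OF vector_space_axioms f gen2_lin(1)]
      N2.lin_mod_comp0[OF vector_space_axioms h gen2_lin(2)])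

lemma (in comm_algebra) tens_rep_cong:
  assumes f: "lin_mod s scale {0} f" and h: "lin_mod s scale {0} h" and u: "eqm (null2 s) u v"
  shows "eqm (null2 scale) (tens_rep f h u) (tens_rep f h v)"
proof (rule eqm_image[OF N2.mod_space_axioms _ tens_rep_null[OF f h] u])
  show "lin_mod fs_scale fs_scale (null2 scale) (tens_rep f h)"
    by (simp add: lin_mod_def tens_rep_simps)
qed

lemma (in comm_algebra) tens_map_cls:
  assumes f: "lin_mod s scale {0} f" and h: "lin_mod s scale {0} h"
  shows "tens_map scale f h (cls2 s u) = cls2 scale (tens_rep f h u)"
  unfolding tens_map_def tens_rep_def
  by (rule q_linear_cls[OF mod_space_null2 N2.mod_space_axioms mem_cls2 cls2_eq_iff])
    (metis tens_rep_null[OF f h] tens_rep_def)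

text \<open>Conditions stated on representatives, with \<open>S g\<close> in the role of
  \<open>g\<^sup>-\<^sup>1\<close>. The representative \<open>w\<close> is chosen with support in
  pairs from the kernel of \<open>\<epsilon>\<close>, so that the counit kills it term by
  term.\<close>

locale poisson_hopf_poly_data =
  poisson_poly_data scale br \<alpha> \<delta> + poisson_hopf_rep scale br d \<epsilon> S
  for scale :: "'k::field \<Rightarrow> 'b::comm_ring_1 \<Rightarrow> 'b" and br \<alpha> \<delta> d \<epsilon> S +
  fixes g :: 'b and w :: "'b \<times> 'b \<Rightarrow>\<^sub>0 'k" and \<eta> :: "'b \<Rightarrow> 'k"
  assumes d_g: "eqm (null2 scale) (d g) (gen (g, g))"
    and \<epsilon>_g: "\<epsilon> g = 1"
    and w_aug: "Poly_Mapping.keys w \<subseteq> {a. \<epsilon> a = 0} \<times> {b. \<epsilon> b = 0}"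
    and \<eta>_lin: "lin_mod scale (*) {0} \<eta>"
    and \<alpha>_left: "\<alpha> b = lin_ext scale (\<lambda>(b1, b2). scale (\<eta> b1) b2) (d b)"
    and \<alpha>_right: "\<alpha> b = lin_ext scale (\<lambda>(b1, b2). scale (\<eta> b2) b1) (d b) + br g b * S g"
    and d_\<delta>: "eqm (null2 scale)
      (d (\<delta> b) - tens_rep \<delta> (\<lambda>b. b) (d b) - tens_rep (\<lambda>b. g * b) \<delta> (d b))
      (bracket_rep w (d b) - d (\<alpha> b) \<odot> w)"
    and w_antipode: "lin_ext scale (\<lambda>(w1, w2). S w1 * w2) w = lin_ext scale (\<lambda>(w1, w2). S g * w1 * S w2) w"
    and w_cocycle: "eqm (null3 scale) (ext_right 1 w + comult_left d w) (ext_left g w + comult_right d w)"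
begin

lemma g_inv: "S g * g = 1" "g * S g = 1"
  using S_group_like[OF d_g \<epsilon>_g] by (simp_all add: mult.commute)

lemma \<eta>_simps: "\<eta> (a + b) = \<eta> a + \<eta> b" "\<eta> (scale c a) = c * \<eta> a"
  using lin_mod_add[OF \<eta>_lin] lin_mod_scale[OF \<eta>_lin] by auto

section \<open>How \<alpha> interacts with the comultiplication\<close>

lemma gen_lin_ext:
  "eqm (null2 scale) (gen (lin_ext scale f u, b)) (lin_ext fs_scale (\<lambda>x. gen (f x, b)) u)"
  "eqm (null2 scale) (gen (b, lin_ext scale f u)) (lin_ext fs_scale (\<lambda>x. gen (b, f x)) u)"
proof -
  have "lin_mod fs_scale fs_scale (null2 scale) (\<lambda>u. gen (lin_ext scale f u, b))"
    "lin_mod fs_scale fs_scale (null2 scale) (\<lambda>u. gen (b, lin_ext scale f u))"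
    using N2.lin_mod_comp0[OF vector_space_axioms lin_ext_lin0 gen2_lin(1)[of scale b]]
      N2.lin_mod_comp0[OF vector_space_axioms lin_ext_lin0 gen2_lin(2)[of scale b]] by auto
  then show "eqm (null2 scale) (gen (lin_ext scale f u, b)) (lin_ext fs_scale (\<lambda>x. gen (f x, b)) u)"
    "eqm (null2 scale) (gen (b, lin_ext scale f u)) (lin_ext fs_scale (\<lambda>x. gen (b, f x)) u)"
    by (auto intro: N2.free_ext[OF _ N2.lin_ext_lin])
qed

text \<open>Apply the contraction \<open>h = \<eta> \<otimes> Id \<otimes> Id\<close> to
  coassociativity. One side becomes \<open>\<eta>(b\<^sub>1) b\<^sub>2 \<otimes> b\<^sub>3 =
  \<alpha>(b\<^sub>1) \<otimes> b\<^sub>2\<close>, the other \<open>\<Delta>(\<eta>(b\<^sub>1)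
  b\<^sub>2) = \<Delta>(\<alpha>(b))\<close>.\<close>

lemma d_\<alpha>_left: "eqm (null2 scale) (d (\<alpha> b)) (tens_rep \<alpha> (\<lambda>b. b) (d b))"
proof -
  define h where "h = lin_ext fs_scale (\<lambda>(a, b, c). fs_scale (\<eta> a) (gen (b :: 'b, c :: 'b)))"
  have h: "h (u + v) = h u + h v" "h (fs_scale r u) = fs_scale r (h u)" for u v r
    by (simp_all add: h_def fs.lin_ext_add fs.lin_ext_fs_scale)
  have hgen: "h (gen (a, b, c)) = fs_scale (\<eta> a) (gen (b, c))" for a b c
    by (simp add: h_def)
  have hlin: "lin_mod fs_scale fs_scale (null2 scale) h"
    by (simp add: lin_mod_def h)
  have hnull: "h u \<in> null2 scale" if "u \<in> null3 scale" for u
  proof (rule N2.null3_mem[OF hlin _ _ _ that])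
    show "lin_mod scale fs_scale (null2 scale) (\<lambda>a. h (gen (a, b, c)))" for b c
      by (simp add: h_def lin_mod_def \<eta>_simps fs.scale_left_distrib del: fs_scale_single)
  qed (auto simp: h_def intro!: N2.lin_mod_scaled gen2_lin simp del: fs_scale_single)
  have l: "eqm (null2 scale) (h (comult_left d u)) (tens_rep \<alpha> (\<lambda>b. b) u)" for u
  proof (induction u rule: fs_induct)
    case (gen x)
    obtain a b where x: "x = (a, b)" by fastforce
    have "h (ext_right b v) = lin_ext fs_scale (\<lambda>(a1, a2). fs_scale (\<eta> a1) (gen (a2, b))) v" for v
      by (simp add: h_def ext_right_def fs.lin_ext_lin_ext case_prod_unfold)
    moreover have "eqm (null2 scale) (lin_ext fs_scale (\<lambda>(a1, a2). fs_scale (\<eta> a1) (gen (a2, b))) (d a))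
        (lin_ext fs_scale (\<lambda>x. gen ((\<lambda>(a1, a2). scale (\<eta> a1) a2) x, b)) (d a))"
      by (rule N2.lin_ext_eqm)
        (auto intro!: N2.eqm_sym[OF lin_mod_scale[OF gen2_lin(1)]] simp del: fs_scale_single)
    ultimately show ?case
      using N2.eqm_trans N2.eqm_sym gen_lin_ext(1)
      unfolding x comult_ext_simps tens_rep_simps \<alpha>_left[of a] by metis
  qed (simp_all add: comult_ext_simps h tens_rep_simps N2.eqm_add N2.eqm_scale)
  have r: "eqm (null2 scale) (h (comult_right d u)) (d (lin_ext scale (\<lambda>(b1, b2). scale (\<eta> b1) b2) u))" for u
  proof -
    have B: "lin_mod fs_scale fs_scale (null2 scale) (\<lambda>u. d (lin_ext scale (\<lambda>(b1, b2). scale (\<eta> b1) b2) u))"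
      by (rule N2.lin_mod_comp0[OF vector_space_axioms lin_ext_lin0 d_lin])
    have A: "lin_mod fs_scale fs_scale (null2 scale) (\<lambda>u. h (comult_right d u))"
      by (simp add: lin_mod_def h comult_ext_simps)
    have C: "eqm (null2 scale) (h (ext_left a v)) (fs_scale (\<eta> a) v)" for a v
    proof -
      have "h (ext_left a v) = fs_scale (\<eta> a) v"
        by (induction v rule: fs_induct)
          (auto simp: h hgen ext_simps fs.scale_right_distrib mult.commute simp del: fs_scale_single)
      then show ?thesis by simp
    qed
    show ?thesis
      by (rule N2.free_ext[OF A B]) (auto simp: comult_ext_simps intro: N2.eqm_trans[OF C N2.eqm_sym[OF lin_mod_scale[OF d_lin]]])
  qed
  have "eqm (null2 scale) (h (comult_left d (d b))) (h (comult_right d (d b)))"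
    by (rule eqm_image[OF N2.mod_space_axioms hlin hnull d_coassoc])
  then show ?thesis
    using l[of "d b"] r[of "d b"] unfolding \<alpha>_left[of b, symmetric]
    by (meson N2.eqm_sym N2.eqm_trans)
qed

text \<open>The part \<open>b\<^sub>1 \<eta>(b\<^sub>2)\<close> of the second formula for
  \<open>\<alpha>\<close>, isolated because it passes through the comultiplication in the second
  slot, whereas \<open>{g, b} g\<^sup>-\<^sup>1\<close> spreads over both slots.\<close>

definition \<beta> :: "'b \<Rightarrow> 'b" where
  "\<beta> b = lin_ext scale (\<lambda>(b1, b2). scale (\<eta> b2) b1) (d b)"

text \<open>The mirror image of the argument for \<open>\<alpha>\<close>, with the contraction
  \<open>h = Id \<otimes> Id \<otimes> \<eta>\<close>.\<close>

lemma d_\<beta>: "eqm (null2 scale) (d (\<beta> b)) (tens_rep (\<lambda>b. b) \<beta> (d b))"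
proof -
  define h where "h = lin_ext fs_scale (\<lambda>(a, b, c). fs_scale (\<eta> c) (gen (a :: 'b, b :: 'b)))"
  have h: "h (u + v) = h u + h v" "h (fs_scale r u) = fs_scale r (h u)" for u v r
    by (simp_all add: h_def fs.lin_ext_add fs.lin_ext_fs_scale)
  have hgen: "h (gen (a, b, c)) = fs_scale (\<eta> c) (gen (a, b))" for a b c
    by (simp add: h_def)
  have hlin: "lin_mod fs_scale fs_scale (null2 scale) h"
    by (simp add: lin_mod_def h)
  have hnull: "h u \<in> null2 scale" if "u \<in> null3 scale" for u
  proof (rule N2.null3_mem[OF hlin _ _ _ that])
    show "lin_mod scale fs_scale (null2 scale) (\<lambda>c. h (gen (a, b, c)))" for a b
      by (simp add: h_def lin_mod_def \<eta>_simps fs.scale_left_distrib del: fs_scale_single)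
  qed (auto simp: h_def intro!: N2.lin_mod_scaled gen2_lin simp del: fs_scale_single)
  have r: "eqm (null2 scale) (h (comult_right d u)) (tens_rep (\<lambda>b. b) \<beta> u)" for u
  proof (induction u rule: fs_induct)
    case (gen x)
    obtain a b where x: "x = (a, b)" by fastforce
    have "h (ext_left a v) = lin_ext fs_scale (\<lambda>(b1, b2). fs_scale (\<eta> b2) (gen (a, b1))) v" for v
      by (simp add: h_def ext_left_def fs.lin_ext_lin_ext case_prod_unfold)
    moreover have "eqm (null2 scale) (lin_ext fs_scale (\<lambda>(b1, b2). fs_scale (\<eta> b2) (gen (a, b1))) (d b))
        (lin_ext fs_scale (\<lambda>x. gen (a, (\<lambda>(b1, b2). scale (\<eta> b2) b1) x)) (d b))"
      by (rule N2.lin_ext_eqm)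
        (auto intro!: N2.eqm_sym[OF lin_mod_scale[OF gen2_lin(2)]] simp del: fs_scale_single)
    ultimately show ?case
      using N2.eqm_trans N2.eqm_sym gen_lin_ext(2)
      unfolding x comult_ext_simps tens_rep_simps \<beta>_def[of b] by metis
  qed (simp_all add: comult_ext_simps h tens_rep_simps N2.eqm_add N2.eqm_scale)
  have l: "eqm (null2 scale) (h (comult_left d u)) (d (lin_ext scale (\<lambda>(b1, b2). scale (\<eta> b2) b1) u))" for u
  proof -
    have B: "lin_mod fs_scale fs_scale (null2 scale) (\<lambda>u. d (lin_ext scale (\<lambda>(b1, b2). scale (\<eta> b2) b1) u))"
      by (rule N2.lin_mod_comp0[OF vector_space_axioms lin_ext_lin0 d_lin])
    have A: "lin_mod fs_scale fs_scale (null2 scale) (\<lambda>u. h (comult_left d u))"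
      by (simp add: lin_mod_def h comult_ext_simps)
    have C: "eqm (null2 scale) (h (ext_right a v)) (fs_scale (\<eta> a) v)" for a v
    proof -
      have "h (ext_right a v) = fs_scale (\<eta> a) v"
        by (induction v rule: fs_induct)
          (auto simp: h hgen ext_simps fs.scale_right_distrib mult.commute simp del: fs_scale_single)
      then show ?thesis by simp
    qed
    show ?thesis
      by (rule N2.free_ext[OF A B]) (auto simp: comult_ext_simps intro: N2.eqm_trans[OF C N2.eqm_sym[OF lin_mod_scale[OF d_lin]]])
  qed
  have "eqm (null2 scale) (h (comult_left d (d b))) (h (comult_right d (d b)))"
    by (rule eqm_image[OF N2.mod_space_axioms hlin hnull d_coassoc])
  then show ?thesis
    using r[of "d b"] l[of "d b"] unfolding \<beta>_def[of b, symmetric]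
    by (meson N2.eqm_sym N2.eqm_trans)
qed

text \<open>\<open>\<Delta>(g) \<Delta>(g\<^sup>-\<^sup>1) = \<Delta>(1)\<close>, and the factor
  \<open>g \<otimes> g\<close> is cancelled by its inverse.\<close>

lemma d_g_inv: "eqm (null2 scale) (d (S g)) (gen (S g, S g))"
proof -
  have "eqm (null2 scale) (gen (g, g) \<odot> d (S g)) (d g \<odot> d (S g))"
    by (intro eqm_fmul2 N2.eqm_sym[OF d_g] N2.eqm_refl)
  moreover have "eqm (null2 scale) (d g \<odot> d (S g)) (gen 1)"
    using N2.eqm_trans[OF N2.eqm_sym[OF d_mult[of g "S g"]]] d_one by (simp add: g_inv)
  ultimately have "eqm (null2 scale) (gen (g, g) \<odot> d (S g)) (gen 1)"
    by (rule N2.eqm_trans)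
  then have "eqm (null2 scale) (gen (S g, S g) \<odot> (gen (g, g) \<odot> d (S g))) (gen (S g, S g) \<odot> gen 1)"
    by (intro eqm_fmul2 N2.eqm_refl)
  moreover have "gen (S g, S g) \<odot> (gen (g, g) \<odot> d (S g)) = d (S g)"
    by (simp add: fmul_assoc[symmetric] fmul_gen g_inv flip: one_prod_def)
  ultimately show ?thesis by simp
qed

text \<open>Write \<open>\<alpha> = \<beta> + c\<close> with
  \<open>c b = {g, b} g\<^sup>-\<^sup>1\<close>. Since \<open>g \<otimes> g\<close> represents
  \<open>\<Delta>(g)\<close>, comultiplying \<open>c b\<close> gives \<open>b\<^sub>1 \<otimes>
  c(b\<^sub>2) + c(b\<^sub>1) \<otimes> b\<^sub>2\<close>; the first summand joins
  \<open>b\<^sub>1 \<otimes> \<beta>(b\<^sub>2)\<close> to form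
  \<open>b\<^sub>1 \<otimes> \<alpha>(b\<^sub>2)\<close>.\<close>

lemma d_\<alpha>_right:
  "eqm (null2 scale) (d (\<alpha> b)) (tens_rep (\<lambda>b. b) \<alpha> (d b) + tens_rep (\<lambda>b. br g b * S g) (\<lambda>b. b) (d b))"
proof -
  let ?c = "\<lambda>b. br g b * S g"
  have \<alpha>: "\<alpha> b = \<beta> b + ?c b" for b by (simp add: \<alpha>_right \<beta>_def)
  have 1: "bracket_rep (gen (g, g)) u \<odot> gen (S g, S g) = tens_rep (\<lambda>b. b) ?c u + tens_rep ?c (\<lambda>b. b) u" for u
  proof (induction u rule: fs_induct)
    case (gen x)
    have "g * a * S g = a" for a using g_inv by (metis mult.assoc mult.commute mult_1)
    then show ?case
      by (cases x) (simp add: bracket_rep_simps fmul_simps tens_rep_simps)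
  qed (simp_all add: bracket_rep_simps fmul_simps tens_rep_simps fs.scale_right_distrib)
  have 2: "eqm (null2 scale) (tens_rep (\<lambda>b. b) \<alpha> u) (tens_rep (\<lambda>b. b) \<beta> u + tens_rep (\<lambda>b. b) ?c u)" for u
  proof (induction u rule: fs_induct)
    case (gen x)
    show ?case
      by (cases x) (auto simp: tens_rep_simps \<alpha> intro: lin_mod_add[OF gen2_lin(2)])
  next
    case (add u v)
    then show ?case using N2.eqm_add[OF add] by (simp add: tens_rep_simps add_ac)
  next
    case (scale c u)
    then show ?case using N2.eqm_scale[OF scale, of c] by (simp add: tens_rep_simps fs.scale_right_distrib)
  qed
  have "eqm (null2 scale) (d (?c b)) (d (br g b) \<odot> d (S g))" by (rule d_mult)
  moreover have "eqm (null2 scale) (d (br g b) \<odot> d (S g)) (bracket_rep (gen (g, g)) (d b) \<odot> gen (S g, S g))"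
    by (intro eqm_fmul2 d_g_inv N2.eqm_trans[OF d_br] bracket_rep_cong d_g N2.eqm_refl)
  ultimately have "eqm (null2 scale) (d (?c b)) (tens_rep (\<lambda>b. b) ?c (d b) + tens_rep ?c (\<lambda>b. b) (d b))"
    unfolding 1 by (rule N2.eqm_trans)
  then have "eqm (null2 scale) (d (\<beta> b) + d (?c b))
      (tens_rep (\<lambda>b. b) \<beta> (d b) + (tens_rep (\<lambda>b. b) ?c (d b) + tens_rep ?c (\<lambda>b. b) (d b)))"
    by (intro N2.eqm_add d_\<beta>)
  then have "eqm (null2 scale) (d (\<alpha> b))
      (tens_rep (\<lambda>b. b) \<beta> (d b) + tens_rep (\<lambda>b. b) ?c (d b) + tens_rep ?c (\<lambda>b. b) (d b))"
    using N2.eqm_trans[OF lin_mod_add[OF d_lin, of "\<beta> b" "?c b"]] by (simp add: \<alpha> add.assoc)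
  moreover have "eqm (null2 scale)
      (tens_rep (\<lambda>b. b) \<beta> (d b) + tens_rep (\<lambda>b. b) ?c (d b) + tens_rep ?c (\<lambda>b. b) (d b))
      (tens_rep (\<lambda>b. b) \<alpha> (d b) + tens_rep ?c (\<lambda>b. b) (d b))"
    by (intro N2.eqm_add N2.eqm_sym[OF 2] N2.eqm_refl)
  ultimately show ?thesis by (rule N2.eqm_trans)
qed

section \<open>Embedding the tensor powers of B into those of B[x]\<close>

abbreviation "M2 \<equiv> null2 ps"
abbreviation "M3 \<equiv> null3 ps"

definition const_rep :: "('b \<times> 'b \<Rightarrow>\<^sub>0 'k) \<Rightarrow> ('b poly \<times> 'b poly \<Rightarrow>\<^sub>0 'k)" where
  "const_rep = tens_rep const_poly const_poly"

definition const_rep3 :: "('b \<times> 'b \<times> 'b \<Rightarrow>\<^sub>0 'k) \<Rightarrow> ('b poly \<times> 'b poly \<times> 'b poly \<Rightarrow>\<^sub>0 'k)" where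
  "const_rep3 = lin_ext fs_scale (\<lambda>(a, b, c). gen (const_poly a, const_poly b, const_poly c))"

lemma const_rep_simps:
  "const_rep (u + v) = const_rep u + const_rep v" "const_rep (fs_scale c u) = fs_scale c (const_rep u)" "const_rep (gen (a, b)) = gen (const_poly a, const_poly b)"
  by (simp_all add: const_rep_def tens_rep_simps)

lemma const_rep3_simps:
  "const_rep3 (u + v) = const_rep3 u + const_rep3 v" "const_rep3 (fs_scale r u) = fs_scale r (const_rep3 u)"
  "const_rep3 (gen (a, b, c)) = gen (const_poly a, const_poly b, const_poly c)"
  by (simp_all add: const_rep3_def fs.lin_ext_add fs.lin_ext_fs_scale)

lemma const_rep_diff: "const_rep (u - v) = const_rep u - const_rep v"
  using const_rep_simps(1)[of "u - v" v] by simp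

lemma const_lin: "lin_mod scale ps {0} const_poly"
  by (simp add: lin_mod_def poly_scale_const)

lemma const_rep_cong: "eqm (null2 scale) u v \<Longrightarrow> eqm M2 (const_rep u) (const_rep v)"
  unfolding const_rep_def by (rule poly.tens_rep_cong[OF const_lin const_lin])

lemma const_rep3_cong:
  assumes "eqm (null3 scale) u v"
  shows "eqm M3 (const_rep3 u) (const_rep3 v)"
proof (rule eqm_image[OF poly.N3.mod_space_axioms _ _ assms])
  show lin: "lin_mod fs_scale fs_scale M3 const_rep3"
    by (simp add: lin_mod_def const_rep3_simps)
  show "const_rep3 u \<in> M3" if "u \<in> null3 scale" for u
    by (rule poly.N3.null3_mem[OF lin _ _ _ that]; unfold const_rep3_simps;
        rule poly.N3.lin_mod_comp0[OF poly.vector_space_axioms const_lin]; rule gen3_lin)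
qed

lemma const_rep_fmul: "const_rep (u \<odot> v) = const_rep u \<odot> const_rep v"
proof (induction u rule: fs_induct)
  case (gen x)
  show ?case
    by (induction v rule: fs_induct; cases x)
      (auto simp: fmul_simps const_rep_simps mult.commute simp del: fs_scale_single)
qed (simp_all add: fmul_simps const_rep_simps)

lemma const_rep_bracket: "P.bracket_rep (const_rep u) (const_rep v) = const_rep (bracket_rep u v)"
proof (induction u rule: fs_induct)
  case (gen x)
  show ?case
    by (induction v rule: fs_induct; cases x)
      (auto simp: P.bracket_rep_simps bracket_rep_simps const_rep_simps poly_br_const_const mult.commute simp del: fs_scale_single)
qed (simp_all add: P.bracket_rep_simps bracket_rep_simps const_rep_simps)

lemma const_rep3_ext: "const_rep3 (ext_right c u) = ext_right (const_poly c) (const_rep u)" "const_rep3 (ext_left c u) = ext_left (const_poly c) (const_rep u)"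
  by (induction u rule: fs_induct; auto simp: ext_simps const_rep_simps const_rep3_simps simp del: fs_scale_single)+

lemma lin_ext_const_rep:
  assumes "\<And>a b. f (const_poly a, const_poly b) = const_poly (f' (a, b))"
  shows "lin_ext ps f (const_rep u) = const_poly (lin_ext scale f' u)"
  by (induction u rule: fs_induct)
    (auto simp: const_rep_simps assms lin_ext_add lin_ext_fs_scale poly.lin_ext_add poly.lin_ext_fs_scale
      poly_scale_const simp del: fs_scale_single)

section \<open>The comultiplication of B[x]\<close>

definition x_rep :: "'b poly \<times> 'b poly \<Rightarrow>\<^sub>0 'k" where
  "x_rep = gen (const_poly g, var_poly) + gen (var_poly, 1) + const_rep w"

text \<open>Horner evaluation at \<open>x_rep\<close>, with coefficients mapped by the embedded
  comultiplication of \<open>B\<close>.\<close>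

definition d' :: "'b poly \<Rightarrow> ('b poly \<times> 'b poly \<Rightarrow>\<^sub>0 'k)" where
  "d' p = fold_coeffs (\<lambda>a f. const_rep (d a) + x_rep \<odot> f) p 0"

lemma const_rep_d_0: "eqm M2 (const_rep (d 0)) 0"
  using const_rep_cong[OF N2.lin_mod_0[OF d_lin]] const_rep_simps(2)[of 0 0] by simp

text \<open>Only a congruence: on the zero polynomial the fold returns \<open>0\<close>, while the
  representative \<open>d 0\<close> is merely congruent to it.\<close>

lemma d'_pCons: "eqm M2 (d' (pCons a p)) (const_rep (d a) + x_rep \<odot> d' p)"
proof (cases "a = 0 \<and> p = 0")
  case True
  then show ?thesis using poly.N2.eqm_sym[OF const_rep_d_0] by (simp add: d'_def)
next
  case False
  then show ?thesis by (auto simp: d'_def)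
qed

lemma d'_const: "eqm M2 (d' (const_poly a)) (const_rep (d a))"
  using d'_pCons[of a 0] by (simp add: d'_def)

lemma const_rep_d_1: "eqm M2 (const_rep (d 1)) (gen 1)"
  using const_rep_cong[OF d_one] by (simp add: one_prod_def const_rep_simps flip: one_pCons)

lemma d'_one: "eqm M2 (d' 1) (gen 1)"
  using poly.N2.eqm_trans[OF d'_const const_rep_d_1] by (simp add: one_pCons)

lemma d'_var: "eqm M2 (d' var_poly) x_rep"
proof -
  have "eqm M2 (const_rep (d 0) + x_rep \<odot> d' 1) (0 + x_rep \<odot> gen 1)"
    by (intro poly.N2.eqm_add poly.eqm_fmul2 const_rep_d_0 d'_one poly.N2.eqm_refl)
  then show ?thesis
    using poly.N2.eqm_trans[OF d'_pCons[of 0 1]] by (simp add: one_pCons)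
qed

lemma d'_add: "eqm M2 (d' (p + q)) (d' p + d' q)"
proof (induction p q rule: poly_induct2)
  case 0
  then show ?case by (simp add: d'_def)
next
  case (pCons a p b q)
  have "eqm M2 (const_rep (d (a + b)) + x_rep \<odot> d' (p + q)) (const_rep (d a + d b) + x_rep \<odot> (d' p + d' q))"
    by (intro poly.N2.eqm_add poly.eqm_fmul2 const_rep_cong lin_mod_add[OF d_lin] pCons poly.N2.eqm_refl)
  then have "eqm M2 (d' (pCons a p + pCons b q)) (const_rep (d a + d b) + x_rep \<odot> (d' p + d' q))"
    using poly.N2.eqm_trans[OF d'_pCons] by simp
  moreover have "const_rep (d a + d b) + x_rep \<odot> (d' p + d' q) = const_rep (d a) + x_rep \<odot> d' p + (const_rep (d b) + x_rep \<odot> d' q)"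
    by (simp add: const_rep_simps fmul_simps add_ac)
  ultimately show ?case
    using poly.N2.eqm_trans poly.N2.eqm_sym[OF poly.N2.eqm_add[OF d'_pCons d'_pCons]] by metis
qed

lemma d'_smult: "eqm M2 (d' (smult a p)) (const_rep (d a) \<odot> d' p)"
proof (induction p)
  case 0
  show ?case by (simp add: d'_def)
next
  case (pCons b p)
  have "eqm M2 (const_rep (d (a * b)) + x_rep \<odot> d' (smult a p)) (const_rep (d a \<odot> d b) + x_rep \<odot> (const_rep (d a) \<odot> d' p))"
    by (intro poly.N2.eqm_add poly.eqm_fmul2 const_rep_cong d_mult pCons poly.N2.eqm_refl)
  then have "eqm M2 (d' (smult a (pCons b p))) (const_rep (d a) \<odot> (const_rep (d b) + x_rep \<odot> d' p))"
    using poly.N2.eqm_trans[OF d'_pCons] by (simp add: const_rep_fmul fmul_simps fmul_left_commute)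
  moreover have "eqm M2 (const_rep (d a) \<odot> (const_rep (d b) + x_rep \<odot> d' p)) (const_rep (d a) \<odot> d' (pCons b p))"
    by (intro poly.eqm_fmul2 poly.N2.eqm_refl poly.N2.eqm_sym[OF d'_pCons])
  ultimately show ?case by (rule poly.N2.eqm_trans)
qed

lemma d'_mult: "eqm M2 (d' (p * q)) (d' p \<odot> d' q)"
proof (induction p)
  case 0
  show ?case by (simp add: d'_def)
next
  case (pCons a p)
  have "eqm M2 (d' (pCons 0 (p * q))) (0 + x_rep \<odot> (d' p \<odot> d' q))"
    by (intro poly.N2.eqm_trans[OF d'_pCons] poly.N2.eqm_add const_rep_d_0 poly.eqm_fmul2 pCons poly.N2.eqm_refl)
  then have "eqm M2 (d' (smult a q) + d' (pCons 0 (p * q))) (const_rep (d a) \<odot> d' q + (0 + x_rep \<odot> (d' p \<odot> d' q)))"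
    by (intro poly.N2.eqm_add d'_smult)
  then have "eqm M2 (d' (pCons a p * q)) ((const_rep (d a) + x_rep \<odot> d' p) \<odot> d' q)"
    using poly.N2.eqm_trans[OF d'_add] by (simp add: fmul_simps fmul_assoc)
  moreover have "eqm M2 ((const_rep (d a) + x_rep \<odot> d' p) \<odot> d' q) (d' (pCons a p) \<odot> d' q)"
    by (intro poly.eqm_fmul2 poly.N2.eqm_refl poly.N2.eqm_sym[OF d'_pCons])
  ultimately show ?case by (rule poly.N2.eqm_trans)
qed

lemma d'_lin: "lin_mod ps fs_scale M2 d'"
proof (rule lin_modI[OF d'_add])
  fix c p
  have "eqm M2 (d' (ps c p)) (const_rep (d (scale c 1)) \<odot> d' p)"
    by (subst poly_scale_eq) (rule d'_smult)
  moreover have "eqm M2 (const_rep (d (scale c 1)) \<odot> d' p) (const_rep (fs_scale c (gen 1)) \<odot> d' p)"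
    by (intro poly.eqm_fmul2 const_rep_cong poly.N2.eqm_refl N2.eqm_trans[OF lin_mod_scale[OF d_lin]]
      N2.eqm_scale d_one)
  moreover have "const_rep (fs_scale c (gen 1)) \<odot> d' p = fs_scale c (gen 1 \<odot> d' p)"
    by (simp only: const_rep_simps fmul_scale_left one_prod_def one_pCons)
  ultimately show "eqm M2 (d' (ps c p)) (fs_scale c (d' p))"
    using poly.N2.eqm_trans by (metis fmul_one(1))
qed

section \<open>Counit and antipode of B[x]\<close>

definition \<epsilon>' :: "'b poly \<Rightarrow> 'k" where
  "\<epsilon>' p = \<epsilon> (coeff p 0)"

definition w_S :: 'b where
  "w_S = lin_ext scale (\<lambda>(w1, w2). S w1 * w2) w"

definition S' :: "'b poly \<Rightarrow> 'b poly" where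
  "S' p = fold_coeffs (\<lambda>a f. const_poly (S a) + (- (const_poly (S g) * var_poly) - const_poly w_S) * f) p 0"

lemma S_0: "S 0 = 0"
  using S_simps(1)[of 0 0] by simp

lemma S'_pCons: "S' (pCons a p) = const_poly (S a) + (- (const_poly (S g) * var_poly) - const_poly w_S) * S' p"
  by (cases "a = 0 \<and> p = 0") (auto simp: S'_def S_0)

lemma S'_0: "S' 0 = 0"
  by (simp add: S'_def)

lemma S'_const: "S' (const_poly a) = const_poly (S a)"
  by (simp only: S'_pCons S'_0) simp

lemma S'_one: "S' 1 = 1"
  by (simp only: one_pCons S'_const S_one)

lemma S'_var: "S' var_poly = - (const_poly (S g) * var_poly) - const_poly w_S"
  by (simp only: S'_pCons[of 0] S'_const S_one S_0) simp

lemma S'_add: "S' (p + q) = S' p + S' q"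
  by (induction p q rule: poly_induct2) (simp_all only: add_pCons S'_pCons S'_0 S_simps,
      simp_all add: S'_0 algebra_simps smult_add_right)

lemma S'_smult: "S' (smult a p) = const_poly (S a) * S' p"
  by (induction p) (simp_all only: smult_pCons smult_0_right S'_pCons S'_0 S_mult, simp_all add: algebra_simps smult_add_right)

lemma S'_mult: "S' (p * q) = S' p * S' q"
proof (induction p)
  case (pCons a p)
  then show ?case
    by (simp only: mult_pCons_left S'_add S'_smult S'_pCons S_0) (simp add: algebra_simps smult_add_right)
qed (simp add: S'_0)

lemma S'_lin: "lin_mod ps ps {0} S'"
proof -
  \<comment> \<open>The antipode fixes scalars, so homogeneity of \<open>S'\<close> is a case of its
    multiplicativity.\<close>
  have "S (scale c 1) = scale c 1" for c by (simp add: S_simps S_one)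
  then show ?thesis by (simp add: lin_mod_def S'_add poly_scale_eq S'_smult)
qed

lemma \<epsilon>'_lin: "lin_mod ps (*) {0} \<epsilon>'"
  by (simp add: lin_mod_def \<epsilon>'_def \<epsilon>_simps poly_scale_def coeff_map_poly)

lemma \<epsilon>'_simps: "\<epsilon>' (p + q) = \<epsilon>' p + \<epsilon>' q" "\<epsilon>' (ps c p) = c * \<epsilon>' p" "\<epsilon>' (p * q) = \<epsilon>' p * \<epsilon>' q"
  "\<epsilon>' (const_poly a) = \<epsilon> a" "\<epsilon>' var_poly = 0" "\<epsilon>' 1 = 1"
  using lin_mod_add[OF \<epsilon>'_lin] lin_mod_scale[OF \<epsilon>'_lin] \<epsilon>_simps(2)[of 0 0]
  by (simp_all add: \<epsilon>'_def \<epsilon>_mult \<epsilon>_one coeff_mult_0)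

text \<open>The common scheme of the counit and antipode axioms: a multiplicative contraction of
  \<open>d' p\<close> and the expected value \<open>T p\<close> are both additive and multiplicative
  in \<open>p\<close>, so they agree once they agree on constants and on \<open>x\<close>.\<close>

lemma lin_ext_d':
  assumes f: "\<And>q. lin_mod ps ps {0} (\<lambda>p. f (p, q))" "\<And>p. lin_mod ps ps {0} (\<lambda>q. f (p, q))"
    and mult: "\<And>s t. f (s * t) = f s * f t"
    and T: "\<And>p q. T (p + q) = T p + T q" "\<And>p q. T (p * q) = T p * T q"
    and const: "\<And>a. lin_ext ps f (const_rep (d a)) = T (const_poly a)" and var: "lin_ext ps f x_rep = T var_poly"
  shows "lin_ext ps f (d' p) = T p"
proof (induction p rule: poly_gen_induct)
  case (const a)
  show ?case
    unfolding assms(6)[symmetric] by (rule poly.lin_ext_null2[OF f d'_const])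
next
  case var
  show ?case
    unfolding assms(7)[symmetric] by (rule poly.lin_ext_null2[OF f d'_var])
next
  case (add p q)
  then show ?case
    using poly.lin_ext_null2[OF f d'_add[of p q]] by (simp add: poly.lin_ext_add T)
next
  case (mult p q)
  then show ?case
    using poly.lin_ext_null2[OF f d'_mult[of p q]] by (simp add: poly.lin_ext_fmul[OF assms(3)] T)
qed

lemma lin_ext_zero_keys: "(\<And>x. x \<in> Poly_Mapping.keys u \<Longrightarrow> f x = 0) \<Longrightarrow> lin_ext scale f u = 0"
  by (simp add: lin_ext_def)

lemma d'_counit_left: "lin_ext ps (\<lambda>(p, q). ps (\<epsilon>' p) q) (d' p) = p"
proof (rule lin_ext_d'[where T = "\<lambda>p. p"])
  let ?f = "\<lambda>(p, q). ps (\<epsilon>' p) q"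
  show "?f (s * t) = ?f s * ?f t" for s t
    by (cases s; cases t) (simp add: \<epsilon>'_simps poly.scale_out)
  have const_rep: "lin_ext ps ?f (const_rep u) = const_poly (lin_ext scale (\<lambda>(a, b). scale (\<epsilon> a) b) u)" for u
    by (rule lin_ext_const_rep) (simp add: \<epsilon>'_simps poly_scale_const)
  show "lin_ext ps ?f (const_rep (d a)) = const_poly a" for a
    by (simp add: const_rep d_counit_left)
  \<comment> \<open>Every pair in the support of \<open>w\<close> has
    \<open>\<epsilon> a = 0\<close>. Of the other terms of \<open>x_rep\<close>,
    \<open>g \<otimes> x\<close> gives \<open>x\<close> and \<open>x \<otimes> 1\<close> gives
    \<open>0\<close>.\<close>
  have "lin_ext scale (\<lambda>(a, b). scale (\<epsilon> a) b) w = 0"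
    using w_aug by (intro lin_ext_zero_keys) auto
  then show "lin_ext ps ?f x_rep = var_poly"
    by (simp add: x_rep_def poly.lin_ext_add const_rep \<epsilon>'_simps \<epsilon>_g)
qed (auto intro!: poly.lin0_I simp: \<epsilon>'_simps poly.scale_left_distrib poly.scale_right_distrib mult.commute)

lemma d'_counit_right: "lin_ext ps (\<lambda>(p, q). ps (\<epsilon>' q) p) (d' p) = p"
proof (rule lin_ext_d'[where T = "\<lambda>p. p"])
  let ?f = "\<lambda>(p, q). ps (\<epsilon>' q) p"
  show "?f (s * t) = ?f s * ?f t" for s t
    by (cases s; cases t) (simp add: \<epsilon>'_simps poly.scale_out mult.commute)
  have const_rep: "lin_ext ps ?f (const_rep u) = const_poly (lin_ext scale (\<lambda>(a, b). scale (\<epsilon> b) a) u)" for u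
    by (rule lin_ext_const_rep) (simp add: \<epsilon>'_simps poly_scale_const)
  show "lin_ext ps ?f (const_rep (d a)) = const_poly a" for a
    by (simp add: const_rep d_counit_right)
  have "lin_ext scale (\<lambda>(a, b). scale (\<epsilon> b) a) w = 0"
    using w_aug by (intro lin_ext_zero_keys) auto
  then show "lin_ext ps ?f x_rep = var_poly"
    by (simp add: x_rep_def poly.lin_ext_add const_rep \<epsilon>'_simps)
qed (auto intro!: poly.lin0_I simp: \<epsilon>'_simps poly.scale_left_distrib poly.scale_right_distrib mult.commute)

lemma S'_simps: "S' (p + q) = S' p + S' q" "S' (ps c p) = ps c (S' p)"
  using S'_add lin_mod_scale[OF S'_lin] by auto

text \<open>At \<open>x\<close> the sum is \<open>S g * x + S' x + w_S\<close>, zero by the choice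
  of \<open>S' x\<close>. The contraction is multiplicative because \<open>S'\<close> is and the
  ring is commutative.\<close>

lemma d'_antipode_left: "lin_ext ps (\<lambda>(p, q). S' p * q) (d' p) = ps (\<epsilon>' p) 1"
proof (rule lin_ext_d'[where T = "\<lambda>p. ps (\<epsilon>' p) 1"])
  let ?f = "\<lambda>(p, q). S' p * q"
  show "?f (s * t) = ?f s * ?f t" for s t
    by (cases s; cases t) (simp add: S'_mult mult_ac)
  have const_rep: "lin_ext ps ?f (const_rep u) = const_poly (lin_ext scale (\<lambda>(a, b). S a * b) u)" for u
    by (rule lin_ext_const_rep) (simp add: S'_const)
  show "lin_ext ps ?f (const_rep (d a)) = ps (\<epsilon>' (const_poly a)) 1" for a
    by (simp add: const_rep d_antipode_left \<epsilon>'_simps poly_scale_const one_pCons)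
  show "lin_ext ps ?f x_rep = ps (\<epsilon>' var_poly) 1"
    by (simp add: x_rep_def poly.lin_ext_add const_rep \<epsilon>'_simps S'_const S'_var w_S_def)
qed (auto intro!: poly.lin0_I simp: S'_simps \<epsilon>'_simps poly.scale_left_distrib poly.scale_out algebra_simps)

lemma d'_antipode_right: "lin_ext ps (\<lambda>(p, q). p * S' q) (d' p) = ps (\<epsilon>' p) 1"
proof (rule lin_ext_d'[where T = "\<lambda>p. ps (\<epsilon>' p) 1"])
  let ?f = "\<lambda>(p, q). p * S' q"
  show "?f (s * t) = ?f s * ?f t" for s t
    by (cases s; cases t) (simp add: S'_mult mult_ac)
  have const_rep: "lin_ext ps ?f (const_rep u) = const_poly (lin_ext scale (\<lambda>(a, b). a * S b) u)" for u
    by (rule lin_ext_const_rep) (simp add: S'_const)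
  show "lin_ext ps ?f (const_rep (d a)) = ps (\<epsilon>' (const_poly a)) 1" for a
    by (simp add: const_rep d_antipode_right \<epsilon>'_simps poly_scale_const one_pCons)
  have "w_S = lin_ext scale (\<lambda>x. S g * (case x of (w1, w2) \<Rightarrow> w1 * S w2)) w"
    unfolding w_S_def w_antipode by (simp add: case_prod_unfold mult.assoc)
  then have "w_S = S g * lin_ext scale (\<lambda>(w1, w2). w1 * S w2) w"
    by (simp only: lin_ext_mult_left)
  \<comment> \<open>Condition (iv) multiplied by \<open>g\<close>: it makes the constant terms of
    \<open>g * S' x + x + \<Sum> w\<^sub>1 S(w\<^sub>2)\<close> cancel.\<close>
  then have "g * w_S = lin_ext scale (\<lambda>(w1, w2). w1 * S w2) w"
    using g_inv(2) by (simp add: mult.assoc[symmetric])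
  \<comment> \<open>The coefficient of \<open>x\<close>: \<open>-1\<close> comes from
    \<open>g * S' x\<close>, \<open>1\<close> from \<open>x * S' 1\<close>.\<close>
  moreover have "const_poly (- 1 :: 'b) + 1 = 0" by (simp add: one_pCons)
  ultimately show "lin_ext ps ?f x_rep = ps (\<epsilon>' var_poly) 1"
    by (simp add: x_rep_def poly.lin_ext_add const_rep \<epsilon>'_simps S'_one S'_var g_inv)
qed (auto intro!: poly.lin0_I simp: S'_simps \<epsilon>'_simps poly.scale_left_distrib poly.scale_out algebra_simps)

section \<open>Coassociativity on B[x]\<close>

lemma comult_d'_const_rep:
  "eqm M3 (comult_left d' (const_rep u)) (const_rep3 (comult_left d u))"
  "eqm M3 (comult_right d' (const_rep u)) (const_rep3 (comult_right d u))"
proof -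
  show "eqm M3 (comult_left d' (const_rep u)) (const_rep3 (comult_left d u))"
  proof (induction u rule: fs_induct)
    case (gen x)
    show ?case
      by (cases x) (simp add: comult_ext_simps const_rep_simps const_rep3_ext poly.ext_cong(1)[OF d'_const])
  qed (simp_all add: comult_ext_simps const_rep_simps const_rep3_simps poly.N3.eqm_add poly.N3.eqm_scale)
  show "eqm M3 (comult_right d' (const_rep u)) (const_rep3 (comult_right d u))"
  proof (induction u rule: fs_induct)
    case (gen x)
    show ?case
      by (cases x) (simp add: comult_ext_simps const_rep_simps const_rep3_ext poly.ext_cong(2)[OF d'_const])
  qed (simp_all add: comult_ext_simps const_rep_simps const_rep3_simps poly.N3.eqm_add poly.N3.eqm_scale)
qed

lemma d'_coassoc: "eqm M3 (comult_left d' (d' p)) (comult_right d' (d' p))"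
proof (induction p rule: poly_gen_induct)
  case (const a)
  note cong = poly.comult_ext_cong[OF d'_lin d'_const[of a]]
  have "eqm M3 (comult_left d' (d' (const_poly a))) (const_rep3 (comult_left d (d a)))"
    by (rule poly.N3.eqm_trans[OF cong(1) comult_d'_const_rep(1)])
  moreover have "eqm M3 (comult_right d' (d' (const_poly a))) (const_rep3 (comult_right d (d a)))"
    by (rule poly.N3.eqm_trans[OF cong(2) comult_d'_const_rep(2)])
  ultimately show ?case
    using const_rep3_cong[OF d_coassoc[of a]] by (meson poly.N3.eqm_sym poly.N3.eqm_trans)
next
  case var
  note cong = poly.comult_ext_cong[OF d'_lin d'_var]
  have g: "eqm M2 (d' (const_poly g)) (gen (const_poly g, const_poly g))"
    using poly.N2.eqm_trans[OF d'_const const_rep_cong[OF d_g]] by (simp add: const_rep_simps)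
  \<comment> \<open>Applying \<open>d'\<close> to the first slot of each term of
    \<open>x_rep\<close>: \<open>g \<otimes> x\<close> gives
    \<open>g \<otimes> g \<otimes> x\<close>, \<open>x \<otimes> 1\<close> gives all of
    \<open>x_rep \<otimes> 1\<close>, and \<open>w\<close> stays over \<open>B\<close>. Both sides
    of coassociativity share three terms containing \<open>x\<close>; the remainders are the two
    sides of (v).\<close>
  have "eqm M3 (comult_left d' x_rep)
      (ext_right var_poly (gen (const_poly g, const_poly g)) + ext_right 1 x_rep + const_rep3 (comult_left d w))"
    unfolding x_rep_def comult_ext_simps
    by (intro poly.N3.eqm_add poly.ext_cong(1) g d'_var[unfolded x_rep_def] comult_d'_const_rep)
  also have "ext_right var_poly (gen (const_poly g, const_poly g)) + ext_right 1 x_rep + const_rep3 (comult_left d w) =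
      gen (const_poly g, const_poly g, var_poly) + gen (const_poly g, var_poly, 1) + gen (var_poly, 1, 1)
      + const_rep3 (ext_right 1 w + comult_left d w)"
    by (simp add: x_rep_def ext_simps const_rep3_simps const_rep3_ext add_ac flip: one_pCons)
  finally have l: "eqm M3 (comult_left d' x_rep) \<dots>" .
  have "eqm M3 (comult_right d' x_rep)
      (ext_left (const_poly g) x_rep + ext_left var_poly (gen 1) + const_rep3 (comult_right d w))"
    unfolding x_rep_def comult_ext_simps
    by (intro poly.N3.eqm_add poly.ext_cong(2) d'_one d'_var[unfolded x_rep_def] comult_d'_const_rep)
  also have "ext_left (const_poly g) x_rep + ext_left var_poly (gen 1) + const_rep3 (comult_right d w) =
      gen (const_poly g, const_poly g, var_poly) + gen (const_poly g, var_poly, 1) + gen (var_poly, 1, 1)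
      + const_rep3 (ext_left g w + comult_right d w)"
    by (simp add: x_rep_def ext_simps const_rep3_simps const_rep3_ext one_prod_def add_ac)
  finally have r: "eqm M3 (comult_right d' x_rep) \<dots>" .
  have "eqm M3 (comult_left d' x_rep) (comult_right d' x_rep)"
    using l r const_rep3_cong[OF w_cocycle] poly.N3.eqm_add[OF poly.N3.eqm_refl]
    by (meson poly.N3.eqm_sym poly.N3.eqm_trans)
  with cong show ?case by (meson poly.N3.eqm_sym poly.N3.eqm_trans)
next
  case (add p q)
  note cong = poly.comult_ext_cong[OF d'_lin d'_add[of p q]]
  have "eqm M3 (comult_left d' (d' p + d' q)) (comult_right d' (d' p + d' q))"
    using add by (simp add: comult_ext_simps poly.N3.eqm_add)
  with cong show ?case by (meson poly.N3.eqm_sym poly.N3.eqm_trans)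
next
  case (mult p q)
  note cong = poly.comult_ext_cong[OF d'_lin d'_mult[of p q]]
  note m = poly.comult_ext_fmul[OF d'_lin d'_mult]
  have "eqm M3 (comult_left d' (d' p \<odot> d' q)) (comult_right d' (d' p \<odot> d' q))"
    using m(1)[of "d' p" "d' q"] m(2)[of "d' p" "d' q"] poly.eqm_fmul3[OF mult]
    by (meson poly.N3.eqm_sym poly.N3.eqm_trans)
  with cong show ?case by (meson poly.N3.eqm_sym poly.N3.eqm_trans)
qed

lemma comm_hopf_rep_poly: "comm_hopf_rep ps d' \<epsilon>' S'"
  by unfold_locales
    (rule d'_lin d'_mult d'_one \<epsilon>'_lin \<epsilon>'_simps d'_coassoc d'_counit_left d'_counit_right S'_lin
      d'_antipode_left d'_antipode_right)+

section \<open>Compatibility of the comultiplication with the bracket\<close>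

lemma gen_var_br:
  "eqm M2 (gen (var_br a, q)) (gen (const_poly (\<alpha> a) * var_poly, q) + gen (const_poly (\<delta> a), q))"
  "eqm M2 (gen (q, var_br a)) (gen (q, const_poly (\<alpha> a) * var_poly) + gen (q, const_poly (\<delta> a)))"
  unfolding var_br_eq by (rule lin_mod_add[OF gen2_lin(1)] lin_mod_add[OF gen2_lin(2)])+

text \<open>As \<open>{1, b} = 0\<close>, only the first slot contributes, and
  \<open>{x, a} = \<alpha>(a) x + \<delta>(a)\<close> splits into a multiple of
  \<open>x \<otimes> 1\<close> and a term over \<open>B\<close>.\<close>

lemma bracket_left_var:
  "eqm M2 (P.bracket_rep (gen (var_poly, 1)) (const_rep u))
    (const_rep (tens_rep \<alpha> (\<lambda>b. b) u) \<odot> gen (var_poly, 1) + const_rep (tens_rep \<delta> (\<lambda>b. b) u))"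
proof (induction u rule: fs_induct)
  case (gen x)
  obtain a b where x: "x = (a, b)" by fastforce
  have "poly_br 1 (const_poly b) = 0"
    by (simp add: one_pCons poly_br_const_const zeros)
  then have "eqm M2 (P.bracket_rep (gen (var_poly, 1)) (const_rep (gen (a, b))))
      (0 + (gen (const_poly (\<alpha> a) * var_poly, const_poly b) + gen (const_poly (\<delta> a), const_poly b)))"
    unfolding const_rep_simps P.bracket_rep_simps poly_br_var_const
    using poly.N2.eqm_add[OF poly.N2.lin_mod_0[OF gen2_lin(2)] gen_var_br(1)] by simp
  then show ?case
    by (simp add: x tens_rep_simps const_rep_simps fmul_gen)
next
  case (add u v)
  then show ?case
    using poly.N2.eqm_add[OF add]
    by (simp add: tens_rep_simps const_rep_simps P.bracket_rep_simps fmul_simps add_ac)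
next
  case (scale c u)
  then show ?case
    using poly.N2.eqm_scale[OF scale, of c]
    by (simp add: tens_rep_simps const_rep_simps P.bracket_rep_simps fmul_simps fs.scale_right_distrib)
qed

text \<open>\<open>{g \<otimes> x, a \<otimes> b} = g a \<otimes> {x, b} + {g, a} \<otimes> x
  b\<close>. Writing \<open>{g, a} = g ({g, a} g\<^sup>-\<^sup>1)\<close> pulls out
  \<open>g \<otimes> x\<close>; the cofactor is then the expression to which
  \<open>\<Delta>(\<alpha>(b))\<close> was expanded on the right.\<close>

lemma bracket_right_var:
  "eqm M2 (P.bracket_rep (gen (const_poly g, var_poly)) (const_rep u))
    (const_rep (tens_rep (\<lambda>b. b) \<alpha> u + tens_rep (\<lambda>b. br g b * S g) (\<lambda>b. b) u) \<odot> gen (const_poly g, var_poly)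
      + const_rep (tens_rep (\<lambda>b. g * b) \<delta> u))"
proof (induction u rule: fs_induct)
  case (gen x)
  obtain a b where x: "x = (a, b)" by fastforce
  have *: "g * (br g a * S g) = br g a" using g_inv(2)
    by (metis mult.left_commute mult.right_neutral)
  show ?case
    unfolding x const_rep_simps P.bracket_rep_simps poly_br_var_const poly_br_const_const tens_rep_simps fmul_simps
    using poly.N2.eqm_add[OF gen_var_br(2)[of "const_poly g * const_poly a" b]
        poly.N2.eqm_refl[of "gen (const_poly (br g a), var_poly * const_poly b)"]]
    by (simp add: * mult.commute[of a g] add_ac)
next
  case (add u v)
  then show ?case
    using poly.N2.eqm_add[OF add]
    by (simp add: tens_rep_simps const_rep_simps P.bracket_rep_simps fmul_simps add_ac)
next
  case (scale c u)
  then show ?case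
    using poly.N2.eqm_scale[OF scale, of c]
    by (simp add: tens_rep_simps const_rep_simps P.bracket_rep_simps fmul_simps fs.scale_right_distrib)
qed

text \<open>The brackets of \<open>g \<otimes> x\<close> and \<open>x \<otimes> 1\<close> with
  \<open>\<Delta>(b)\<close> both have cofactor \<open>\<Delta>(\<alpha>(b))\<close>, by the two
  expansions of it. The terms over \<open>B\<close> match by (iii), whose summand
  \<open>- \<Delta>(\<alpha>(b)) w\<close> compensates for the \<open>w\<close> inside
  \<open>\<Delta>(\<alpha>(b)) \<Delta>'(x)\<close>.\<close>

lemma d'_br_var_const: "eqm M2 (d' (poly_br var_poly (const_poly b))) (P.bracket_rep x_rep (const_rep (d b)))"
proof -
  let ?G = "gen (const_poly g, var_poly) :: _ \<Rightarrow>\<^sub>0 'k" and ?V = "gen (var_poly, 1) :: _ \<Rightarrow>\<^sub>0 'k"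
  have "eqm M2 (P.bracket_rep x_rep (const_rep (d b)))
     (const_rep (d (\<alpha> b)) \<odot> ?G + const_rep (tens_rep (\<lambda>b. g * b) \<delta> (d b)) +
       (const_rep (d (\<alpha> b)) \<odot> ?V + const_rep (tens_rep \<delta> (\<lambda>b. b) (d b))) + const_rep (bracket_rep w (d b)))"
    unfolding x_rep_def P.bracket_rep_simps const_rep_bracket
    by (intro poly.N2.eqm_add poly.N2.eqm_refl poly.N2.eqm_trans[OF bracket_right_var]
        poly.N2.eqm_trans[OF bracket_left_var] poly.eqm_fmul2 const_rep_cong N2.eqm_sym[OF d_\<alpha>_left]
        N2.eqm_sym[OF d_\<alpha>_right])
  moreover have "eqm M2 (const_rep (d (\<delta> b)))
      (const_rep (tens_rep \<delta> (\<lambda>b. b) (d b)) + const_rep (tens_rep (\<lambda>b. g * b) \<delta> (d b)) + const_rep (bracket_rep w (d b))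
        - const_rep (d (\<alpha> b)) \<odot> const_rep w)"
  proof -
    have "eqm (null2 scale) (d (\<delta> b)) (tens_rep \<delta> (\<lambda>b. b) (d b) + tens_rep (\<lambda>b. g * b) \<delta> (d b) +
        bracket_rep w (d b) - d (\<alpha> b) \<odot> w)"
      using d_\<delta>[of b] by (simp add: eqm_def algebra_simps)
    from const_rep_cong[OF this] show ?thesis by (simp add: const_rep_simps const_rep_diff const_rep_fmul)
  qed
  moreover have "eqm M2 (d' (poly_br var_poly (const_poly b))) (const_rep (d (\<alpha> b)) \<odot> x_rep + const_rep (d (\<delta> b)))"
    unfolding poly_br_var_const var_br_eq
    by (intro poly.N2.eqm_trans[OF d'_add] poly.N2.eqm_add poly.N2.eqm_trans[OF d'_mult] poly.eqm_fmul2
        d'_const d'_var)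
  moreover have "const_rep (d (\<alpha> b)) \<odot> x_rep = const_rep (d (\<alpha> b)) \<odot> ?G + const_rep (d (\<alpha> b)) \<odot> ?V + const_rep (d (\<alpha> b)) \<odot> const_rep w"
    by (simp add: x_rep_def fmul_simps)
  ultimately have "eqm M2 (d' (poly_br var_poly (const_poly b)))
      (const_rep (d (\<alpha> b)) \<odot> ?G + const_rep (d (\<alpha> b)) \<odot> ?V + const_rep (d (\<alpha> b)) \<odot> const_rep w +
       (const_rep (tens_rep \<delta> (\<lambda>b. b) (d b)) + const_rep (tens_rep (\<lambda>b. g * b) \<delta> (d b)) + const_rep (bracket_rep w (d b))
        - const_rep (d (\<alpha> b)) \<odot> const_rep w))"
    and "eqm M2 (P.bracket_rep x_rep (const_rep (d b)))
     (const_rep (d (\<alpha> b)) \<odot> ?G + const_rep (d (\<alpha> b)) \<odot> ?V + const_rep (d (\<alpha> b)) \<odot> const_rep w +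
       (const_rep (tens_rep \<delta> (\<lambda>b. b) (d b)) + const_rep (tens_rep (\<lambda>b. g * b) \<delta> (d b)) + const_rep (bracket_rep w (d b))
        - const_rep (d (\<alpha> b)) \<odot> const_rep w))"
    using poly.N2.eqm_add[OF poly.N2.eqm_refl] poly.N2.eqm_trans by (metis, simp add: algebra_simps)
  then show ?thesis by (meson poly.N2.eqm_sym poly.N2.eqm_trans)
qed

text \<open>The elements \<open>p\<close> satisfying the claim against a fixed \<open>r\<close> are
  closed under sums and products. For a product, the Leibniz rule of \<open>bracket_rep\<close> is
  available in the second argument and is carried to the first by antisymmetry, which costs the two
  sign changes.\<close>

lemma d'_br_step:
  assumes "eqm M2 (d' (poly_br p r)) (P.bracket_rep (d' p) (d' r))"
    and "eqm M2 (d' (poly_br q r)) (P.bracket_rep (d' q) (d' r))"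
  shows "eqm M2 (d' (poly_br (p + q) r)) (P.bracket_rep (d' (p + q)) (d' r))"
    and "eqm M2 (d' (poly_br (p * q) r)) (P.bracket_rep (d' (p * q)) (d' r))"
proof -
  have "eqm M2 (d' (poly_br (p + q) r)) (P.bracket_rep (d' p + d' q) (d' r))"
    unfolding poly_br_add_left P.bracket_rep_simps
    by (intro poly.N2.eqm_trans[OF d'_add] poly.N2.eqm_add assms)
  moreover have "eqm M2 (P.bracket_rep (d' p + d' q) (d' r)) (P.bracket_rep (d' (p + q)) (d' r))"
    by (intro P.bracket_rep_cong poly.N2.eqm_sym[OF d'_add] poly.N2.eqm_refl)
  ultimately show "eqm M2 (d' (poly_br (p + q) r)) (P.bracket_rep (d' (p + q)) (d' r))"
    by (rule poly.N2.eqm_trans)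
  have "eqm M2 (d' (poly_br (p * q) r))
      (P.bracket_rep (d' p) (d' r) \<odot> d' q + d' p \<odot> P.bracket_rep (d' q) (d' r))"
    unfolding poly_br_mult_left
    by (intro poly.N2.eqm_trans[OF d'_add] poly.N2.eqm_add poly.N2.eqm_trans[OF d'_mult]
        poly.eqm_fmul2 assms poly.N2.eqm_refl)
  moreover have "eqm M2 (P.bracket_rep (d' p \<odot> d' q) (d' r))
      (- (P.bracket_rep (d' r) (d' p) \<odot> d' q + d' p \<odot> P.bracket_rep (d' r) (d' q)))"
    by (intro poly.N2.eqm_trans[OF P.bracket_rep_anti] poly.N2.eqm_minus P.bracket_rep_leibniz)
  moreover have "eqm M2 (- (P.bracket_rep (d' r) (d' p) \<odot> d' q + d' p \<odot> P.bracket_rep (d' r) (d' q)))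
      (P.bracket_rep (d' p) (d' r) \<odot> d' q + d' p \<odot> P.bracket_rep (d' q) (d' r))"
  proof -
    have "eqm M2 (- P.bracket_rep (d' r) (d' p) \<odot> d' q + d' p \<odot> - P.bracket_rep (d' r) (d' q))
      (P.bracket_rep (d' p) (d' r) \<odot> d' q + d' p \<odot> P.bracket_rep (d' q) (d' r))"
      by (intro poly.N2.eqm_add poly.eqm_fmul2 poly.N2.eqm_refl poly.N2.eqm_sym[OF P.bracket_rep_anti])
    moreover have "- u \<odot> v = - (u \<odot> v)" "v \<odot> - u = - (v \<odot> u)" for u v :: "'b poly \<times> 'b poly \<Rightarrow>\<^sub>0 'k"
      using fmul_scale_left[of "-1" u v] fmul_scale_right[of v "-1" u] by simp_all
    ultimately show ?thesis by simp
  qed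
  moreover have "eqm M2 (P.bracket_rep (d' p \<odot> d' q) (d' r)) (P.bracket_rep (d' (p * q)) (d' r))"
    by (intro P.bracket_rep_cong poly.N2.eqm_sym[OF d'_mult] poly.N2.eqm_refl)
  ultimately show "eqm M2 (d' (poly_br (p * q) r)) (P.bracket_rep (d' (p * q)) (d' r))"
    by (meson poly.N2.eqm_sym poly.N2.eqm_trans)
qed

lemma d'_br_anti:
  assumes "eqm M2 (d' (poly_br p q)) (P.bracket_rep (d' p) (d' q))"
  shows "eqm M2 (d' (poly_br q p)) (P.bracket_rep (d' q) (d' p))"
proof -
  have "eqm M2 (d' (poly_br q p)) (- d' (poly_br p q))"
    using poly.N2.lin_mod_uminus[OF d'_lin, of "poly_br p q"] poly_br_anti[of q p] by simp
  moreover have "eqm M2 (- d' (poly_br p q)) (- P.bracket_rep (d' p) (d' q))"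
    by (rule poly.N2.eqm_minus[OF assms])
  ultimately show ?thesis
    using P.bracket_rep_anti[of "d' q" "d' p"] by (meson poly.N2.eqm_sym poly.N2.eqm_trans)
qed

text \<open>Closure in the first argument settles the claim against a constant and against
  \<open>x\<close>; antisymmetry exchanges the arguments, and a second induction handles arbitrary
  pairs.\<close>

lemma d'_br: "eqm M2 (d' (poly_br p q)) (P.bracket_rep (d' p) (d' q))"
proof -
  have cc: "eqm M2 (d' (poly_br (const_poly a) (const_poly b))) (P.bracket_rep (d' (const_poly a)) (d' (const_poly b)))" for a b
  proof -
    have "eqm M2 (d' (poly_br (const_poly a) (const_poly b))) (P.bracket_rep (const_rep (d a)) (const_rep (d b)))"
      unfolding poly_br_const_const const_rep_bracket
      by (rule poly.N2.eqm_trans[OF d'_const const_rep_cong[OF d_br]])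
    then show ?thesis
      using P.bracket_rep_cong[OF d'_const[of a] d'_const[of b]]
      by (meson poly.N2.eqm_sym poly.N2.eqm_trans)
  qed
  have vc: "eqm M2 (d' (poly_br var_poly (const_poly b))) (P.bracket_rep (d' var_poly) (d' (const_poly b)))" for b
    using d'_br_var_const[of b] P.bracket_rep_cong[OF d'_var d'_const[of b]]
    by (meson poly.N2.eqm_sym poly.N2.eqm_trans)
  have vv: "eqm M2 (d' (poly_br var_poly var_poly)) (P.bracket_rep (d' var_poly) (d' var_poly))"
    using P.bracket_rep_alternating[of "d' var_poly"] poly.N2.lin_mod_0[OF d'_lin] poly_br_self
    by (metis poly.N2.eqm_sym poly.N2.eqm_trans)
  have c: "eqm M2 (d' (poly_br p (const_poly b))) (P.bracket_rep (d' p) (d' (const_poly b)))" for p b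
    by (induction p rule: poly_gen_induct) (auto intro: cc vc d'_br_step)
  have v: "eqm M2 (d' (poly_br p var_poly)) (P.bracket_rep (d' p) (d' var_poly))" for p
    by (induction p rule: poly_gen_induct) (auto intro: d'_br_anti[OF vc] vv d'_br_step)
  have "eqm M2 (d' (poly_br q p)) (P.bracket_rep (d' q) (d' p))"
    by (induction q rule: poly_gen_induct) (auto intro: d'_br_anti[OF c] d'_br_anti[OF v] d'_br_step)
  then show ?thesis by (rule d'_br_anti)
qed

lemma poisson_hopf_rep_poly: "poisson_hopf_rep ps poly_br d' \<epsilon>' S'"
  by (intro poisson_hopf_rep.intro poisson_hopf_rep_axioms.intro poisson_algebra_poly_br comm_hopf_rep_poly d'_br)

text \<open>Comultiplication and counit are algebra maps, hence determined on generators. The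
  antipode carries no prescribed value at \<open>x\<close>; it is determined as the convolution
  inverse of the identity.\<close>

lemma hopf_unique:
  assumes "comm_hopf_rep ps d'' \<epsilon>'' S''"
    and "\<And>b. eqm M2 (d'' (const_poly b)) (const_rep (d b))" and "eqm M2 (d'' var_poly) x_rep"
    and "\<And>b. \<epsilon>'' (const_poly b) = \<epsilon> b" and "\<epsilon>'' var_poly = 0"
  shows "eqm M2 (d'' p) (d' p)" and "\<epsilon>'' = \<epsilon>'" and "S'' = S'"
proof -
  interpret H: comm_hopf_rep ps d'' \<epsilon>'' S'' by fact
  show d: "eqm M2 (d'' p) (d' p)" for p
  proof (induction p rule: poly_gen_induct)
    case (const a)
    show ?case by (rule poly.N2.eqm_trans[OF assms(2) poly.N2.eqm_sym[OF d'_const]])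
  next
    case var
    show ?case by (rule poly.N2.eqm_trans[OF assms(3) poly.N2.eqm_sym[OF d'_var]])
  next
    case (add p q)
    then show ?case
      by (meson lin_mod_add[OF H.d_lin] d'_add poly.N2.eqm_add poly.N2.eqm_sym poly.N2.eqm_trans)
  next
    case (mult p q)
    then show ?case
      by (meson H.d_mult d'_mult poly.eqm_fmul2 poly.N2.eqm_sym poly.N2.eqm_trans)
  qed
  have "\<epsilon>'' p = \<epsilon>' p" for p
    by (induction p rule: poly_gen_induct)
      (simp_all add: assms(4,5) \<epsilon>'_simps H.\<epsilon>_simps H.\<epsilon>_mult)
  then show e: "\<epsilon>'' = \<epsilon>'" by (rule ext)
  \<comment> \<open>\<open>d''\<close> and \<open>d'\<close> represent the same comultiplication, so
    \<open>S'\<close> is an antipode for \<open>d''\<close> too and can be compared with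
    \<open>S''\<close>.\<close>
  have "comm_hopf_rep ps d'' \<epsilon>' S'"
    by (rule comm_hopf_rep_cong[OF comm_hopf_rep_poly d])
  then show "S'' = S'"
    using H.S_unique[of S'] by (simp add: e)
qed

end

section \<open>Return from representatives to cosets\<close>

theorem proposition4p3:
  fixes scale :: "'k::field \<Rightarrow> 'b::comm_ring_1 \<Rightarrow> 'b"
    and br :: "'b \<Rightarrow> 'b \<Rightarrow> 'b"
    and \<Delta> :: "'b \<Rightarrow> ('b \<times> 'b \<Rightarrow>\<^sub>0 'k) set"
    and \<epsilon> :: "'b \<Rightarrow> 'k"
    and S \<alpha> \<delta> :: "'b \<Rightarrow> 'b"
    and g :: 'b
    and w :: "('b \<times> 'b \<Rightarrow>\<^sub>0 'k) set"
    and \<eta> :: "'b \<Rightarrow> 'k"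
  assumes B: "poisson_hopf_algebra scale br \<Delta> \<epsilon> S"
    and \<alpha>: "poisson_derivation scale br \<alpha>"
    and \<delta>: "algebra_derivation scale \<delta>"
    and \<alpha>_\<delta>: "\<And>a b. \<delta> (br a b) = br (\<delta> a) b + br a (\<delta> b) + \<alpha> a * \<delta> b - \<delta> a * \<alpha> b"
    and g: "group_like scale \<Delta> \<epsilon> g"
    and w: "w \<in> aug_tensor2 scale \<epsilon>"
    and \<eta>: "Vector_Spaces.linear scale (*) \<eta>"
    and i_left: "\<And>b. \<alpha> b = eval2 scale (\<lambda>b1 b2. scale (\<eta> b1) b2) (\<Delta> b)"
    and i_right: "\<And>b. \<alpha> b = eval2 scale (\<lambda>b1 b2. scale (\<eta> b2) b1) (\<Delta> b) + br g b * ring_inv g"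
    and ii_mult: "\<And>a b. \<eta> (a * b) = \<epsilon> a * \<eta> b + \<epsilon> b * \<eta> a"
    and ii_br: "\<And>a b. \<eta> (br a b) = 0"
    and iii: "\<And>b. minus2 scale
                     (minus2 scale (\<Delta> (\<delta> b)) (tens_map scale \<delta> (\<lambda>b2. b2) (\<Delta> b)))
                     (tens_map scale (\<lambda>b1. g * b1) \<delta> (\<Delta> b))
                 = minus2 scale (bracket2 scale br w (\<Delta> b)) (mult2 scale (\<Delta> (\<alpha> b)) w)"
    and iv: "eval2 scale (\<lambda>w1 w2. S w1 * w2) w
             = eval2 scale (\<lambda>w1 w2. ring_inv g * w1 * S w2) w"
    and v: "add3 scale (tens_right scale w 1) (left3 scale \<Delta> w)
            = add3 scale (tens_left scale g w) (right3 scale \<Delta> w)"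
  shows "\<exists>!H. case H of (\<Delta>', \<epsilon>', S') \<Rightarrow>
           poisson_hopf_algebra (poly_scale scale) (poisson_poly_bracket scale br \<alpha> \<delta>) \<Delta>' \<epsilon>' S' \<and>
           (\<forall>b. \<Delta>' (const_poly b) = tens_map (poly_scale scale) const_poly const_poly (\<Delta> b)) \<and>
           (\<forall>b. \<epsilon>' (const_poly b) = \<epsilon> b) \<and>
           (\<forall>b. S' (const_poly b) = const_poly (S b)) \<and>
           \<epsilon>' var_poly = 0 \<and>
           \<Delta>' var_poly =
             add2 (poly_scale scale)
               (add2 (poly_scale scale)
                 (tens (poly_scale scale) (const_poly g) var_poly)
                 (tens (poly_scale scale) var_poly 1))
               (tens_map (poly_scale scale) const_poly const_poly w)"
proof -
  interpret B: poisson_hopf_algebra scale br \<Delta> \<epsilon> S by (rule B)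
  obtain d where \<Delta>: "\<Delta> = (\<lambda>a. cls2 scale (d a))" by (rule B.obtain_rep)
  interpret R: poisson_hopf_rep scale br d \<epsilon> S
    using B by (simp add: \<Delta> poisson_hopf_algebra_iff)
  obtain w0 where w0: "w = cls2 scale w0"
    and keys: "Poly_Mapping.keys w0 \<subseteq> {a. \<epsilon> a = 0} \<times> {b. \<epsilon> b = 0}"
    using w by (auto simp: aug_tensor2_def)
  have g': "eqm (null2 scale) (d g) (gen (g, g))" "\<epsilon> g = 1"
    using g by (auto simp: group_like_def tens_def \<Delta> cls2_eq_iff)
  have g_inv: "g * S g = 1"
    using R.S_group_like[OF g'] by (simp add: mult.commute)
  \<comment> \<open>Inverses in a commutative ring are unique, so the description picks the one
    supplied by the antipode.\<close>
  then have ring_inv: "ring_inv g = S g"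
    unfolding ring_inv_def by (intro the_equality) (metis mult.assoc mult.commute mult_1)+
  have \<eta>': "lin_mod scale (*) {0} \<eta>" by (rule linear_imp_lin_mod[OF \<eta>])
  have \<delta>': "lin_mod scale scale {0} \<delta>"
    using \<delta> by (auto simp: algebra_derivation_def intro: linear_imp_lin_mod)
  have id': "lin_mod scale scale {0} (\<lambda>b. b)" by (simp add: lin_mod_def)
  interpret H: poisson_hopf_poly_data scale br \<alpha> \<delta> d \<epsilon> S g w0 \<eta>
  proof unfold_locales
    show "poisson_derivation scale br \<alpha>" "algebra_derivation scale \<delta>" "lin_mod scale (*) {0} \<eta>"
      "\<epsilon> g = 1" "eqm (null2 scale) (d g) (gen (g, g))"
      "Poly_Mapping.keys w0 \<subseteq> {a. \<epsilon> a = 0} \<times> {b. \<epsilon> b = 0}"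
      by (fact \<alpha> \<delta> \<eta>' g' keys)+
    fix a b
    show "\<delta> (br a b) = br (\<delta> a) b + br a (\<delta> b) + \<alpha> a * \<delta> b - \<delta> a * \<alpha> b" by (rule \<alpha>_\<delta>)
    show "\<alpha> b = lin_ext scale (\<lambda>(b1, b2). scale (\<eta> b1) b2) (d b)"
      using i_left[of b] by (simp add: \<Delta> B.eval2_counit[OF \<eta>'])
    show "\<alpha> b = lin_ext scale (\<lambda>(b1, b2). scale (\<eta> b2) b1) (d b) + br g b * S g"
      using i_right[of b] by (simp add: \<Delta> B.eval2_counit[OF \<eta>'] ring_inv)
    show "eqm (null2 scale) (d (\<delta> b) - tens_rep \<delta> (\<lambda>b. b) (d b) - tens_rep (\<lambda>b. g * b) \<delta> (d b))
        (B.bracket_rep w0 (d b) - d (\<alpha> b) \<odot> w0)"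
      using iii[of b]
      by (simp add: \<Delta> w0 B.tens_map_cls[OF \<delta>' id'] B.tens_map_cls[OF B.mult_lin0(1) \<delta>']
          minus2_cls B.bracket2_cls B.mult2_cls cls2_eq_iff)
    show "lin_ext scale (\<lambda>(w1, w2). S w1 * w2) w0 = lin_ext scale (\<lambda>(w1, w2). S g * w1 * S w2) w0"
    proof -
      have "eval2 scale (\<lambda>w1 w2. S g * w1 * S w2) w = lin_ext scale (\<lambda>(w1, w2). S g * w1 * S w2) w0"
        unfolding w0
        by (rule B.eval2_cls) (auto intro!: B.lin0_I simp: R.S_simps algebra_simps B.scale_out)
      then show ?thesis
        using iv by (simp add: w0 ring_inv B.eval2_antipode[OF R.S_lin])
    qed
    show "eqm (null3 scale) (ext_right 1 w0 + comult_left d w0) (ext_left g w0 + comult_right d w0)"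
      using v by (simp add: \<Delta> w0 B.tens_right_cls B.tens_left_cls B.left3_right3_cls[OF R.d_lin]
          add3_cls cls3_eq_iff)
  qed
  let ?ps = "poly_scale scale"
  have embed: "tens_map ?ps const_poly const_poly (cls2 scale u) = cls2 ?ps (H.const_rep u)" for u
    unfolding H.const_rep_def by (rule H.poly.tens_map_cls[OF H.const_lin H.const_lin])
  have var: "add2 ?ps (add2 ?ps (tens ?ps (const_poly g) var_poly) (tens ?ps var_poly 1))
      (tens_map ?ps const_poly const_poly w) = cls2 ?ps H.x_rep"
    by (simp add: w0 embed tens_def add2_cls H.x_rep_def)
  show ?thesis
    unfolding H.poisson_poly_bracket_eq var
  proof (rule ex1I[of _ "(\<lambda>p. cls2 ?ps (H.d' p), H.\<epsilon>', H.S')"], goal_cases)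
    case 1
    show ?case
      using H.poisson_hopf_rep_poly
      by (simp add: poisson_hopf_algebra_iff \<Delta> embed cls2_eq_iff H.d'_const H.d'_var H.\<epsilon>'_simps H.S'_const)
  next
    case (2 K)
    obtain \<Delta>'' \<epsilon>'' S'' where K: "K = (\<Delta>'', \<epsilon>'', S'')" by (cases K)
    with 2 interpret K: poisson_hopf_algebra ?ps H.poly_br \<Delta>'' \<epsilon>'' S'' by simp
    obtain d'' where \<Delta>'': "\<Delta>'' = (\<lambda>p. cls2 ?ps (d'' p))" by (rule K.obtain_rep)
    have K_rep: "comm_hopf_rep ?ps d'' \<epsilon>'' S''"
      using K.comm_hopf_algebra_axioms by (simp add: \<Delta>'' comm_hopf_algebra_iff)
    have "eqm (null2 ?ps) (d'' (const_poly b)) (H.const_rep (d b))"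
      "eqm (null2 ?ps) (d'' var_poly) H.x_rep" "\<epsilon>'' (const_poly b) = \<epsilon> b" "\<epsilon>'' var_poly = 0" for b
      using 2 by (simp_all add: K \<Delta> \<Delta>'' embed cls2_eq_iff)
    note unique = H.hopf_unique[OF K_rep this]
    have "\<Delta>'' = (\<lambda>p. cls2 ?ps (H.d' p))"
      unfolding \<Delta>'' by (rule ext) (simp only: cls2_eq_iff unique(1))
    with unique(2,3) show ?case by (simp add: K)
  qed
qed

end
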